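(* There is a set $\mathcal{L}$ of linear maps $L:\mathbb{R}^d\to\mathbb{R}^{k-d}$ (identified with a subset of $\mathbb{R}^{d(k-d)}$ via their matrix entries $\alpha_{ij}$) of Hausdorff dimension $d(k-d)$ with the following property. For every $L\in\mathcal{L}$, the graph $E$ of $L$ is totally irrational, and for every admissible choice of $F_0$, $\Omega$ and regular $s$, and every window $\mathcal{W}$ that is a parallelotope generated by vectors in $F\cap\mathbb{Z}^k$, there exists a constant $C$ such that \[\#\xi_1(r)\le C\quad\text{and}\quad\#\xi_2(r)\le C\quad\text{for all } r\ge 0.\]
   Context: Fix integers $1\le d<k$. For $x\in\mathbb{R}^m$, $|x|=\max_i|x_i|$. Let $L:\mathbb{R}^d\to\mathbb{R}^{k-d}$ be linear, $L(x)=Ax$ with $A=(\alpha_{ij})$, and let $E=\{(x,L(x)):x\in\mathbb{R}^d\}\subseteq\mathbb{R}^k$. We say $E$ is totally irrational if $E+\mathbb{Z}^k$ is dense in $\mathbb{R}^k$. Let $F=\{0\}\times\mathbb{R}^{k-d}$, and let $F_0$ be a subspace complementary to $E$ with $F_0\cap\mathbb{Z}^k=\{0\}$. Denote by $\pi_1:\mathbb{R}^k\to E$ the projection along $F_0$, by $\pi_2:\mathbb{R}^k\to E$ the projection along $F$, and by $\pi^*:\mathbb{R}^k\to F$ the projection along $E$. A window is a compact $\mathcal{W}\subseteq F$ equal to the closure of its interior (in $F$). The strip is $\mathcal{S}=(\pi^* )^{-1}(\mathcal{W})$. A point $s\in\mathbb{R}^k$ is regular if $(\mathbb{Z}^k+s)\cap\partial\mathcal{S}=\emptyset$.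 The cut and project set is $Y=\pi_1(\mathcal{S}\cap(\mathbb{Z}^k+s))$. For $y\in Y$, $\tilde y$ denotes the unique point of $\mathcal{S}\cap(\mathbb{Z}^k+s)$ with $\pi_1(\tilde y)=y$. Let $\Omega\subseteq E$ be a bounded convex set containing a neighborhood of $0$ in $E$. For $y\in Y$ and $r\ge0$, define \[P_1(y,r)=\{y'\in Y: y'-y\in r\Omega\},\qquad P_2(y,r)=\{y'\in Y:\pi_2(\tilde y'-\tilde y)\in r\Omega\}.\] For $i\in\{1,2\}$, the patches $P_i(y_1,r)$ and $P_i(y_2,r)$ are equivalent if $P_i(y_1,r)=P_i(y_2,r)+y_1-y_2$; write $\mathcal{P}_i(y,r)$ for the equivalence class. The frequency of a class $\mathcal{P}$ is \[\xi_{\mathcal{P}}=\lim_{R\to\infty}\frac{\#\{y'\in Y:|y'|\le R,\ \mathcal{P}_i(y',r)=\mathcal{P}\}}{\#\{y'\in Y:|y'|\le R\}};\] this limit exists. $\xi_i(r)$ is the set of distinct values of $\xi_{\mathcal{P}}$ as $\mathcal{P}$ runs over the equivalence classes of type $i$ patches of size $r$. These notions are defined under the standing assumption that $E$ is totally irrational, and $\xi_i(r)$ does not depend on the regular point $s$. A window $\mathcal{W}$ is a parallelotope generated by vectors in $F\cap\mathbb{Z}^k$ if $\mathcal{W}=\{\sum_{j=1}^{k-d}t_jw_j:0\le t_j\le1\}$ for some linearly independent $w_1,\dots,w_{k-d}\in F\cap\mathbb{Z}^k$. *)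

theory Defs
  imports "HOL-Analysis.Analysis"
begin

section \<open>Hausdorff dimension\<close>

definition hausdorff_pre :: "real \<Rightarrow> real \<Rightarrow> 'a::metric_space set \<Rightarrow> ennreal" where
  "hausdorff_pre s \<delta> S =
     (INF U \<in> {U :: nat \<Rightarrow> 'a set. S \<subseteq> (\<Union>i. U i) \<and> (\<forall>i. bounded (U i) \<and> diameter (U i) \<le> \<delta>)}.
        (\<Sum>i. ennreal (diameter (U i) powr s)))"

definition hausdorff_measure :: "real \<Rightarrow> 'a::metric_space set \<Rightarrow> ennreal" where
  "hausdorff_measure s S = (SUP \<delta> \<in> {0<..}. hausdorff_pre s \<delta> S)"

definition hausdorff_dim :: "'a::metric_space set \<Rightarrow> real" where
  "hausdorff_dim S = Inf {s. 0 < s \<and> hausdorff_measure s S = 0}"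

section \<open>Cut and project setting: R^k = R^('d + 'e), d = CARD('d), k - d = CARD('e)\<close>

text \<open>Matrix A with rows indexed by 'e and columns by 'd: L(x) = A x.\<close>
definition graph_emb :: "real^'d::finite^'e::finite \<Rightarrow> real^'d \<Rightarrow> real^('d::finite + 'e::finite)" where
  "graph_emb A x = (\<chi> i. case i of Inl a \<Rightarrow> x $ a | Inr b \<Rightarrow> (A *v x) $ b)"

definition graphE :: "real^'d::finite^'e::finite \<Rightarrow> (real^('d::finite + 'e::finite)) set" where
  "graphE A = range (graph_emb A)"

definition intlat :: "(real^'n::finite) set" where
  "intlat = {v. \<forall>i. v $ i \<in> \<int>}"

definition totally_irrational :: "(real^'n::finite) set \<Rightarrow> bool" where
  "totally_irrational E \<longleftrightarrow> closure {e + z | e z. e \<in> E \<and> z \<in> intlat} = UNIV"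

definition Fsp :: "(real^('d::finite + 'e::finite)) set" where
  "Fsp = {v. \<forall>a. v $ Inl a = 0}"

text \<open>Projection onto U along W (for complementary subspaces U, W).\<close>
definition proj_along :: "(real^'n::finite) set \<Rightarrow> (real^'n::finite) set \<Rightarrow> real^'n::finite \<Rightarrow> real^'n" where
  "proj_along U W v = (THE u. u \<in> U \<and> v - u \<in> W)"

definition admissible_F0 :: "(real^'n::finite) set \<Rightarrow> (real^'n::finite) set \<Rightarrow> bool" where
  "admissible_F0 E F0 \<longleftrightarrow> subspace F0 \<and> E \<inter> F0 = {0} \<and>
      (\<forall>v. \<exists>e\<in>E. \<exists>f\<in>F0. v = e + f) \<and> F0 \<inter> intlat = {0}"

definition is_window :: "(real^('d::finite + 'e::finite)) set \<Rightarrow> bool" where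
  "is_window W \<longleftrightarrow> W \<subseteq> Fsp \<and> compact W \<and>
      W = closure ((top_of_set Fsp) interior_of W)"

definition int_parallelotope :: "(real^('d::finite + 'e::finite)) set \<Rightarrow> bool" where
  "int_parallelotope W \<longleftrightarrow> (\<exists>w :: 'e::finite \<Rightarrow> real^('d::finite + 'e::finite).
      (\<forall>j. w j \<in> Fsp \<inter> intlat) \<and> inj w \<and> independent (range w) \<and>
      W = {(\<Sum>j\<in>UNIV. t j *\<^sub>R w j) | t. \<forall>j. 0 \<le> t j \<and> t j \<le> 1})"

definition admissible_Omega :: "(real^'n::finite) set \<Rightarrow> (real^'n::finite) set \<Rightarrow> bool" where
  "admissible_Omega E \<Omega> \<longleftrightarrow> \<Omega> \<subseteq> E \<and> bounded \<Omega> \<and> convex \<Omega> \<and>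
      (\<exists>\<epsilon>>0. E \<inter> ball 0 \<epsilon> \<subseteq> \<Omega>)"

text \<open>Strip S = (pi*)^{-1}(W), pi* the projection onto F along E.\<close>
definition strip :: "real^'d::finite^'e::finite \<Rightarrow> (real^('d::finite + 'e::finite)) set \<Rightarrow> (real^('d::finite + 'e::finite)) set" where
  "strip A W = {v. proj_along Fsp (graphE A) v \<in> W}"

definition lat_shift :: "real^'n::finite \<Rightarrow> (real^'n::finite) set" where
  "lat_shift s = (\<lambda>z. z + s) ` intlat"

definition regular_pt :: "real^'d::finite^'e::finite \<Rightarrow> (real^('d::finite + 'e::finite)) set \<Rightarrow> real^('d::finite + 'e::finite) \<Rightarrow> bool" where
  "regular_pt A W s \<longleftrightarrow> lat_shift s \<inter> frontier (strip A W) = {}"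

text \<open>Cut and project set Y = pi1(S \<inter> (Z^k + s)), pi1 the projection onto E along F0.\<close>
definition cps :: "real^'d::finite^'e::finite \<Rightarrow> (real^('d::finite + 'e::finite)) set \<Rightarrow> (real^('d::finite + 'e::finite)) set \<Rightarrow> real^('d::finite + 'e::finite)
                   \<Rightarrow> (real^('d::finite + 'e::finite)) set" where
  "cps A F0 W s = proj_along (graphE A) F0 ` (strip A W \<inter> lat_shift s)"

definition lift :: "real^'d::finite^'e::finite \<Rightarrow> (real^('d::finite + 'e::finite)) set \<Rightarrow> (real^('d::finite + 'e::finite)) set \<Rightarrow> real^('d::finite + 'e::finite)
                   \<Rightarrow> real^('d::finite + 'e::finite) \<Rightarrow> real^('d::finite + 'e::finite)" where
  "lift A F0 W s y = (THE t. t \<in> strip A W \<inter> lat_shift s \<and> proj_along (graphE A) F0 t = y)"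

text \<open>Patches of type i (i = 1 or i = 2).\<close>
definition patch :: "nat \<Rightarrow> real^'d::finite^'e::finite \<Rightarrow> (real^('d::finite + 'e::finite)) set \<Rightarrow> (real^('d::finite + 'e::finite)) set
                   \<Rightarrow> real^('d::finite + 'e::finite) \<Rightarrow> (real^('d::finite + 'e::finite)) set \<Rightarrow> real^('d::finite + 'e::finite) \<Rightarrow> real
                   \<Rightarrow> (real^('d::finite + 'e::finite)) set" where
  "patch i A F0 W s \<Omega> y r =
     (if i = 1 then {y' \<in> cps A F0 W s. y' - y \<in> (*\<^sub>R) r ` \<Omega>}
      else {y' \<in> cps A F0 W s.
              proj_along (graphE A) Fsp (lift A F0 W s y' - lift A F0 W s y) \<in> (*\<^sub>R) r ` \<Omega>})"

definition patch_equiv :: "nat \<Rightarrow> real^'d::finite^'e::finite \<Rightarrow> (real^('d::finite + 'e::finite)) set \<Rightarrow> (real^('d::finite + 'e::finite)) set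
                   \<Rightarrow> real^('d::finite + 'e::finite) \<Rightarrow> (real^('d::finite + 'e::finite)) set \<Rightarrow> real
                   \<Rightarrow> real^('d::finite + 'e::finite) \<Rightarrow> real^('d::finite + 'e::finite) \<Rightarrow> bool" where
  "patch_equiv i A F0 W s \<Omega> r y1 y2 \<longleftrightarrow>
     patch i A F0 W s \<Omega> y1 r = (\<lambda>v. v + (y1 - y2)) ` patch i A F0 W s \<Omega> y2 r"

text \<open>Frequency of the equivalence class of the patch of type i and size r at y.\<close>
definition freq :: "nat \<Rightarrow> real^'d::finite^'e::finite \<Rightarrow> (real^('d::finite + 'e::finite)) set \<Rightarrow> (real^('d::finite + 'e::finite)) set
                   \<Rightarrow> real^('d::finite + 'e::finite) \<Rightarrow> (real^('d::finite + 'e::finite)) set \<Rightarrow> real \<Rightarrow> real^('d::finite + 'e::finite) \<Rightarrow> real" where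
  "freq i A F0 W s \<Omega> r y =
     Lim at_top (\<lambda>R::real.
        real (card {y' \<in> cps A F0 W s. infnorm y' \<le> R \<and> patch_equiv i A F0 W s \<Omega> r y' y})
      / real (card {y' \<in> cps A F0 W s. infnorm y' \<le> R}))"

definition xi :: "nat \<Rightarrow> real^'d::finite^'e::finite \<Rightarrow> (real^('d::finite + 'e::finite)) set \<Rightarrow> (real^('d::finite + 'e::finite)) set
                   \<Rightarrow> real^('d::finite + 'e::finite) \<Rightarrow> (real^('d::finite + 'e::finite)) set \<Rightarrow> real \<Rightarrow> real set" where
  "xi i A F0 W s \<Omega> r = freq i A F0 W s \<Omega> r ` cps A F0 W s"

end

theory Submission
  imports Defs
begin

text \<open>The set of maps consists of the matrices A in the unit cube such that bA is badly approximable
  for every nonzero integer row vector b. It has full Hausdorff dimension: in a tree of nested cubes,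
  at each stage all rational points of controlled height near the current cube lie on one hyperplane,
  and it costs few subcubes to stay away from that hyperplane; the vectors b are treated in turn.

  For a parallelotope window with edges w, the coordinates with respect to w turn the condition that
  a translate of a point stays in the window into a condition on the unit torus. Hence patches
  correspond to regions of the torus which, up to a change of the radius by a bounded factor, are the
  boxes of a product partition. The cut points in each coordinate are the values of a linear form whose
  coefficient vector is a rational multiple of some bA. Bad approximability makes the gaps between
  consecutive cut points as well as the differences of cut points comparable to the inverse d-th power
  of the radius, so only boundedly many gap lengths occur and a patch class consists of boundedly many
  boxes. The asymptotic share of a box depends on its side lengths only, as boxes with equal sides are
  almost translates of one another by elements of the dense projected lattice.

  The existence of the frequencies is never needed: if the relative counts of two classes differ by
  a null function, their limits agree, also as junk values when they do not exist.\<close>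

section \<open>Hausdorff measure of sets built from nested cubes\<close>

text \<open>Two dual notions of bad approximability meet here. The cubes control rational points p/q
  near bA, so they deliver simultaneous inapproximability, whereas separation of cut points needs
  lower bounds for linear forms; a pigeonhole transference links the two. The upper bound for gaps
  is an inhomogeneous statement: at each dyadic scale Dirichlet's theorem supplies a small value of
  the form, bad approximability keeps it from being too small, and a greedy expansion with such
  values approaches every real number from below. General integer vectors b enter because the
  coordinate forms involve the inverse of the integer edge matrix, whose rows are rational by
  Cramer's rule. Integrality of the edges also makes reduction modulo the edges preserve the shifted
  lattice, so that translating by a lattice vector and reducing is injective on lifted points.
  Equidistribution is obtained by comparing such translates: a shell of bounded width holds a
  vanishing share of the points, so the change of radius caused by a fixed translation is
  harmless.\<close>

definition cube_at :: "'a::euclidean_space \<Rightarrow> real \<Rightarrow> 'a set" where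
  "cube_at a \<rho> = cbox a (a + \<rho> *\<^sub>R One)"

lemma mem_cube_at: "x \<in> cube_at a \<rho> \<longleftrightarrow> (\<forall>b\<in>Basis. a \<bullet> b \<le> x \<bullet> b \<and> x \<bullet> b \<le> a \<bullet> b + \<rho>)"
  by (simp add: cube_at_def mem_box inner_add_left inner_sum_left inner_Basis)

definition digits :: "nat \<Rightarrow> ('a::euclidean_space \<Rightarrow> nat) set" where
  "digits \<beta> = Basis \<rightarrow>\<^sub>E {..<\<beta>}"

definition digit_vec :: "('a::euclidean_space \<Rightarrow> nat) \<Rightarrow> 'a" where
  "digit_vec k = (\<Sum>b\<in>Basis. real (k b) *\<^sub>R b)"

lemma digit_vec_inner [simp]: "b \<in> Basis \<Longrightarrow> digit_vec k \<bullet> b = real (k b)"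
  by (simp add: digit_vec_def inner_sum_left inner_Basis if_distrib cong: if_cong)

lemma finite_digits [simp]: "finite (digits \<beta>)"
  by (simp add: digits_def finite_PiE)

lemma card_digits: "card (digits \<beta> :: ('a::euclidean_space \<Rightarrow> nat) set) = \<beta> ^ DIM('a)"
  by (simp add: digits_def card_PiE)

lemma dist_cube_at_le:
  fixes a :: "'a::euclidean_space"
  assumes "x \<in> cube_at a \<rho>" "y \<in> cube_at a \<rho>"
  shows "norm (x - y) \<le> real DIM('a) * \<rho>"
proof -
  have "norm (x - y) \<le> (\<Sum>b\<in>Basis. \<bar>(x - y) \<bullet> b\<bar>)" by (rule norm_le_l1)
  also have "\<dots> \<le> (\<Sum>b\<in>(Basis::'a set). \<rho>)"
    using assms by (intro sum_mono) (force simp: mem_cube_at inner_diff_left abs_le_iff)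
  finally show ?thesis by simp
qed

lemma subcube_subset:
  fixes a :: "'a::euclidean_space"
  assumes k: "k \<in> digits \<beta>" and \<sigma>: "0 \<le> \<sigma>"
  shows "cube_at (a + \<sigma> *\<^sub>R digit_vec k) \<sigma> \<subseteq> cube_at a (real \<beta> * \<sigma>)"
proof
  fix x assume x: "x \<in> cube_at (a + \<sigma> *\<^sub>R digit_vec k) \<sigma>"
  show "x \<in> cube_at a (real \<beta> * \<sigma>)"
    unfolding mem_cube_at
  proof
    fix b :: 'a assume b: "b \<in> Basis"
    have "k b < \<beta>" using k b by (auto simp: digits_def PiE_def Pi_def)
    then have "\<sigma> * (real (k b) + 1) \<le> \<sigma> * real \<beta>"
      using \<sigma> by (intro mult_left_mono) auto
    then have "\<sigma> * real (k b) + \<sigma> \<le> real \<beta> * \<sigma>" by (simp add: algebra_simps)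
    moreover have "0 \<le> \<sigma> * real (k b)" using \<sigma> by simp
    moreover have "a \<bullet> b + \<sigma> * real (k b) \<le> x \<bullet> b" "x \<bullet> b \<le> a \<bullet> b + \<sigma> * real (k b) + \<sigma>"
      using x b by (auto simp: mem_cube_at inner_add_left)
    ultimately show "a \<bullet> b \<le> x \<bullet> b \<and> x \<bullet> b \<le> a \<bullet> b + real \<beta> * \<sigma>" by linarith
  qed
qed

text \<open>Subdividing the unit cube into M^D cubes of side 1/M gives the cover sum M^D (D/M)^s =
  D^s M^(D-s), which tends to 0 as M grows because s > D.\<close>

lemma hausdorff_measure_subset_unit_cube:
  fixes S :: "'a::euclidean_space set"
  assumes S: "S \<subseteq> cube_at 0 1" and s: "s > real DIM('a)"
  shows "hausdorff_measure s S = 0"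
proof -
  let ?D = "DIM('a)"
  have "hausdorff_pre s \<delta> S \<le> ennreal \<epsilon>" if "\<delta> > 0" "\<epsilon> > 0" for \<delta> \<epsilon> :: real
  proof -
    have "((\<lambda>M::nat. real ?D powr s * (real M powr (real ?D - s))) \<longlongrightarrow> real ?D powr s * 0) sequentially"
      using s by (intro tendsto_intros tendsto_neg_powr filterlim_real_sequentially) auto
    then have "\<forall>\<^sub>F M in sequentially. real ?D powr s * (real M powr (real ?D - s)) < \<epsilon>"
      using \<open>\<epsilon> > 0\<close> by (intro order_tendstoD(2)[where a = \<epsilon>]) auto
    moreover have "((\<lambda>M::nat. real ?D / real M) \<longlongrightarrow> 0) sequentially"
      by (rule lim_const_over_n)
    then have "\<forall>\<^sub>F M in sequentially. real ?D / real M < \<delta>"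
      using \<open>\<delta> > 0\<close> by (auto intro: order_tendstoD)
    ultimately have "\<forall>\<^sub>F M::nat in sequentially. real ?D powr s * (real M powr (real ?D - s)) < \<epsilon>
        \<and> real ?D / real M < \<delta> \<and> M > 0"
      using eventually_gt_at_top[of "0::nat"] by eventually_elim auto
    then obtain M :: nat where M: "real ?D powr s * (real M powr (real ?D - s)) < \<epsilon>"
        "real ?D / real M < \<delta>" "M > 0"
      using eventually_happens'[OF sequentially_bot] by blast
    define K where "K = (digits M :: ('a \<Rightarrow> nat) set)"
    define Q where "Q k = cube_at ((1 / real M) *\<^sub>R digit_vec k) (1 / real M)" for k :: "'a \<Rightarrow> nat"
    obtain h where h: "bij_betw h {0..<card K} K"
      using ex_bij_betw_nat_finite[of K] by (auto simp: K_def)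
    define U where "U i = (if i < card K then Q (h i) else {})" for i :: nat
    have bQ: "bounded (Q k)" for k unfolding Q_def cube_at_def by (rule bounded_cbox)
    have dQ: "diameter (Q k) \<le> real ?D / real M" for k
      using dist_cube_at_le[of _ "(1 / real M) *\<^sub>R digit_vec k" "1 / real M"]
      by (intro diameter_le) (auto simp: Q_def)
    have cov: "S \<subseteq> (\<Union>i. U i)"
    proof
      fix x assume "x \<in> S"
      then have x: "\<And>b. b \<in> Basis \<Longrightarrow> 0 \<le> x \<bullet> b \<and> x \<bullet> b \<le> 1" using S by (force simp: mem_cube_at)
      \<comment> \<open>A coordinate equal to 1 would get the digit M; it is put into the last
        closed subcube instead.\<close>
      define k where "k = (\<lambda>b\<in>(Basis::'a set). if x \<bullet> b = 1 then M - 1 else nat \<lfloor>x \<bullet> b * M\<rfloor>)"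
      have kK: "k \<in> K"
        unfolding K_def digits_def
      proof (rule PiE_I)
        fix b :: 'a assume b: "b \<in> Basis"
        show "k b \<in> {..<M}"
        proof (cases "x \<bullet> b = 1")
          case False
          then have "x \<bullet> b * M < M" using x[OF b] M(3) by simp
          then have "\<lfloor>x \<bullet> b * M\<rfloor> < int M" by (simp add: floor_less_iff)
          then show ?thesis using b False M(3) by (simp add: k_def)
        qed (use b M in \<open>simp add: k_def\<close>)
      qed (auto simp: k_def)
      have "x \<in> Q k"
        unfolding Q_def mem_cube_at
      proof
        fix b :: 'a assume b: "b \<in> Basis"
        have "real (k b) \<le> x \<bullet> b * M \<and> x \<bullet> b * M \<le> real (k b) + 1"
        proof (cases "x \<bullet> b = 1")
          case True then show ?thesis using M(3) b by (simp add: k_def of_nat_diff)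
        next
          case False
          have "0 \<le> x \<bullet> b * M" using x[OF b] by simp
          then have "real (nat \<lfloor>x \<bullet> b * M\<rfloor>) = of_int \<lfloor>x \<bullet> b * M\<rfloor>" by simp
          then show ?thesis using False b by (simp add: k_def)
        qed
        then show "(1 / real M) *\<^sub>R digit_vec k \<bullet> b \<le> x \<bullet> b \<and> x \<bullet> b \<le> (1 / real M) *\<^sub>R digit_vec k \<bullet> b + 1 / real M"
          using M(3) b by (simp add: field_simps)
      qed
      moreover obtain i where "i < card K" "h i = k"
        using h kK unfolding bij_betw_def by (metis atLeastLessThan_iff imageE)
      ultimately show "x \<in> (\<Union>i. U i)" by (auto simp: U_def)
    qed
    have "hausdorff_pre s \<delta> S \<le> (\<Sum>i. ennreal (diameter (U i) powr s))"
      unfolding hausdorff_pre_def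
    proof (intro INF_lower CollectI conjI allI)
      show "bounded (U i)" for i using bQ by (simp add: U_def)
      show "diameter (U i) \<le> \<delta>" for i using dQ[of "h i"] M(2) that(1) by (simp add: U_def)
    qed (rule cov)
    also have "\<dots> = (\<Sum>i<card K. ennreal (diameter (U i) powr s))"
      using s by (intro suminf_finite) (auto simp: U_def)
    also have "\<dots> \<le> (\<Sum>i<card K. ennreal ((real ?D / real M) powr s))"
      using dQ bQ s by (intro sum_mono ennreal_leI powr_mono2) (auto simp: U_def diameter_ge_0)
    also have "\<dots> = ennreal (real (M ^ ?D) * (real ?D / real M) powr s)"
      by (simp add: K_def card_digits ennreal_mult ennreal_of_nat_eq_real_of_nat ennreal_power)
    also have "real (M ^ ?D) * (real ?D / real M) powr s = real ?D powr s * (real M powr (real ?D - s))"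
      using M(3) by (simp add: powr_divide powr_diff powr_realpow)
    also have "ennreal \<dots> \<le> ennreal \<epsilon>" using M(1) by (intro ennreal_leI) simp
    finally show ?thesis .
  qed
  note small = this
  have "hausdorff_pre s \<delta> S = 0" if "\<delta> > 0" for \<delta> :: real
  proof -
    have "hausdorff_pre s \<delta> S \<le> 0 + ennreal \<epsilon>" if "\<epsilon> > 0" for \<epsilon> :: real
      using small[OF \<open>\<delta> > 0\<close> that] by simp
    then have "hausdorff_pre s \<delta> S \<le> 0" by (rule ennreal_le_epsilon)
    then show ?thesis by simp
  qed
  then show ?thesis
    unfolding hausdorff_measure_def by simp
qed

text \<open>All points of U lie less than one side length from a fixed u in each coordinate. With y
  the rescaled coordinate of u, only the three digits from floor(y) - 1 to floor(y) + 1 remain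
  possible there.\<close>

lemma card_digits_meeting_small_set:
  fixes a :: "'a::euclidean_space"
  assumes \<sigma>: "\<sigma> > 0" and U: "bounded U" "diameter U < \<sigma>"
  shows "card {k \<in> digits \<beta>. U \<inter> cube_at (a + \<sigma> *\<^sub>R digit_vec k) \<sigma> \<noteq> {}} \<le> 3 ^ DIM('a)"
proof (cases "U = {}")
  case False
  then obtain u where u: "u \<in> U" by auto
  define y where "y b = (u \<bullet> b - a \<bullet> b) / \<sigma>" for b :: 'a
  define J where "J b = {k::nat. \<lfloor>y b\<rfloor> - 1 \<le> int k \<and> int k \<le> \<lfloor>y b\<rfloor> + 1}" for b :: 'a
  have J: "finite (J b)" "card (J b) \<le> 3" for b
  proof -
    have "int ` J b \<subseteq> {\<lfloor>y b\<rfloor> - 1..\<lfloor>y b\<rfloor> + 1}" by (auto simp: J_def)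
    then have "finite (int ` J b)" "card (int ` J b) \<le> card {\<lfloor>y b\<rfloor> - 1..\<lfloor>y b\<rfloor> + 1}"
      using finite_subset card_mono by (blast intro: finite_atLeastAtMost_int)+
    then show "finite (J b)" "card (J b) \<le> 3"
      by (auto simp: finite_image_iff inj_on_def card_image)
  qed
  have "{k \<in> digits \<beta>. U \<inter> cube_at (a + \<sigma> *\<^sub>R digit_vec k) \<sigma> \<noteq> {}} \<subseteq> Pi\<^sub>E Basis J"
  proof
    fix k assume k: "k \<in> {k \<in> digits \<beta>. U \<inter> cube_at (a + \<sigma> *\<^sub>R digit_vec k) \<sigma> \<noteq> {}}"
    then obtain x where x: "x \<in> U" "x \<in> cube_at (a + \<sigma> *\<^sub>R digit_vec k) \<sigma>" by auto
    show "k \<in> Pi\<^sub>E Basis J"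
    proof (rule PiE_I)
      fix b :: 'a assume b: "b \<in> Basis"
      have "\<bar>x \<bullet> b - u \<bullet> b\<bar> \<le> dist x u"
        using Basis_le_norm[OF b, of "x - u"] by (simp add: inner_diff_left dist_norm)
      also have "\<dots> < \<sigma>" using diameter_bounded_bound[OF U(1) x(1) u] U(2) by simp
      finally have "\<bar>x \<bullet> b - u \<bullet> b\<bar> < \<sigma>" .
      moreover have "a \<bullet> b + \<sigma> * k b \<le> x \<bullet> b" "x \<bullet> b \<le> a \<bullet> b + \<sigma> * k b + \<sigma>"
        using x(2) b by (auto simp: mem_cube_at inner_add_left)
      ultimately have "\<sigma> * k b < \<sigma> * y b + \<sigma>" "\<sigma> * y b - \<sigma> < \<sigma> * k b + \<sigma>"
        using \<sigma> unfolding y_def by auto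
      then have "\<sigma> * k b < \<sigma> * (y b + 1)" "\<sigma> * (y b - 1) < \<sigma> * (k b + 1)"
        by (auto simp: algebra_simps)
      then have "real (k b) < y b + 1" "y b - 1 < real (k b) + 1"
        using \<sigma> by simp_all
      then show "k b \<in> J b" unfolding J_def by (simp, linarith)
    qed (use k in \<open>auto simp: digits_def PiE_def extensional_def\<close>)
  qed
  then have "card {k \<in> digits \<beta>. U \<inter> cube_at (a + \<sigma> *\<^sub>R digit_vec k) \<sigma> \<noteq> {}} \<le> card (Pi\<^sub>E Basis J)"
    using J by (intro card_mono finite_PiE) auto
  also have "\<dots> = (\<Prod>b\<in>Basis. card (J b))" by (simp add: card_PiE)
  also have "\<dots> \<le> (\<Prod>b\<in>(Basis::'a set). 3)" using J by (intro prod_mono) auto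
  finally show ?thesis by simp
qed simp

text \<open>Freeze all digits except the one at \<open>b0\<close>, where v is largest. Raising that
  digit by one moves the value of v by m \<sigma>, with m the modulus of v at \<open>b0\<close>.
  From the corner of a subcube the value varies by at most D m \<sigma>, and the slab has half-width
  m \<sigma>, so at most 2(D+1)+1 values of the digit survive.\<close>

lemma card_digits_meeting_slab:
  fixes a v :: "'a::euclidean_space"
  assumes \<sigma>: "\<sigma> > 0" and b0: "b0 \<in> Basis" "v \<bullet> b0 \<noteq> 0" "\<And>b. b \<in> Basis \<Longrightarrow> \<bar>v \<bullet> b\<bar> \<le> \<bar>v \<bullet> b0\<bar>"
  shows "card {k \<in> digits \<beta>. \<exists>x\<in>cube_at (a + \<sigma> *\<^sub>R digit_vec k) \<sigma>. \<bar>v \<bullet> x - c\<bar> \<le> \<bar>v \<bullet> b0\<bar> * \<sigma>}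
     \<le> (2 * DIM('a) + 3) * \<beta> ^ (DIM('a) - 1)" (is "card ?S \<le> _")
proof -
  let ?m = "\<bar>v \<bullet> b0\<bar>"
  let ?R = "(Basis - {b0}) \<rightarrow>\<^sub>E {..<\<beta>}"
  define F where "F r = {k \<in> ?S. restrict k (Basis - {b0}) = r}" for r
  have m: "?m > 0" using b0 by simp
  have "?S \<subseteq> (\<Union>r\<in>?R. F r)"
    by (auto simp: F_def digits_def PiE_def Pi_def extensional_def)
  moreover have finF: "finite (F r)" for r unfolding F_def by (rule finite_subset[OF _ finite_digits[of \<beta>]]) auto
  ultimately have "card ?S \<le> card (\<Union>r\<in>?R. F r)"
    by (intro card_mono finite_UN_I finite_PiE) auto
  also have "\<dots> \<le> (\<Sum>r\<in>?R. card (F r))"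
    by (intro card_UN_le finite_PiE) auto
  also have "\<dots> \<le> (\<Sum>r\<in>?R. 2 * DIM('a) + 3)"
  proof (intro sum_mono)
    fix r
    \<comment> \<open>Chosen so that the value of v at the corner of the subcube, minus c, is
      \<sigma> times the entry of v at \<open>b0\<close> times
      \<open>y + real (k b0)\<close>.\<close>
    define y where "y = (v \<bullet> a + \<sigma> * (\<Sum>b\<in>Basis - {b0}. real (r b) * (v \<bullet> b)) - c) / (\<sigma> * (v \<bullet> b0))"
    have key: "\<bar>y + real (k b0)\<bar> \<le> DIM('a) + 1" if k: "k \<in> F r" for k
    proof -
      obtain x where x: "x \<in> cube_at (a + \<sigma> *\<^sub>R digit_vec k) \<sigma>" "\<bar>v \<bullet> x - c\<bar> \<le> ?m * \<sigma>"
        using k by (auto simp: F_def)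
      have rk: "r b = k b" if "b \<in> Basis - {b0}" for b
        using k that by (auto simp: F_def)
      let ?a = "a + \<sigma> *\<^sub>R digit_vec k"
      have "\<bar>v \<bullet> x - v \<bullet> ?a\<bar> = \<bar>\<Sum>b\<in>Basis. (v \<bullet> b) * ((x - ?a) \<bullet> b)\<bar>"
        by (metis euclidean_inner inner_diff_right)
      also have "\<dots> \<le> (\<Sum>b\<in>Basis. \<bar>(v \<bullet> b) * ((x - ?a) \<bullet> b)\<bar>)" by (rule sum_abs)
      also have "\<dots> \<le> (\<Sum>b\<in>(Basis::'a set). ?m * \<sigma>)"
        unfolding abs_mult using x(1) b0 \<sigma>
        by (intro sum_mono mult_mono) (auto simp: mem_cube_at inner_diff_left)
      finally have 1: "\<bar>v \<bullet> x - v \<bullet> ?a\<bar> \<le> DIM('a) * (?m * \<sigma>)" by simp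
      have "v \<bullet> digit_vec k = (\<Sum>b\<in>Basis. real (k b) * (v \<bullet> b))"
        by (simp add: digit_vec_def inner_sum_right)
      also have "\<dots> = real (k b0) * (v \<bullet> b0) + (\<Sum>b\<in>Basis - {b0}. real (r b) * (v \<bullet> b))"
        using b0 rk by (subst sum.remove[of _ b0]) (auto intro!: sum.cong)
      finally have "v \<bullet> ?a - c = \<sigma> * (v \<bullet> b0) * (y + real (k b0))"
        using \<sigma> b0 by (simp add: y_def inner_add_right field_simps)
      then have "\<sigma> * ?m * \<bar>y + real (k b0)\<bar> = \<bar>v \<bullet> ?a - c\<bar>" using \<sigma> by (simp add: abs_mult)
      also have "\<dots> \<le> DIM('a) * (?m * \<sigma>) + ?m * \<sigma>" using 1 x(2) by linarith
      also have "\<dots> = \<sigma> * ?m * (DIM('a) + 1)" by (simp add: algebra_simps)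
      finally show ?thesis using \<sigma> m by (simp add: mult_le_cancel_left_pos[of "\<sigma> * ?m"])
    qed
    let ?n = "int DIM('a) + 1"
    have inj: "inj_on (\<lambda>k. int (k b0)) (F r)"
    proof (rule inj_onI)
      fix k k' assume kk: "k \<in> F r" "k' \<in> F r" "int (k b0) = int (k' b0)"
      show "k = k'"
      proof
        fix b show "k b = k' b"
        proof (cases "b \<in> Basis - {b0}")
          case True
          have "restrict k (Basis - {b0}) b = restrict k' (Basis - {b0}) b" using kk by (simp add: F_def)
          then show ?thesis using True by simp
        next
          case False
          then show ?thesis using kk by (cases "b = b0") (auto simp: F_def digits_def PiE_def extensional_def)
        qed
      qed
    qed
    have "(\<lambda>k. int (k b0)) ` F r \<subseteq> {\<lceil>- y\<rceil> - ?n..\<lceil>-y\<rceil> + ?n}"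
    proof
      fix z assume "z \<in> (\<lambda>k. int (k b0)) ` F r"
      then obtain k where "k \<in> F r" "z = int (k b0)" by auto
      with key[of k] have "\<bar>y + real_of_int z\<bar> \<le> real_of_int ?n" by simp
      then have "real_of_int z \<le> - y + of_int ?n" "- y - of_int ?n \<le> of_int z" by linarith+
      then have "\<lceil>- y - of_int ?n\<rceil> \<le> z" "z \<le> \<lceil>- y + of_int ?n\<rceil>" 
        by (auto simp: ceiling_le_iff) linarith
      then show "z \<in> {\<lceil>- y\<rceil> - ?n..\<lceil>-y\<rceil> + ?n}" 
        using ceiling_diff_of_int[of "-y" ?n] ceiling_add_of_int[of "-y" ?n] by auto
    qed
    then have "card (F r) \<le> card {\<lceil>- y\<rceil> - ?n..\<lceil>-y\<rceil> + ?n}"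
      using card_image[OF inj] card_mono by (metis finite_atLeastAtMost_int)
    then show "card (F r) \<le> 2 * DIM('a) + 3" by simp
  qed
  also have "\<dots> = (2 * DIM('a) + 3) * \<beta> ^ (DIM('a) - 1)"
    using b0 by (simp add: card_PiE card_Diff_singleton)
  finally show ?thesis .
qed


text \<open>The covering sets are treated as further obstacles: among the admissible subcubes one is chosen
  that meets covering sets of small total weight only, so the limit point escapes every cover.\<close>
lemma hausdorff_measure_nonzero_of_cube_strategy:
  fixes S :: "'a::euclidean_space set" and Fb :: "nat \<Rightarrow> 'a \<Rightarrow> ('a \<Rightarrow> nat) set"
  assumes s: "s > 0" and \<beta>: "\<beta> \<ge> 2" "2 * 3 ^ DIM('a) \<le> real \<beta> powr (real DIM('a) - s)"
    and Fb: "\<And>l a. 2 * card (digits \<beta> \<inter> Fb l a) \<le> \<beta> ^ DIM('a)"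
    and win: "\<And>a \<kappa> x. a 0 = 0 \<Longrightarrow> (\<And>l. \<kappa> l \<in> digits \<beta> - Fb l (a l)) \<Longrightarrow>
        (\<And>l. a (Suc l) = a l + ((1 / real \<beta>) ^ Suc l) *\<^sub>R digit_vec (\<kappa> l)) \<Longrightarrow>
        (\<And>l. x \<in> cube_at (a l) ((1 / real \<beta>) ^ l)) \<Longrightarrow> x \<in> S"
  shows "hausdorff_measure s S \<noteq> 0"
proof
  assume 0: "hausdorff_measure s S = 0"
  let ?D = "DIM('a)"
  \<comment> \<open>\<open>\<theta> ^ l\<close> is the s-th power of the side of a cube of level l,
    the natural weight of such a cube.\<close>
  define \<theta> where "\<theta> = real \<beta> powr (- s)"
  define \<rho> where "\<rho> l = (1 / real \<beta>) ^ l" for l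
  have \<beta>0: "real \<beta> > 0" using \<beta> by simp
  have \<theta>: "\<theta> > 0" using \<beta>0 by (simp add: \<theta>_def)
  have \<rho>: "\<rho> l > 0" for l using \<beta>0 by (simp add: \<rho>_def)
  have \<rho>_Suc: "real \<beta> * \<rho> (Suc l) = \<rho> l" for l using \<beta>0 by (simp add: \<rho>_def)
  have \<rho>s: "\<rho> l powr s = \<theta> ^ l" for l
  proof -
    have "\<rho> l = real \<beta> powr (- real l)" using \<beta>0 by (simp add: \<rho>_def powr_minus powr_realpow field_simps)
    then have "\<rho> l powr s = real \<beta> powr (- s * real l)" by (simp add: powr_powr mult.commute)
    also have "\<dots> = (real \<beta> powr (- s)) ^ l" using \<beta>0 by (simp add: powr_power mult.commute)
    finally show ?thesis by (simp add: \<theta>_def)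
  qed
  have "\<theta> < 1"
    using \<beta> s by (simp add: \<theta>_def powr_less_one)
  have "hausdorff_pre s 1 S \<le> hausdorff_measure s S"
    unfolding hausdorff_measure_def by (intro SUP_upper) auto
  then have "hausdorff_pre s 1 S < ennreal (\<theta> / 2)" using 0 \<theta> by simp
  then obtain U where U: "S \<subseteq> (\<Union>i. U i)" "\<And>i. bounded (U i)" 
    "(\<Sum>i. ennreal (diameter (U i) powr s)) < ennreal (\<theta> / 2)"
    unfolding hausdorff_pre_def INF_less_iff by auto
  \<comment> \<open>The geometric supplement makes every weight positive, also for covering sets of
    diameter 0, so that a limit point inside any \<open>U i\<close> is detected. It adds \<theta>/2
    in total, which keeps the sum of the weights below \<theta>.\<close>
  define v where "v i = diameter (U i) powr s + \<theta> / 4 * (1 / 2) ^ i" for i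
  have v_pos: "v i > 0" for i unfolding v_def using \<theta> by (intro add_nonneg_pos) auto
  have v0: "v i \<ge> 0" for i using v_pos[of i] by simp
  have sumd: "summable (\<lambda>i. diameter (U i) powr s)"
    using U(3) by (intro summable_suminf_not_top) (auto simp: top_unique)
  have sumg: "(\<lambda>i::nat. \<theta> / 4 * (1 / 2) ^ i) sums (\<theta> / 4 * (1 / (1 - 1 / 2)))"
    by (intro sums_mult geometric_sums) auto
  have sumv: "summable v"
    unfolding v_def using sumd sums_summable[OF sumg] by (intro summable_add)
  have "suminf v = (\<Sum>i. diameter (U i) powr s) + \<theta> / 2"
    unfolding v_def using suminf_add[OF sumd sums_summable[OF sumg]] sums_unique[OF sumg] by simp
  moreover have "(\<Sum>i. diameter (U i) powr s) < \<theta> / 2"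
    using U(3) \<theta> by (subst (asm) suminf_ennreal2[OF _ sumd]) (auto simp: ennreal_less_iff suminf_nonneg[OF sumd])
  ultimately have suminf_v: "suminf v < \<theta>" by simp
  define meets where "meets a l i \<longleftrightarrow> U i \<inter> cube_at a (\<rho> l) \<noteq> {}" for a l i
  define mass where "mass a l = (\<Sum>i. if meets a l i then v i else 0)" for a l
  have sum_if: "summable (\<lambda>i. if P i then v i else 0)" for P
    using v0 by (intro summable_comparison_test'[OF sumv, of 0]) auto
  have v_le_mass: "v i \<le> mass a l" if "meets a l i" for a l i
  proof -
    have "(\<Sum>j\<in>{i}. if meets a l j then v j else 0) \<le> mass a l"
      unfolding mass_def using v0 by (intro sum_le_suminf sum_if) auto
    then show ?thesis using that by simp
  qed
  define child where "child a l k = a + \<rho> (Suc l) *\<^sub>R digit_vec k" for a :: 'a and l k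
  \<comment> \<open>Averaging over the admissible subcubes. A covering set that meets the cube is
    smaller than a subcube side, since otherwise its weight alone would exceed the mass; hence it
    meets at most 3^D subcubes. At least half of the \<beta>^D subcubes are admissible, so the lower
    bound on \<beta> to the power D - s forces one of them to have small mass.\<close>
  have step: "\<exists>k. k \<in> digits \<beta> - Fb l a \<and> mass (child a l k) (Suc l) < \<theta> ^ Suc (Suc l)"
    if ml: "mass a l < \<theta> ^ Suc l" for a l
  proof (rule ccontr)
    assume "\<not> ?thesis"
    then have big: "\<theta> ^ Suc (Suc l) \<le> mass (child a l k) (Suc l)" if "k \<in> digits \<beta> - Fb l a" for k
      using that by force
    let ?G = "digits \<beta> - Fb l a"
    have small: "diameter (U i) < \<rho> (Suc l)" if "meets a l i" for i
    proof (rule ccontr)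
      assume "\<not> ?thesis"
      then have "\<rho> (Suc l) powr s \<le> diameter (U i) powr s" using \<rho>[of "Suc l"] s by (intro powr_mono2) auto
      also have "\<dots> \<le> v i" using \<theta> by (simp add: v_def)
      also have "\<dots> < \<theta> ^ Suc l" using v_le_mass[OF that] ml by simp
      finally show False by (simp only: \<rho>s)
    qed
    have sub: "meets a l i" if "meets (child a l k) (Suc l) i" "k \<in> digits \<beta>" for k i
    proof -
      have "cube_at (child a l k) (\<rho> (Suc l)) \<subseteq> cube_at a (\<rho> l)"
        using subcube_subset[OF that(2), of "\<rho> (Suc l)" a] \<rho>[of "Suc l"] \<rho>_Suc by (simp add: child_def)
      then show ?thesis using that(1) by (auto simp: meets_def)
    qed
    have "real (card ?G) * \<theta> ^ Suc (Suc l) \<le> (\<Sum>k\<in>?G. mass (child a l k) (Suc l))"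
      using big sum_mono[of ?G "\<lambda>_. \<theta> ^ Suc (Suc l)" "\<lambda>k. mass (child a l k) (Suc l)"] by simp
    also have "\<dots> = (\<Sum>i. \<Sum>k\<in>?G. if meets (child a l k) (Suc l) i then v i else 0)"
      unfolding mass_def by (intro suminf_sum[symmetric] sum_if)
    also have "\<dots> \<le> (\<Sum>i. 3 ^ ?D * (if meets a l i then v i else 0))"
    proof (intro suminf_le)
      fix i
      show "(\<Sum>k\<in>?G. if meets (child a l k) (Suc l) i then v i else 0) \<le> 3 ^ ?D * (if meets a l i then v i else 0)"
      proof (cases "meets a l i")
        case True
        have "(\<Sum>k\<in>?G. if meets (child a l k) (Suc l) i then v i else 0)
          = real (card {k \<in> ?G. meets (child a l k) (Suc l) i}) * v i"
          by (subst sum.inter_filter[symmetric]) auto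
        also have "card {k \<in> ?G. meets (child a l k) (Suc l) i} \<le> card {k \<in> digits \<beta>. meets (child a l k) (Suc l) i}"
          by (intro card_mono) auto
        also have "\<dots> \<le> 3 ^ ?D"
          unfolding meets_def child_def
          by (intro card_digits_meeting_small_set \<rho> U(2) small True)
        finally show ?thesis using True v0[of i] by (simp add: mult_right_mono)
      next
        case False
        then have "\<not> meets (child a l k) (Suc l) i" if "k \<in> ?G" for k using sub that by auto
        then show ?thesis using False by simp
      qed
    qed (auto intro!: summable_sum summable_mult sum_if)
    also have "\<dots> = 3 ^ ?D * mass a l" unfolding mass_def by (intro suminf_mult sum_if)
    also have "\<dots> < 3 ^ ?D * \<theta> ^ Suc l" using ml by simp
    finally have "(real (card ?G) * \<theta>) * \<theta> ^ Suc l < 3 ^ ?D * \<theta> ^ Suc l" by (simp add: mult_ac)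
    then have 1: "real (card ?G) * \<theta> < 3 ^ ?D" using \<theta> by (simp add: mult_less_cancel_right_pos)
    have "card ?G = \<beta> ^ ?D - card (digits \<beta> \<inter> Fb l a)"
      by (simp add: card_Diff_subset_Int card_digits)
    then have "real (\<beta> ^ ?D) \<le> 2 * real (card ?G)" using Fb[of l a] by linarith
    then have "real (\<beta> ^ ?D) * \<theta> \<le> 2 * real (card ?G) * \<theta>" using \<theta> by simp
    moreover have "real (\<beta> ^ ?D) * \<theta> = real \<beta> powr (real ?D - s)"
      using \<beta>0 by (simp add: \<theta>_def powr_diff powr_minus powr_realpow divide_inverse)
    ultimately show False using 1 \<beta>(2) by linarith
  qed
  have "mass 0 0 \<le> suminf v" 
    unfolding mass_def using v0 by (intro suminf_le sum_if sumv) auto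
  then have m0: "mass 0 0 < \<theta> ^ Suc 0" using suminf_v by simp
  define pick where "pick l a = (SOME k. k \<in> digits \<beta> - Fb l a \<and> mass (child a l k) (Suc l) < \<theta> ^ Suc (Suc l))" for l a
  define a where "a = rec_nat (0::'a) (\<lambda>l x. child x l (pick l x))"
  have a0: "a 0 = 0" and aS: "a (Suc l) = child (a l) l (pick l (a l))" for l by (auto simp: a_def)
  have pick: "pick l x \<in> digits \<beta> - Fb l x \<and> mass (child x l (pick l x)) (Suc l) < \<theta> ^ Suc (Suc l)"
    if "mass x l < \<theta> ^ Suc l" for x l
    unfolding pick_def by (rule someI_ex[OF step[OF that]])
  have inv: "mass (a l) l < \<theta> ^ Suc l" for l
  proof (induction l)
    case (Suc l)
    then show ?case using pick[of "a l" l] by (simp only: aS)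
  qed (use m0 a0 in simp)
  have sub: "cube_at (a (Suc l)) (\<rho> (Suc l)) \<subseteq> cube_at (a l) (\<rho> l)" for l
    using subcube_subset[of "pick l (a l)" \<beta> "\<rho> (Suc l)" "a l"] pick[OF inv, of l] \<rho>[of "Suc l"] \<rho>_Suc
    by (simp add: aS child_def)
  have "\<Inter>(range (\<lambda>l. cube_at (a l) (\<rho> l))) \<noteq> {}"
  proof (rule compact_nest)
    show "compact (cube_at (a n) (\<rho> n))" for n by (simp add: cube_at_def compact_cbox)
    show "cube_at (a n) (\<rho> n) \<noteq> {}" for n
      using \<rho>[of n] mem_cube_at[of "a n" "a n" "\<rho> n"] by force
    show "cube_at (a n) (\<rho> n) \<subseteq> cube_at (a m) (\<rho> m)" if "m \<le> n" for m n
      using lift_Suc_antimono_le[of "\<lambda>l. cube_at (a l) (\<rho> l)" m n] sub that by blast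
  qed
  then obtain x where x: "\<And>l. x \<in> cube_at (a l) (\<rho> l)" by auto
  have "x \<in> S"
  proof (rule win[where a = a and \<kappa> = "\<lambda>l. pick l (a l)"])
    show "pick l (a l) \<in> digits \<beta> - Fb l (a l)" for l using pick[OF inv] by blast
    show "a (Suc l) = a l + (1 / real \<beta>) ^ Suc l *\<^sub>R digit_vec (pick l (a l))" for l
      unfolding aS by (simp only: child_def \<rho>_def)
    show "x \<in> cube_at (a l) ((1 / real \<beta>) ^ l)" for l using x by (simp only: \<rho>_def)
  qed (rule a0)
  then obtain i where i: "x \<in> U i" using U(1) by auto
  \<comment> \<open>The weight of \<open>U i\<close> is counted in the mass of every cube around x,
    and these masses tend to 0.\<close>
  have "v i \<le> \<theta> ^ Suc l" for l
    using v_le_mass[of "a l" l i] inv[of l] i x[of l] by (force simp: meets_def)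
  moreover have "(\<lambda>l. \<theta> ^ Suc l) \<longlonglongrightarrow> 0"
    using \<theta> \<open>\<theta> < 1\<close> by (intro LIMSEQ_Suc LIMSEQ_power_zero) auto
  ultimately have "v i \<le> 0" by (intro LIMSEQ_le_const) auto
  then show False using v_pos[of i] by simp
qed

section \<open>Badly approximable vectors and linear forms\<close>

lemma infnorm_cart_le_iff: "infnorm (x :: real^'n) \<le> c \<longleftrightarrow> (\<forall>i. \<bar>x $ i\<bar> \<le> c)"
proof
  assume "infnorm x \<le> c"
  then show "\<forall>i. \<bar>x $ i\<bar> \<le> c" using component_le_infnorm_cart[of x] by (blast intro: order_trans)
next
  assume "\<forall>i. \<bar>x $ i\<bar> \<le> c"
  then show "infnorm x \<le> c" unfolding infnorm_cart by (intro cSup_least) auto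
qed

lemma infnorm_cart_attained: "\<exists>i. \<bar>(x :: real^'n) $ i\<bar> = infnorm x"
proof -
  have "infnorm x = Max (range (\<lambda>i. \<bar>x $ i\<bar>))"
    unfolding infnorm_cart by (subst cSup_eq_Max) (auto simp: full_SetCompr_eq intro: arg_cong[where f = Max])
  moreover have "Max (range (\<lambda>i. \<bar>x $ i\<bar>)) \<in> range (\<lambda>i. \<bar>x $ i\<bar>)" by (intro Max_in) auto
  ultimately show ?thesis by (metis (no_types, lifting) imageE)
qed

lemma abs_inner_le_infnorm: "\<bar>(x :: real^'n) \<bullet> y\<bar> \<le> real CARD('n) * infnorm x * infnorm y"
proof -
  have "\<bar>x \<bullet> y\<bar> \<le> (\<Sum>i\<in>UNIV. \<bar>x $ i * y $ i\<bar>)"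
    unfolding inner_vec_def by (simp add: sum_abs)
  also have "\<dots> \<le> (\<Sum>i\<in>(UNIV::'n set). infnorm x * infnorm y)"
    unfolding abs_mult by (intro sum_mono mult_mono component_le_infnorm_cart) (auto simp: infnorm_pos_le)
  finally show ?thesis by simp
qed

lemma infnorm_diff_le: "infnorm (x - y) \<le> infnorm x + infnorm (y :: real^'n)"
  using infnorm_triangle[of x "- y"] by (simp add: infnorm_neg)

lemma intlat_0 [simp]: "0 \<in> intlat"
  and intlat_add: "x \<in> intlat \<Longrightarrow> y \<in> intlat \<Longrightarrow> x + y \<in> intlat"
  and intlat_diff: "x \<in> intlat \<Longrightarrow> y \<in> intlat \<Longrightarrow> x - y \<in> intlat"
  and intlat_uminus: "x \<in> intlat \<Longrightarrow> - x \<in> intlat"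
  and intlat_scaleR: "a \<in> \<int> \<Longrightarrow> x \<in> intlat \<Longrightarrow> a *\<^sub>R x \<in> intlat"
  by (auto simp: intlat_def)

lemma intlat_sum: "(\<And>i. i \<in> I \<Longrightarrow> f i \<in> intlat) \<Longrightarrow> sum f I \<in> intlat"
  by (induction I rule: infinite_finite_induct) (auto intro: intlat_add)

lemma intlat_inner: "x \<in> intlat \<Longrightarrow> y \<in> intlat \<Longrightarrow> x \<bullet> y \<in> \<int>"
  by (auto simp: intlat_def inner_vec_def intro!: Ints_sum Ints_mult)

lemma infnorm_intlat_ge_1:
  assumes "x \<in> intlat" "x \<noteq> 0" shows "1 \<le> infnorm x"
proof -
  obtain i where i: "x $ i \<noteq> 0" using assms(2) by (auto simp: vec_eq_iff)
  have "1 \<le> \<bar>x $ i\<bar>" using assms(1) i by (auto simp: intlat_def intro: Ints_nonzero_abs_ge1)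
  then show ?thesis using component_le_infnorm_cart[of x i] by linarith
qed

lemma countable_intlat: "countable (intlat :: (real^'n) set)"
proof -
  have "(intlat :: (real^'n) set) \<subseteq> range (\<lambda>f :: 'n \<Rightarrow> int. \<chi> i. of_int (f i))"
  proof
    fix v :: "real^'n" assume "v \<in> intlat"
    then have "v = (\<chi> i. of_int \<lfloor>v $ i\<rfloor>)" by (auto simp: intlat_def vec_eq_iff elim!: Ints_cases)
    then show "v \<in> range (\<lambda>f :: 'n \<Rightarrow> int. \<chi> i. of_int (f i))"
      by (rule range_eqI[where x = "\<lambda>i. \<lfloor>v $ i\<rfloor>"])
  qed
  then show ?thesis by (rule countable_subset) auto
qed

text \<open>Pigeonhole: there are (N+1)^d integer vectors with entries in 0..N but only N^d
  intervals of length N^(-d) for the fractional part of the form; \<open>n\<close> is the difference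
  of two vectors that share an interval.\<close>

lemma dirichlet_linear_form:
  fixes x :: "real^'d"
  assumes N: "N \<ge> (1::nat)"
  shows "\<exists>n p. n \<in> intlat \<and> n \<noteq> 0 \<and> infnorm n \<le> real N \<and> p \<in> \<int> \<and> \<bar>x \<bullet> n - p\<bar> \<le> 1 / real N ^ CARD('d)"
proof -
  let ?d = "CARD('d)"
  define F where "F = (UNIV :: 'd set) \<rightarrow>\<^sub>E {..N}"
  define w where "w f = (\<chi> i. real (f i))" for f :: "'d \<Rightarrow> nat"
  define g where "g f = nat \<lfloor>real (N ^ ?d) * frac (x \<bullet> w f)\<rfloor>" for f
  have cF: "card F = (N + 1) ^ ?d" unfolding F_def by (simp add: card_PiE)
  have "g ` F \<subseteq> {..<N ^ ?d}"
  proof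
    fix z assume "z \<in> g ` F"
    then obtain f where z: "z = g f" by auto
    have "real (N ^ ?d) * frac (x \<bullet> w f) < real (N ^ ?d)"
      using N frac_lt_1[of "x \<bullet> w f"] by simp
    then have "\<lfloor>real (N ^ ?d) * frac (x \<bullet> w f)\<rfloor> < int (N ^ ?d)" by (simp add: floor_less_iff)
    then show "z \<in> {..<N ^ ?d}" using z N by (simp add: g_def nat_less_iff)
  qed
  then have "card (g ` F) \<le> N ^ ?d" using card_mono[of "{..<N ^ ?d}" "g ` F"] by simp
  also have "\<dots> < card F" using cF by (simp add: power_strict_mono)
  finally have "\<not> inj_on g F" by (rule pigeonhole)
  then obtain f f' where ff: "f \<in> F" "f' \<in> F" "f \<noteq> f'" "g f = g f'" by (auto simp: inj_on_def)
  define n where "n = w f - w f'"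
  define p where "p = of_int \<lfloor>x \<bullet> w f\<rfloor> - (of_int \<lfloor>x \<bullet> w f'\<rfloor> :: real)"
  have "n \<in> intlat" by (auto simp: n_def w_def intlat_def)
  moreover have "n \<noteq> 0" using ff(3) by (auto simp: n_def w_def vec_eq_iff)
  moreover have "\<bar>real (f i) - real (f' i)\<bar> \<le> N" for i
  proof -
    have "f i \<le> N" "f' i \<le> N" using ff by (auto simp: F_def PiE_def Pi_def)
    then show ?thesis by linarith
  qed
  then have "infnorm n \<le> real N" by (simp add: infnorm_cart_le_iff n_def w_def)
  moreover have "\<bar>x \<bullet> n - p\<bar> \<le> 1 / real N ^ ?d"
  proof -
    let ?a = "real (N ^ ?d) * frac (x \<bullet> w f)" and ?b = "real (N ^ ?d) * frac (x \<bullet> w f')"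
    have "0 \<le> ?a" "0 \<le> ?b" by auto
    then have "\<lfloor>?a\<rfloor> = \<lfloor>?b\<rfloor>" using ff(4) by (simp add: g_def eq_nat_nat_iff)
    then have "\<bar>?a - ?b\<bar> \<le> 1" by linarith
    then have "real (N ^ ?d) * \<bar>frac (x \<bullet> w f) - frac (x \<bullet> w f')\<bar> \<le> 1"
      by (simp add: abs_mult flip: right_diff_distrib)
    moreover have eq: "x \<bullet> n - p = frac (x \<bullet> w f) - frac (x \<bullet> w f')"
      by (simp add: n_def p_def frac_def inner_diff_right)
    ultimately show ?thesis using N unfolding eq by (simp add: field_simps)
  qed
  moreover have "p \<in> \<int>" by (simp add: p_def)
  ultimately show ?thesis by blast
qed

section \<open>Transference and inhomogeneous approximation for badly approximable vectors\<close>

definition bad_simult :: "real^'d \<Rightarrow> bool" where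
  "bad_simult x \<longleftrightarrow> (\<exists>c>0. \<forall>q\<ge>1::nat. \<forall>p\<in>intlat. c \<le> real q * infnorm (real q *\<^sub>R x - p) ^ CARD('d))"

text \<open>The dual notion, for the values modulo 1 of the linear form with coefficient vector x.
  The cube construction yields \<open>bad_simult\<close>; the cut points of the window require this
  one.\<close>

definition bad_form :: "real^'d \<Rightarrow> bool" where
  "bad_form x \<longleftrightarrow> (\<exists>c>0. \<forall>n\<in>intlat. n \<noteq> 0 \<longrightarrow> (\<forall>p\<in>\<int>. c / infnorm n ^ CARD('d) \<le> \<bar>x \<bullet> n - p\<bar>))"

text \<open>An unusually small value of the form at n ties the fractional parts of the coordinates
  of q x together by a nearly exact relation with coefficients n. In the pigeonhole for multiples of
  x, the coordinate j where n is largest can then be replaced by one integer of bounded size. The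
  collision gives a simultaneous approximation that is better than the hypothesis permits.\<close>

lemma bad_form_if_bad_simult:
  fixes x :: "real^'d"
  assumes "bad_simult x"
  shows "bad_form x"
proof -
  let ?d = "CARD('d)"
  obtain c where c: "c > 0" "\<And>q p. q \<ge> (1::nat) \<Longrightarrow> p \<in> intlat \<Longrightarrow> c \<le> real q * infnorm (real q *\<^sub>R x - p) ^ ?d"
    using assms by (auto simp: bad_simult_def)
  \<comment> \<open>The argument ends with c \<le> (2d+3) d^d / \<open>K0\<close>, which this choice
    contradicts.\<close>
  obtain K0 :: nat where K0: "real K0 > (2 * ?d + 3) * real ?d ^ ?d / c" using reals_Archimedean2 by blast
  have "(2 * ?d + 3) * real ?d ^ ?d / c > 0" using c(1) by simp
  then have K0pos: "K0 > 0" using K0 by (metis gr0I of_nat_0 less_asym)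
  have main: "1 / ((2 * ?d + 3) * real K0 ^ ?d) / infnorm n ^ ?d \<le> \<bar>x \<bullet> n - p\<bar>"
    if n: "n \<in> intlat" "n \<noteq> 0" and p: "p \<in> \<int>" for n p
  proof (rule ccontr)
    assume less: "\<not> ?thesis"
    obtain j where j: "\<bar>n $ j\<bar> = infnorm n" using infnorm_cart_attained by blast
    obtain ni where ni: "\<And>i. n $ i = of_int (ni i)"
      using n(1) unfolding intlat_def Ints_def by (auto simp: image_iff) metis
    obtain pI where pI: "p = of_int pI" using p by (auto elim: Ints_cases)
    define H where "H = nat \<bar>ni j\<bar>"
    have H: "real H = infnorm n" using j ni by (simp add: H_def)
    have H1: "H \<ge> 1" using infnorm_intlat_ge_1[OF n] H by simp
    have niH: "\<bar>real_of_int (ni i)\<bar> \<le> H" for i using component_le_infnorm_cart[of n i] H ni by simp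
    define K where "K = K0 * H"
    have K: "K > 0" using K0pos H1 by (simp add: K_def)
    \<comment> \<open>At least the number of pigeonholes: K boxes for each of d-1 coordinates, and
      2(dH+1)+1 \<le> (2d+3)H possible integers \<open>k q\<close>. The Q+1 numbers 0..Q therefore
      collide.\<close>
    define Q where "Q = K ^ (?d - 1) * ((2 * ?d + 3) * H)"
    have QK: "Q * K = K ^ ?d * ((2 * ?d + 3) * H)"
      using power_minus_mult[of ?d K] by (simp add: Q_def mult_ac)
    define \<eta> where "\<eta> = \<bar>x \<bullet> n - p\<bar>"
    have "\<eta> < 1 / ((2 * ?d + 3) * real K ^ ?d)"
      using less H by (simp add: \<eta>_def K_def power_mult_distrib mult_ac)
    moreover have "(2 * ?d + 3) * real K ^ ?d > 0" using K by simp
    ultimately have "(2 * ?d + 3) * real K ^ ?d * \<eta> < 1"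
      using pos_less_divide_eq[of "(2 * ?d + 3) * real K ^ ?d" \<eta> 1] by (simp only: mult.commute)
    then have "H * ((2 * ?d + 3) * real K ^ ?d * \<eta>) < H" using H1 by simp
    moreover have "H * ((2 * ?d + 3) * real K ^ ?d * \<eta>) = real (Q * K) * \<eta>"
      unfolding QK by simp
    ultimately have "real (Q * K) * \<eta> < H" by linarith
    then have QK\<eta>: "real Q * \<eta> * K < H" by (simp add: mult_ac)
    then have Q\<eta>: "real Q * \<eta> < H / K" using K by (simp add: field_simps)
    have "H / K \<le> 1" using K0pos H1 by (simp add: K_def)
    define \<theta> where "\<theta> q i = frac (real q * x $ i)" for q :: nat and i
    \<comment> \<open>The integer in the relation: the sum of n_i times the fractional part of q x_i
      equals \<open>k q\<close> up to the error q (x . n - p), which for q \<le> Q is below H/K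
      \<le> 1.\<close>
    define k where "k q = int q * pI - (\<Sum>i\<in>UNIV. ni i * \<lfloor>real q * x $ i\<rfloor>)" for q :: nat
    have k: "of_int (k q) = (\<Sum>i\<in>UNIV. n $ i * \<theta> q i) - real q * (x \<bullet> n - p)" for q
    proof -
      have "(\<Sum>i\<in>UNIV. n $ i * \<theta> q i) = real q * (x \<bullet> n) - (\<Sum>i\<in>UNIV. n $ i * of_int \<lfloor>real q * x $ i\<rfloor>)"
        by (simp add: \<theta>_def frac_def inner_vec_def sum_distrib_left algebra_simps sum_subtractf)
      then show ?thesis by (simp add: k_def ni pI algebra_simps)
    qed
    have kb: "\<bar>k q\<bar> \<le> int (?d * H + 1)" if "q \<le> Q" for q
    proof -
      have "\<bar>\<Sum>i\<in>UNIV. n $ i * \<theta> q i\<bar> \<le> (\<Sum>i\<in>(UNIV::'d set). real H * 1)"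
      proof (intro order_trans[OF sum_abs] sum_mono)
        fix i show "\<bar>n $ i * \<theta> q i\<bar> \<le> real H * 1"
          unfolding abs_mult ni using niH[of i] less_imp_le[OF frac_lt_1, of "real q * x $ i"]
          by (intro mult_mono) (auto simp: \<theta>_def)
      qed
      moreover have "\<bar>real q * (x \<bullet> n - p)\<bar> \<le> real Q * \<eta>"
        using that by (simp add: abs_mult \<eta>_def mult_right_mono)
      ultimately have "\<bar>real_of_int (k q)\<bar> \<le> real (?d * H) + 1"
        using k[of q] Q\<eta> \<open>H / K \<le> 1\<close> by (simp add: abs_le_iff)
      then show ?thesis by linarith
    qed
    define key where "key q = (restrict (\<lambda>i. nat \<lfloor>real K * \<theta> q i\<rfloor>) (UNIV - {j}), k q)" for q
    let ?R = "((UNIV - {j}) \<rightarrow>\<^sub>E {..<K}) \<times> {- int (?d * H + 1)..int (?d * H + 1)}"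
    have "key ` {..Q} \<subseteq> ?R"
    proof
      fix z assume "z \<in> key ` {..Q}"
      then obtain q where q: "q \<le> Q" "z = key q" by auto
      have "nat \<lfloor>real K * \<theta> q i\<rfloor> < K" for i
      proof -
        have "real K * \<theta> q i < K" using K frac_lt_1 by (simp add: \<theta>_def)
        then have "\<lfloor>real K * \<theta> q i\<rfloor> < int K" by (simp add: floor_less_iff del: mult_less_cancel_left2)
        then show ?thesis using K by linarith
      qed
      then show "z \<in> ?R" using kb[OF q(1)] q(2) by (auto simp: key_def)
    qed
    then have "card (key ` {..Q}) \<le> card ?R" by (intro card_mono finite_cartesian_product finite_PiE) auto
    also have "card ?R = K ^ (?d - 1) * (2 * (?d * H) + 3)"
    proof -
      have "card {- int (?d * H + 1)..int (?d * H + 1)} = 2 * (?d * H) + 3"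
        by (simp only: card_atLeastAtMost_int)
      then show ?thesis by (simp add: card_cartesian_product card_PiE)
    qed
    also have "\<dots> \<le> Q" unfolding Q_def using H1 by (intro mult_left_mono) (auto simp: algebra_simps)
    also have "\<dots> < card {..Q}" by simp
    finally have "\<not> inj_on key {..Q}" by (rule pigeonhole)
    then obtain q q' where "q \<le> Q" "q' \<le> Q" "q \<noteq> q'" "key q = key q'" by (auto simp: inj_on_def)
    then obtain q q' where q: "q < q'" "q' \<le> Q" "key q = key q'"
      by (metis linorder_neqE_nat)
    define p' where "p' = (\<chi> i. real_of_int \<lfloor>real q' * x $ i\<rfloor> - real_of_int \<lfloor>real q * x $ i\<rfloor>)"
    have diff: "real (q' - q) * x $ i - p' $ i = \<theta> q' i - \<theta> q i" for i
      using q(1) by (simp add: p'_def \<theta>_def frac_def of_nat_diff algebra_simps)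
    have d1: "\<bar>\<theta> q' i - \<theta> q i\<bar> \<le> 1 / K" if "i \<noteq> j" for i
    proof -
      have "nat \<lfloor>real K * \<theta> q i\<rfloor> = nat \<lfloor>real K * \<theta> q' i\<rfloor>"
        using q(3) that unfolding key_def by (auto simp: fun_eq_iff restrict_def split: if_splits)
      moreover have "0 \<le> real K * \<theta> q i" "0 \<le> real K * \<theta> q' i" by (auto simp: \<theta>_def)
      ultimately have "\<lfloor>real K * \<theta> q i\<rfloor> = \<lfloor>real K * \<theta> q' i\<rfloor>" by (simp add: eq_nat_nat_iff)
      then have "\<bar>real K * \<theta> q' i - real K * \<theta> q i\<bar> \<le> 1" by linarith
      then have "real K * \<bar>\<theta> q' i - \<theta> q i\<bar> \<le> 1" by (simp add: abs_mult flip: right_diff_distrib)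
      then show ?thesis using K by (simp add: field_simps)
    qed
    \<comment> \<open>The omitted coordinate is recovered from the relation. Equal integers cancel,
      the other d-1 terms contribute at most H/K each and the error at most H/K more; division by
      the modulus H of n_j leaves d/K.\<close>
    have dj: "\<bar>\<theta> q' j - \<theta> q j\<bar> \<le> ?d / K"
    proof -
      have "k q = k q'" using q(3) by (simp add: key_def)
      then have "(\<Sum>i\<in>UNIV. n $ i * (\<theta> q' i - \<theta> q i)) = (real q' - real q) * (x \<bullet> n - p)"
        using k[of q] k[of q'] by (simp add: algebra_simps sum_subtractf)
      moreover have "(\<Sum>i\<in>UNIV. n $ i * (\<theta> q' i - \<theta> q i)) = n $ j * (\<theta> q' j - \<theta> q j) + (\<Sum>i\<in>UNIV-{j}. n $ i * (\<theta> q' i - \<theta> q i))"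
        by (subst sum.remove[of _ j]) auto
      ultimately have eq: "n $ j * (\<theta> q' j - \<theta> q j) = (real q' - real q) * (x \<bullet> n - p) - (\<Sum>i\<in>UNIV-{j}. n $ i * (\<theta> q' i - \<theta> q i))"
        by linarith
      have "\<bar>(real q' - real q) * (x \<bullet> n - p)\<bar> \<le> real Q * \<eta>"
        using q by (auto simp: abs_mult \<eta>_def intro!: mult_right_mono)
      moreover have "\<bar>\<Sum>i\<in>UNIV-{j}. n $ i * (\<theta> q' i - \<theta> q i)\<bar> \<le> (\<Sum>i\<in>UNIV-{j}. real H * (1 / K))"
      proof (intro order_trans[OF sum_abs] sum_mono)
        fix i assume "i \<in> UNIV - {j}"
        then show "\<bar>n $ i * (\<theta> q' i - \<theta> q i)\<bar> \<le> real H * (1 / K)"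
          unfolding abs_mult ni using niH[of i] d1[of i] by (intro mult_mono) auto
      qed
      moreover have "(\<Sum>i\<in>UNIV-{j}. real H * (1 / K)) = (real ?d - 1) * (H / K)"
        by (simp add: card_Diff_singleton of_nat_diff)
      ultimately have "\<bar>n $ j * (\<theta> q' j - \<theta> q j)\<bar> \<le> H / K + (real ?d - 1) * (H / K)"
        using Q\<eta> unfolding eq by linarith
      moreover have "H / K + (real ?d - 1) * (H / K) = real H * (?d / K)"
        using K by (simp add: field_simps)
      ultimately have "real H * \<bar>\<theta> q' j - \<theta> q j\<bar> \<le> real H * (?d / K)"
        unfolding abs_mult j H by linarith
      then show ?thesis using H1 by (simp only: mult_le_cancel_left_pos)
    qed
    have "\<bar>\<theta> q' i - \<theta> q i\<bar> \<le> ?d / K" for i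
    proof (cases "i = j")
      case False
      have "1 / real K \<le> ?d / K" using K by (simp add: divide_right_mono Suc_leI)
      then show ?thesis using d1[OF False] by linarith
    qed (use dj in simp)
    then have inf: "infnorm (real (q' - q) *\<^sub>R x - p') \<le> ?d / K"
      by (simp add: infnorm_cart_le_iff diff)
    have "p' \<in> intlat" by (auto simp: p'_def intlat_def)
    then have "c \<le> real (q' - q) * infnorm (real (q' - q) *\<^sub>R x - p') ^ ?d" using q by (intro c(2)) auto
    also have "\<dots> \<le> real Q * (?d / K) ^ ?d"
      using q inf by (intro mult_mono power_mono) (auto simp: infnorm_pos_le)
    also have "\<dots> = real (Q * K) * (real ?d ^ ?d / (real K ^ ?d * K))" using K by (simp add: power_divide)
    also have "\<dots> = (2 * ?d + 3) * real ?d ^ ?d / K0"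
      unfolding QK using K0pos H1 by (simp add: K_def field_simps)
    also have "\<dots> < c" using K0 K0pos c(1) by (simp add: field_simps)
    finally show False by simp
  qed
  show ?thesis unfolding bad_form_def
    using main K0pos by (intro exI[of _ "1 / ((2 * ?d + 3) * real K0 ^ ?d)"]) auto
qed

text \<open>A greedy expansion of y. At each dyadic scale Dirichlet's theorem gives a value of the
  form that \<open>bad_form\<close> prevents from being much too small. Subtracting the right
  multiple keeps the remainder nonnegative and takes it below the next scale, at the cost of a
  bounded coefficient. This is the source of the upper bound for gaps between cut points.\<close>

lemma bad_form_dense:
  fixes x :: "real^'d"
  assumes "bad_form x"
  shows "\<exists>C\<ge>1. \<forall>(N::nat) y. \<exists>n\<in>intlat. \<exists>p\<in>\<int>. infnorm n \<le> N \<and> 0 \<le> y - (x \<bullet> n - p) \<and> y - (x \<bullet> n - p) < C / real (N + 1) ^ CARD('d)"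
proof -
  let ?d = "CARD('d)"
  obtain c where c: "c > 0" "\<And>n p. n \<in> intlat \<Longrightarrow> n \<noteq> 0 \<Longrightarrow> p \<in> \<int> \<Longrightarrow> c / infnorm n ^ ?d \<le> \<bar>x \<bullet> n - p\<bar>"
    using assms by (auto simp: bad_form_def)
  \<comment> \<open>With this value, \<open>C' * 2 ^ I\<close> plus the increment (2^d / c) 2^(I+1)
    is exactly \<open>C' * 2 ^ Suc I\<close>.\<close>
  define C' where "C' = 2 * 2 ^ ?d / c"
  have C': "C' > 0" using c(1) by (simp add: C'_def)
  have scale: "\<exists>n p. n \<in> intlat \<and> p \<in> \<int> \<and> infnorm n \<le> 2 ^ I \<and> c / (2 ^ I) ^ ?d \<le> x \<bullet> n - p \<and> x \<bullet> n - p \<le> 1 / (2 ^ I) ^ ?d" for I :: nat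
  proof -
    obtain n p where n: "n \<in> intlat" "n \<noteq> 0" "infnorm n \<le> 2 ^ I" "p \<in> \<int>" "\<bar>x \<bullet> n - p\<bar> \<le> 1 / (2 ^ I) ^ ?d"
      using dirichlet_linear_form[of "2 ^ I" x] by auto
    have "c / (2 ^ I) ^ ?d \<le> c / infnorm n ^ ?d"
      using n(3) c(1) infnorm_intlat_ge_1[OF n(1,2)]
      by (intro divide_left_mono power_mono mult_pos_pos zero_less_power) auto
    also have "\<dots> \<le> \<bar>x \<bullet> n - p\<bar>" by (rule c(2)) fact+
    finally have lo: "c / (2 ^ I) ^ ?d \<le> \<bar>x \<bullet> n - p\<bar>" .
    show ?thesis
    proof (cases "x \<bullet> n - p \<ge> 0")
      case True
      then show ?thesis using n lo by (intro exI[of _ n] exI[of _ p]) auto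
    next
      case False
      then show ?thesis using n lo
        by (intro exI[of _ "- n"] exI[of _ "- p"]) (auto simp: intlat_uminus infnorm_neg)
    qed
  qed
  have greedy: "\<exists>n\<in>intlat. \<exists>p\<in>\<int>. infnorm n \<le> C' * 2 ^ I \<and> 0 \<le> y - (x \<bullet> n - p) \<and> y - (x \<bullet> n - p) < 1 / (2 ^ I) ^ ?d" for I :: nat and y
  proof (induction I)
    case 0
    have "0 \<le> y - of_int \<lfloor>y\<rfloor>" "y - of_int \<lfloor>y\<rfloor> < 1" by linarith+
    then show ?case using C'
      by (intro bexI[where x = "0::real^'d"] bexI[where x = "- of_int \<lfloor>y\<rfloor>"]) (auto simp: infnorm_0)
  next
    case (Suc I)
    then obtain n p where n: "n \<in> intlat" "p \<in> \<int>" "infnorm n \<le> C' * 2 ^ I" "0 \<le> y - (x \<bullet> n - p)" "y - (x \<bullet> n - p) < 1 / (2 ^ I) ^ ?d" by blast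
    obtain m r where m: "m \<in> intlat" "r \<in> \<int>" "infnorm m \<le> 2 ^ Suc I" "c / (2 ^ Suc I) ^ ?d \<le> x \<bullet> m - r" "x \<bullet> m - r \<le> 1 / (2 ^ Suc I) ^ ?d"
      using scale by blast
    define \<delta> where "\<delta> = x \<bullet> m - r"
    define res where "res = y - (x \<bullet> n - p)"
    have "0 < c / (2 ^ Suc I) ^ ?d" using c(1) by simp
    then have \<delta>: "\<delta> > 0" using m(4) by (simp add: \<delta>_def)
    \<comment> \<open>Division with remainder by \<delta>. The quotient is bounded because the old
      remainder is below the previous scale and \<delta> is at least c times the new one.\<close>
    define a where "a = real_of_int \<lfloor>res / \<delta>\<rfloor>"
    have a: "0 \<le> a" "a \<le> res / \<delta>" "res / \<delta> < a + 1" using n(4) \<delta> by (auto simp: a_def res_def)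
    have ab: "a \<le> 2 ^ ?d / c"
    proof -
      have "res / \<delta> \<le> (1 / (2 ^ I) ^ ?d) / (c / (2 ^ Suc I) ^ ?d)"
        using n(5) m(4) c(1) by (intro frac_le) (auto simp: res_def \<delta>_def)
      also have "\<dots> = 2 ^ ?d / c" by (simp add: power_mult_distrib)
      finally show ?thesis using a by linarith
    qed
    have "infnorm (n + a *\<^sub>R m) \<le> infnorm n + infnorm (a *\<^sub>R m)" by (rule infnorm_triangle)
    also have "infnorm (a *\<^sub>R m) = a * infnorm m" using a by (simp add: infnorm_mul)
    also have "a * infnorm m \<le> 2 ^ ?d / c * 2 ^ Suc I"
      using ab a m(3) c(1) by (intro mult_mono) (auto simp: infnorm_pos_le)
    also have "infnorm n + 2 ^ ?d / c * 2 ^ Suc I \<le> C' * 2 ^ Suc I"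
      using n(3) by (simp add: C'_def algebra_simps)
    finally have 1: "infnorm (n + a *\<^sub>R m) \<le> C' * 2 ^ Suc I" by simp
    have "y - (x \<bullet> (n + a *\<^sub>R m) - (p + a * r)) = res - a * \<delta>"
      by (simp add: res_def \<delta>_def inner_add_right algebra_simps)
    moreover have "0 \<le> res - a * \<delta>" "res - a * \<delta> < \<delta>" using a \<delta> by (auto simp: field_simps)
    ultimately have "0 \<le> y - (x \<bullet> (n + a *\<^sub>R m) - (p + a * r)) \<and> y - (x \<bullet> (n + a *\<^sub>R m) - (p + a * r)) < 1 / (2 ^ Suc I) ^ ?d"
      using m(5) by (simp add: \<delta>_def)
    moreover have "n + a *\<^sub>R m \<in> intlat" "p + a * r \<in> \<int>"
      using n m by (auto simp: a_def intro!: intlat_add intlat_scaleR)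
    ultimately show ?case using 1 by blast
  qed
  \<comment> \<open>If N < \<open>C'\<close>, the integer part of y is near enough. Otherwise take
    the last I with \<open>C' * 2 ^ I\<close> \<le> N; there N+1 \<le> (2C'+1) 2^I.\<close>
  define C where "C = (2 * C' + 1) ^ ?d"
  have "\<exists>n\<in>intlat. \<exists>p\<in>\<int>. infnorm n \<le> N \<and> 0 \<le> y - (x \<bullet> n - p) \<and> y - (x \<bullet> n - p) < C / real (N + 1) ^ ?d" for N :: nat and y
  proof (cases "real N < C'")
    case True
    then have "real (N + 1) ^ ?d \<le> C" unfolding C_def using C' by (intro power_mono) auto
    then have "1 \<le> C / real (N + 1) ^ ?d" by (simp add: field_simps)
    moreover have "0 \<le> y - of_int \<lfloor>y\<rfloor>" "y - of_int \<lfloor>y\<rfloor> < 1" by linarith+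
    ultimately have "0 \<le> y - of_int \<lfloor>y\<rfloor>" "y - of_int \<lfloor>y\<rfloor> < C / real (N + 1) ^ ?d"
      using \<open>1 \<le> C / real (N + 1) ^ ?d\<close> by linarith+
    then show ?thesis
      by (intro bexI[where x = "0::real^'d"] bexI[where x = "- of_int \<lfloor>y\<rfloor>"]) (auto simp: infnorm_0)
  next
    case False
    obtain m0 :: nat where "real N / C' < 2 ^ m0" using real_arch_pow[of 2 "real N / C'"] by auto
    then have ex: "\<exists>m::nat. real N < C' * 2 ^ m" using C' by (auto simp: field_simps)
    define m where "m = (LEAST m::nat. real N < C' * 2 ^ m)"
    have m: "real N < C' * 2 ^ m" unfolding m_def by (rule LeastI_ex[OF ex])
    then obtain I where I: "m = Suc I" using False by (cases m) auto
    have "\<not> real N < C' * 2 ^ I" using I unfolding m_def by (intro not_less_Least) simp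
    then have NI: "C' * 2 ^ I \<le> real N" by simp
    obtain n p where n: "n \<in> intlat" "p \<in> \<int>" "infnorm n \<le> C' * 2 ^ I" "0 \<le> y - (x \<bullet> n - p)" "y - (x \<bullet> n - p) < 1 / (2 ^ I) ^ ?d" 
      using greedy by blast
    have "(1::real) \<le> 2 ^ I" by simp
    moreover have "real N < 2 * C' * 2 ^ I" using m unfolding I by (simp add: mult_ac)
    ultimately have "real (N + 1) \<le> 2 * C' * 2 ^ I + 1 * 2 ^ I" unfolding of_nat_add of_nat_1 by linarith
    then have "real (N + 1) ^ ?d \<le> ((2 * C' + 1) * 2 ^ I) ^ ?d"
      by (intro power_mono) (simp_all add: distrib_right)
    then have "real (N + 1) ^ ?d \<le> C * (2 ^ I) ^ ?d" by (simp only: C_def power_mult_distrib)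
    then have "1 / (2 ^ I) ^ ?d \<le> C / real (N + 1) ^ ?d"
      by (simp add: pos_divide_le_eq pos_le_divide_eq)
    then show ?thesis using n NI by (intro bexI[of _ n] bexI[of _ p]) auto
  qed
  moreover have "1 \<le> C" unfolding C_def using C' by (intro one_le_power) auto
  ultimately show ?thesis by blast
qed

text \<open>The integer p . n - q n0 is less than 1/4 + 1/8 + 1/2 in modulus, the three errors
  coming from p against q x, from x against x0, and from the quality of (n, n0) at x0. Hence it is 0
  and p/q lies on the hyperplane y . n = n0. A point x off this hyperplane has a definite distance
  from p/q.\<close>

lemma rational_points_near_on_hyperplane:
  fixes x x0 n p :: "real^'d"
  assumes n: "n \<in> intlat" "infnorm n \<le> real N" and n0: "n0 \<in> \<int>" 
    and app: "\<bar>x0 \<bullet> n - n0\<bar> \<le> 1 / real N ^ CARD('d)" and N: "N \<ge> 1"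
    and near: "infnorm (x - x0) \<le> \<delta>" "4 * real CARD('d) * \<delta> * real N ^ (CARD('d) + 1) \<le> 1"
    and q: "1 \<le> q" "2 * q \<le> N ^ CARD('d)" and p: "p \<in> intlat" and off: "\<bar>x \<bullet> n - n0\<bar> > \<tau>"
    and close: "infnorm (real q *\<^sub>R x - p) < 1 / (4 * real CARD('d) * real N)"
  shows "real CARD('d) * infnorm n * infnorm (real q *\<^sub>R x - p) > real q * \<tau>"
proof -
  let ?d = "CARD('d)"
  let ?\<theta> = "infnorm (real q *\<^sub>R x - p)"
  have N0: "real N > 0" using N by simp
  have q2: "2 * real q \<le> real N ^ ?d" using q(2) by (metis of_nat_le_iff of_nat_mult of_nat_numeral of_nat_power)
  have eq: "p \<bullet> n - n0 * q = - ((real q *\<^sub>R x - p) \<bullet> n) + real q * ((x - x0) \<bullet> n) + real q * (x0 \<bullet> n - n0)"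
    by (simp add: inner_diff_left algebra_simps)
  have "\<bar>(real q *\<^sub>R x - p) \<bullet> n\<bar> \<le> ?d * ?\<theta> * infnorm n" by (rule abs_inner_le_infnorm)
  also have "\<dots> \<le> ?d * ?\<theta> * N" using n(2) by (intro mult_left_mono) (auto simp: infnorm_pos_le)
  also have "\<dots> < 1 / 4" using close N0 by (simp add: field_simps)
  finally have 1: "\<bar>(real q *\<^sub>R x - p) \<bullet> n\<bar> < 1 / 4" .
  have \<delta>0: "0 \<le> \<delta>" using near(1) infnorm_pos_le order_trans by blast
  have "\<bar>(x - x0) \<bullet> n\<bar> \<le> ?d * infnorm (x - x0) * infnorm n" by (rule abs_inner_le_infnorm)
  also have "\<dots> \<le> ?d * \<delta> * N" using n(2) near(1) by (intro mult_mono) (auto simp: infnorm_pos_le \<delta>0)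
  finally have 2: "\<bar>(x - x0) \<bullet> n\<bar> \<le> ?d * \<delta> * N" .
  have "2 * \<bar>real q * ((x - x0) \<bullet> n)\<bar> \<le> (2 * real q) * (?d * \<delta> * N)"
    using 2 by (simp add: abs_mult mult_left_mono)
  also have "\<dots> \<le> real N ^ ?d * (?d * \<delta> * N)" using q2 \<delta>0 by (intro mult_right_mono) auto
  also have "\<dots> \<le> 1 / 4" using near(2) by (simp add: mult_ac)
  finally have 3: "\<bar>real q * ((x - x0) \<bullet> n)\<bar> \<le> 1 / 8" by simp
  have "2 * \<bar>real q * (x0 \<bullet> n - n0)\<bar> \<le> (2 * real q) * (1 / real N ^ ?d)"
    using mult_left_mono[OF app, of "2 * real q"] by (simp add: abs_mult)
  also have "\<dots> \<le> real N ^ ?d * (1 / real N ^ ?d)" using q2 by (intro mult_right_mono) auto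
  also have "\<dots> = 1" using N0 by simp
  finally have 4: "\<bar>real q * (x0 \<bullet> n - n0)\<bar> \<le> 1 / 2" by simp
  have "\<bar>p \<bullet> n - n0 * q\<bar> < 1" using 1 3 4 unfolding eq by linarith
  moreover have "p \<bullet> n - n0 * q \<in> \<int>" using n(1) p n0 by (auto intro!: intlat_inner)
  ultimately have "p \<bullet> n - n0 * q = 0" using Ints_nonzero_abs_less1 by blast
  then have "p \<bullet> n = q * n0" by simp
  then have "(real q *\<^sub>R x - p) \<bullet> n = real q * (x \<bullet> n - n0)" by (simp add: inner_diff_left right_diff_distrib)
  then have eq': "\<bar>(real q *\<^sub>R x - p) \<bullet> n\<bar> = real q * \<bar>x \<bullet> n - n0\<bar>" by (simp add: abs_mult)
  have "real q * \<tau> < real q * \<bar>x \<bullet> n - n0\<bar>" using off q by simp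
  also have "\<dots> = \<bar>(real q *\<^sub>R x - p) \<bullet> n\<bar>" by (rule eq'[symmetric])
  also have "\<dots> \<le> real ?d * ?\<theta> * infnorm n" by (rule abs_inner_le_infnorm)
  also have "\<dots> = real ?d * infnorm n * ?\<theta>" by (simp only: mult_ac)
  finally show ?thesis .
qed

section \<open>Full Hausdorff dimension of the badly approximable matrices\<close>

lemma Least_not_pow2_dvd: "(LEAST j. \<not> 2 ^ Suc j dvd (2 ^ i * (2 * m + 1) :: nat)) = i"
proof (rule Least_equality)
  show "\<not> 2 ^ Suc i dvd 2 ^ i * (2 * m + 1)"
    by (simp only: power_Suc2 nat_mult_dvd_cancel_disj) simp
next
  fix j assume j: "\<not> 2 ^ Suc j dvd 2 ^ i * (2 * m + 1)"
  show "i \<le> j"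
  proof (rule ccontr)
    assume "\<not> i \<le> j"
    then have "(2::nat) ^ Suc j dvd 2 ^ i" by (intro le_imp_power_dvd) simp
    then show False using j by (metis dvd_mult2)
  qed
qed

definition bad_matrices :: "(real^'d^'e) set" where
  "bad_matrices = {A \<in> cube_at 0 1. \<forall>b\<in>intlat. b \<noteq> 0 \<longrightarrow> bad_simult (b v* A)}"

lemma hausdorff_measure_bad_matrices:
  assumes s: "0 < s" "s < real (CARD('d) * CARD('e))"
  shows "hausdorff_measure s (bad_matrices :: (real^'d^'e) set) \<noteq> 0"
proof -
  let ?d = "CARD('d)" and ?e = "CARD('e)"
  define D where "D = DIM(real^'d^'e)"
  have D: "D = ?d * ?e" by (simp add: D_def mult.commute)
  have sD: "s < real D" using s D by simp
  obtain g0 :: nat where g0: "real g0 \<ge> (2 * 3 ^ D) powr (1 / (real D - s))"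
    using real_arch_simple by blast
  \<comment> \<open>The bound 2(2D+3) makes the forbidden digits at most half of all;
    \<open>g0\<close> absorbs the factor 2 3^D lost in the averaging argument.\<close>
  define g where "g = max 2 (max (2 * (2 * D + 3)) g0)"
  have g: "g \<ge> 2" "g \<ge> 2 * (2 * D + 3)" "real g \<ge> (2 * 3 ^ D) powr (1 / (real D - s))"
    using g0 by (auto simp: g_def)
  \<comment> \<open>Per level the Dirichlet bound N is to grow by g and the side of the cube to
    shrink by g^(d+1), so that N^(d+1) times the side stays constant, as the closeness condition for
    denominators up to N^d / 2 demands.\<close>
  define \<beta> where "\<beta> = g ^ (?d + 1)"
  have g\<beta>: "g \<le> \<beta>" unfolding \<beta>_def using g(1) by (intro self_le_power) auto
  have \<beta>D: "2 * 3 ^ D \<le> real \<beta> powr (real D - s)"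
  proof -
    have "2 * 3 ^ D = ((2 * 3 ^ D) powr (1 / (real D - s))) powr (real D - s)"
      using sD by (simp add: powr_powr)
    also have "\<dots> \<le> real \<beta> powr (real D - s)"
      using sD g(3) g\<beta> by (intro powr_mono2) (auto intro: order_trans)
    finally show ?thesis .
  qed
  define bb where "bb = from_nat_into (intlat - {0 :: real^'e})"
  have ne: "intlat - {0 :: real^'e} \<noteq> {}"
  proof -
    have "(\<chi> i. 1) \<in> intlat - {0 :: real^'e}" by (auto simp: intlat_def vec_eq_iff)
    then show ?thesis by blast
  qed
  have bb: "bb i \<in> intlat" "bb i \<noteq> 0" for i
    using from_nat_into[OF ne, of i] by (auto simp: bb_def)
  \<comment> \<open>Bounds the displacement of \<open>bb i v* A\<close>, in units of the side, when
    A moves inside a cube.\<close>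
  define \<mu> where "\<mu> i = real ?e * infnorm (bb i)" for i
  \<comment> \<open>A delay for the i-th vector: letting N lag \<open>h i\<close> levels behind
    compensates the factor \<open>\<mu> i\<close> in the closeness condition.\<close>
  have "\<exists>h. 4 * real ?d * \<mu> i < real g ^ h" for i
    using g(1) by (intro real_arch_pow) auto
  then obtain h where h: "\<And>i. 4 * real ?d * \<mu> i < real g ^ h i" by metis
  define apx where "apx x N n p \<longleftrightarrow> n \<in> intlat \<and> n \<noteq> 0 \<and> infnorm n \<le> real N \<and> p \<in> \<int> \<and> \<bar>x \<bullet> n - p\<bar> \<le> 1 / real N ^ ?d"
    for x n :: "real^'d" and N p
  define dn where "dn x N = (SOME n. \<exists>p. apx x N n p)" for x N
  define dp where "dp x N = (SOME p. apx x N (dn x N) p)" for x N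
  have dir: "apx x N (dn x N) (dp x N)" if "N \<ge> 1" for x N
  proof -
    have "\<exists>n p. apx x N n p" using dirichlet_linear_form[OF that] unfolding apx_def by blast
    then have "\<exists>p. apx x N (dn x N) p" unfolding dn_def by (rule someI_ex)
    then show ?thesis unfolding dp_def by (rule someI_ex)
  qed
  \<comment> \<open>The 2-adic valuation of l+1. Index i comes up exactly when l+1 is an odd
    multiple of 2^i, hence infinitely often and with constant spacing 2^(i+1).\<close>
  define sched where "sched l = (LEAST j. \<not> 2 ^ Suc j dvd Suc l)" for l
  define \<rho> where "\<rho> l = (1 / real \<beta>) ^ l" for l
  have \<beta>0: "real \<beta> > 0" using g\<beta> g(1) by linarith
  have g0': "real g > 0" using g(1) by simp
  have \<rho>: "\<rho> l > 0" for l using \<beta>0 by (simp add: \<rho>_def)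
  have \<rho>g: "\<rho> l * real g ^ ((?d + 1) * l) = 1" for l
  proof -
    have "real \<beta> ^ l = real g ^ ((?d + 1) * l)" unfolding \<beta>_def of_nat_power by (rule power_mult[symmetric])
    then show ?thesis using g0' by (simp add: \<rho>_def power_divide)
  qed
  define NN where "NN l = g ^ (l - h (sched l))" for l
  have NN: "NN l \<ge> 1" for l using g(1) by (simp add: NN_def)
  define x0 where "x0 l a = bb (sched l) v* a" for l and a :: "real^'d^'e"
  define nn where "nn l a = dn (x0 l a) (NN l)" for l a
  define pp where "pp l a = dp (x0 l a) (NN l)" for l a
  \<comment> \<open>A rank one matrix, the outer product of b and n: its inner product with A is the
    value of bA at n, so a neighbourhood of the hyperplane for bA becomes a slab in the space of
    matrices.\<close>
  define v where "v l a = (\<chi> r c. bb (sched l) $ r * nn l a $ c)" for l a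
  have nn: "nn l a \<in> intlat" "nn l a \<noteq> 0" "infnorm (nn l a) \<le> NN l" "pp l a \<in> \<int>"
     "\<bar>x0 l a \<bullet> nn l a - pp l a\<bar> \<le> 1 / real (NN l) ^ ?d" for l a
    using dir[OF NN, of "x0 l a" l] by (auto simp: nn_def pp_def apx_def)
  have v_inner: "v l a \<bullet> A = (bb (sched l) v* A) \<bullet> nn l a" for l a and A :: "real^'d^'e"
  proof -
    have "v l a \<bullet> A = (\<Sum>r\<in>UNIV. \<Sum>c\<in>UNIV. bb (sched l) $ r * nn l a $ c * A $ r $ c)"
      by (simp add: inner_vec_def v_def)
    also have "\<dots> = (\<Sum>c\<in>UNIV. \<Sum>r\<in>UNIV. bb (sched l) $ r * nn l a $ c * A $ r $ c)"
      by (rule sum.swap)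
    also have "\<dots> = (bb (sched l) v* A) \<bullet> nn l a"
      by (simp add: inner_vec_def vector_matrix_mult_def sum_distrib_left sum_distrib_right mult_ac)
    finally show ?thesis .
  qed
  define mx where "mx l a = Max ((\<lambda>b. \<bar>v l a \<bullet> b\<bar>) ` Basis)" for l a
  have mx_ge: "\<bar>v l a \<bullet> b\<bar> \<le> mx l a" if "b \<in> Basis" for l a b
    unfolding mx_def using that by (intro Max_ge) auto
  \<comment> \<open>Some entry of the nonzero integer vector b has modulus at least 1, so
    multiplying n by it does not shrink n.\<close>
  have mx_nn: "infnorm (nn l a) \<le> mx l a" for l a
  proof -
    obtain c where c: "\<bar>nn l a $ c\<bar> = infnorm (nn l a)" using infnorm_cart_attained by blast
    obtain r where r: "\<bar>bb (sched l) $ r\<bar> = infnorm (bb (sched l))" using infnorm_cart_attained by blast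
    have "1 * infnorm (nn l a) \<le> \<bar>bb (sched l) $ r\<bar> * infnorm (nn l a)"
      using infnorm_intlat_ge_1[OF bb] r by (intro mult_right_mono) (auto simp: infnorm_pos_le)
    also have "\<dots> = \<bar>v l a \<bullet> axis r (axis c 1)\<bar>" 
      by (simp add: inner_axis v_def abs_mult c)
    also have "\<dots> \<le> mx l a" by (intro mx_ge) (simp add: axis_in_Basis_iff)
    finally show ?thesis by simp
  qed
  have mx_pos: "mx l a > 0" for l a
    using mx_nn[of l a] infnorm_intlat_ge_1[OF nn(1,2), of l a] by linarith
  \<comment> \<open>Below the delay the exponent in \<open>NN\<close> is truncated to 0, and nothing
    is forbidden there.\<close>
  define Fb where "Fb l a = (if h (sched l) \<le> l then
      {k. \<exists>x\<in>cube_at (a + \<rho> (Suc l) *\<^sub>R digit_vec k) (\<rho> (Suc l)). \<bar>v l a \<bullet> x - pp l a\<bar> \<le> mx l a * \<rho> (Suc l)} else {})" for l a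
  have Fb: "2 * card (digits \<beta> \<inter> Fb l a) \<le> \<beta> ^ DIM(real^'d^'e)" for l a
  proof (cases "h (sched l) \<le> l")
    case True
    have "mx l a \<in> (\<lambda>b. \<bar>v l a \<bullet> b\<bar>) ` Basis" unfolding mx_def by (intro Max_in) auto
    then obtain b0 where b0: "b0 \<in> Basis" "mx l a = \<bar>v l a \<bullet> b0\<bar>" by auto
    have eq: "digits \<beta> \<inter> Fb l a = {k \<in> digits \<beta>. \<exists>x\<in>cube_at (a + \<rho> (Suc l) *\<^sub>R digit_vec k) (\<rho> (Suc l)). \<bar>v l a \<bullet> x - pp l a\<bar> \<le> \<bar>v l a \<bullet> b0\<bar> * \<rho> (Suc l)}"
      using True by (auto simp: Fb_def b0(2))
    have "card (digits \<beta> \<inter> Fb l a) \<le> (2 * D + 3) * \<beta> ^ (D - 1)"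
      unfolding eq D_def
    proof (rule card_digits_meeting_slab[OF \<rho> b0(1)])
      show "v l a \<bullet> b0 \<noteq> 0" using mx_pos[of l a] b0(2) by auto
      show "\<And>b. b \<in> Basis \<Longrightarrow> \<bar>v l a \<bullet> b\<bar> \<le> \<bar>v l a \<bullet> b0\<bar>" using mx_ge b0(2) by metis
    qed
    then have "2 * card (digits \<beta> \<inter> Fb l a) \<le> 2 * (2 * D + 3) * \<beta> ^ (D - 1)"
      unfolding mult.assoc[of 2] by (rule mult_le_mono2)
    also have "\<dots> \<le> \<beta> * \<beta> ^ (D - 1)" using g(2) g\<beta> by (intro mult_right_mono) auto
    also have "\<dots> = \<beta> ^ D" using D by (metis mult.commute power_minus_mult zero_less_card_finite nat_0_less_mult_iff)
    finally show ?thesis by (simp add: D_def)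
  qed (simp add: Fb_def)
  show ?thesis
  proof (rule hausdorff_measure_nonzero_of_cube_strategy[OF s(1) _ _ Fb])
    show "2 \<le> \<beta>" using g(1) g\<beta> by simp
    show "2 * 3 ^ DIM(real^'d^'e) \<le> real \<beta> powr (real DIM(real^'d^'e) - s)" using \<beta>D by (simp only: D_def)
  next
    fix a :: "nat \<Rightarrow> real^'d^'e" and \<kappa> A
    assume a0: "a 0 = 0" and \<kappa>: "\<And>l. \<kappa> l \<in> digits \<beta> - Fb l (a l)"
      and aS: "\<And>l. a (Suc l) = a l + (1 / real \<beta>) ^ Suc l *\<^sub>R digit_vec (\<kappa> l)"
      and A: "\<And>l. A \<in> cube_at (a l) ((1 / real \<beta>) ^ l)"
    have A: "A \<in> cube_at (a l) (\<rho> l)" for l using A by (simp add: \<rho>_def)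
    have aS: "a (Suc l) = a l + \<rho> (Suc l) *\<^sub>R digit_vec (\<kappa> l)" for l using aS by (simp only: \<rho>_def)
    have "bad_simult (b v* A)" if b: "b \<in> intlat" "b \<noteq> 0" for b
    proof -
      obtain i where i: "bb i = b"
        using from_nat_into_surj[of "intlat - {0}" b] countable_intlat b unfolding bb_def by (auto intro: countable_Diff)
      \<comment> \<open>The spacing of the levels assigned to i. From one of them to the next N^d
        grows by g^(dP); W records this together with the 2 from 2q \<le> N^d.\<close>
      define P where "P = (2::nat) ^ Suc i"
      define W where "W = 2 * real g ^ (?d * P)"
      have W: "W > 0" using g0' by (simp add: W_def)
      \<comment> \<open>The constant value of N^(d+1) times the side of a subcube at the levels
        assigned to i, once the delay has passed.\<close>
      define \<kappa>0 where "\<kappa>0 = 1 / real g ^ ((?d + 1) * (h i + 1))"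
      have \<kappa>0: "\<kappa>0 > 0" using g0' by (simp add: \<kappa>0_def)
      define c where "c = min (1 / ((4 * real ?d) ^ ?d * W)) (\<kappa>0 ^ ?d / (real ?d ^ ?d * W ^ (?d + 1)))"
      have c: "c > 0" using W \<kappa>0 by (simp add: c_def)
      define lm where "lm m = 2 ^ i * (2 * m + 1) - (1::nat)" for m
      have Slm: "Suc (lm m) = 2 ^ i * (2 * m + 1)" for m by (simp add: lm_def)
      have sched: "sched (lm m) = i" for m unfolding sched_def Slm by (rule Least_not_pow2_dvd)
      have "c \<le> real q * infnorm (real q *\<^sub>R (b v* A) - p) ^ ?d" if q: "q \<ge> 1" and p: "p \<in> intlat" for q :: nat and p
      proof -
        \<comment> \<open>The first assigned level at which N^d reaches 2q is used for q; its
          minimality yields the converse bound N^d \<le> W q.\<close>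
        define good where "good m \<longleftrightarrow> h i \<le> lm m \<and> 2 * q \<le> g ^ (?d * (lm m - h i))" for m
        have ex: "good (h i + 2 * q)"
        proof -
          let ?m = "h i + 2 * q"
          have "1 * (2 * ?m + 1) \<le> 2 ^ i * (2 * ?m + 1)" by (intro mult_right_mono) auto
          then have l: "2 * ?m \<le> lm ?m" unfolding Slm[of ?m, symmetric] by simp
          have "2 * q \<le> ?d * (2 * q)" by (simp add: Suc_leI)
          also have "\<dots> \<le> ?d * (lm ?m - h i)" using l by (intro mult_left_mono) auto
          also have "\<dots> \<le> 2 ^ (?d * (lm ?m - h i))" by (rule less_imp_le, rule less_exp)
          also have "\<dots> \<le> g ^ (?d * (lm ?m - h i))" using g(1) by (intro power_mono) auto
          finally show ?thesis using l by (simp add: good_def)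
        qed
        define m where "m = (LEAST m. good m)"
        have m: "good m" unfolding m_def by (rule LeastI[of good, OF ex])
        define l where "l = lm m"
        have sl: "sched l = i" by (simp add: l_def sched)
        have hl: "h i \<le> l" using m by (simp add: good_def l_def)
        define N where "N = NN l"
        have N: "N = g ^ (l - h i)" by (simp add: N_def NN_def sl)
        have N1: "N \<ge> 1" unfolding N_def by (rule NN)
        have Nd: "N ^ ?d = g ^ (?d * (l - h i))" by (simp add: N power_mult[symmetric] mult.commute)
        have qN: "2 * q \<le> N ^ ?d" using m unfolding good_def l_def[symmetric] Nd by simp
        have small: "real N ^ ?d \<le> W * q" if "l - h i \<le> P"
        proof -
          have "real N ^ ?d = real g ^ (?d * (l - h i))" using Nd by (metis of_nat_power)
          also have "\<dots> \<le> real g ^ (?d * P)" using that g(1) by (intro power_increasing) auto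
          also have "\<dots> \<le> W * 1" using g0' by (simp add: W_def)
          also have "\<dots> \<le> W * q" using q W by (intro mult_left_mono) auto
          finally show ?thesis .
        qed
        \<comment> \<open>If the level is the first one assigned to i, or its predecessor lies below
          the delay, the exponent of N is at most P. Otherwise the predecessor failed because its
          power N^d was below 2q.\<close>
        have NW: "real N ^ ?d \<le> W * q"
        proof (cases m)
          case 0
          then have "l < P" using Slm[of 0] by (simp add: l_def P_def)
          then show ?thesis by (intro small) simp
        next
          case (Suc m')
          have "Suc l = Suc (lm m') + P" unfolding l_def Slm Suc P_def by (simp add: algebra_simps)
          then have l: "l = lm m' + P" by simp
          have "\<not> good m'" using not_less_Least[of m' good] Suc unfolding m_def by simp
          then consider "lm m' < h i" | "h i \<le> lm m'" "g ^ (?d * (lm m' - h i)) < 2 * q"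
            unfolding good_def by linarith
          then show ?thesis
          proof cases
            case 1
            then show ?thesis using l by (intro small) simp
          next
            case 2
            have "real N ^ ?d = real g ^ (?d * (l - h i))" using Nd by (metis of_nat_power)
            also have "?d * (l - h i) = ?d * (lm m' - h i) + ?d * P" using 2(1) l by (simp flip: distrib_left)
            also have "real g ^ \<dots> = real (g ^ (?d * (lm m' - h i))) * real g ^ (?d * P)" by (simp add: power_add)
            also have "\<dots> \<le> real (2 * q) * real g ^ (?d * P)"
              using 2(2) g0' by (intro mult_right_mono of_nat_mono) simp_all
            finally show ?thesis by (simp add: W_def mult_ac)
          qed
        qed
        define x where "x = b v* A"
        define \<theta> where "\<theta> = infnorm (real q *\<^sub>R x - p)"
        define n where "n = nn l (a l)"
        define \<sigma> where "\<sigma> = \<rho> (Suc l)"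
        have \<theta>0: "\<theta> \<ge> 0" by (simp add: \<theta>_def infnorm_pos_le)
        have near: "infnorm (x - x0 l (a l)) \<le> \<mu> i * \<rho> l"
          unfolding infnorm_cart_le_iff
        proof
          fix c
          have comp: "\<bar>A $ r $ c - a l $ r $ c\<bar> \<le> \<rho> l" for r
          proof -
            have "axis r (axis c 1) \<in> (Basis :: (real^'d^'e) set)" by (simp add: axis_in_Basis_iff)
            then have "a l \<bullet> axis r (axis c 1) \<le> A \<bullet> axis r (axis c 1) \<and> A \<bullet> axis r (axis c 1) \<le> a l \<bullet> axis r (axis c 1) + \<rho> l"
              using A[of l] unfolding mem_cube_at by blast
            then show ?thesis by (simp add: inner_axis)
          qed
          have "(x - x0 l (a l)) $ c = (\<Sum>r\<in>UNIV. b $ r * (A $ r $ c - a l $ r $ c))"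
            by (simp add: x_def x0_def sl i vector_matrix_mult_def right_diff_distrib sum_subtractf)
          also have "\<bar>\<dots>\<bar> \<le> (\<Sum>r\<in>(UNIV::'e set). infnorm b * \<rho> l)"
          proof (intro order_trans[OF sum_abs] sum_mono)
            fix r show "\<bar>b $ r * (A $ r $ c - a l $ r $ c)\<bar> \<le> infnorm b * \<rho> l"
              unfolding abs_mult by (intro mult_mono component_le_infnorm_cart comp) (auto simp: infnorm_pos_le)
          qed
          finally show "\<bar>(x - x0 l (a l)) $ c\<bar> \<le> \<mu> i * \<rho> l" by (simp add: \<mu>_def i mult_ac)
        qed
        have Ng: "real N ^ (?d + 1) * real g ^ ((?d + 1) * h i) = real g ^ ((?d + 1) * l)"
        proof -
          have "real N ^ (?d + 1) = real g ^ ((?d + 1) * (l - h i))"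
            unfolding N of_nat_power power_mult[symmetric] by (simp only: mult.commute)
          then show ?thesis using hl by (simp flip: power_add distrib_left)
        qed
        have N\<rho>: "real N ^ (?d + 1) * \<rho> l = 1 / real g ^ ((?d + 1) * h i)"
        proof -
          have "(real N ^ (?d + 1) * \<rho> l) * real g ^ ((?d + 1) * h i) = 1"
            using Ng \<rho>g[of l] by (metis mult.assoc mult.commute)
          then show ?thesis using g0' by (simp add: nonzero_eq_divide_eq)
        qed
        have "4 * real ?d * (\<mu> i * \<rho> l) * real N ^ (?d + 1) = 4 * real ?d * \<mu> i / real g ^ ((?d + 1) * h i)"
        proof -
          have "4 * real ?d * (\<mu> i * \<rho> l) * real N ^ (?d + 1) = 4 * real ?d * \<mu> i * (real N ^ (?d + 1) * \<rho> l)"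
            by (simp only: mult_ac)
          then show ?thesis unfolding N\<rho> by simp
        qed
        also have "\<dots> \<le> 1"
        proof -
          have "4 * real ?d * \<mu> i \<le> real g ^ h i" using h less_imp_le by blast
          also have "\<dots> \<le> real g ^ ((?d + 1) * h i)" using g(1) by (intro power_increasing) auto
          finally show ?thesis using g0' by (simp add: pos_divide_le_eq)
        qed
        finally have near2: "4 * real ?d * (\<mu> i * \<rho> l) * real N ^ (?d + 1) \<le> 1" .
        have off: "\<bar>x \<bullet> n - pp l (a l)\<bar> > infnorm n * \<sigma>"
        proof -
          have "A \<in> cube_at (a l + \<rho> (Suc l) *\<^sub>R digit_vec (\<kappa> l)) (\<rho> (Suc l))" using A[of "Suc l"] by (simp only: aS)
          moreover have "\<kappa> l \<notin> Fb l (a l)" using \<kappa> by blast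
          ultimately have "\<not> \<bar>v l (a l) \<bullet> A - pp l (a l)\<bar> \<le> mx l (a l) * \<rho> (Suc l)"
            using hl sl unfolding Fb_def by auto
          moreover have "v l (a l) \<bullet> A = x \<bullet> n" by (simp add: v_inner x_def n_def sl i)
          moreover have "infnorm n * \<sigma> \<le> mx l (a l) * \<rho> (Suc l)"
            unfolding \<sigma>_def n_def using mx_nn \<rho>[of "Suc l"] by (intro mult_right_mono) auto
          ultimately show ?thesis by linarith
        qed
        have n1: "infnorm n \<ge> 1" unfolding n_def by (rule infnorm_intlat_ge_1[OF nn(1,2)])
        \<comment> \<open>If \<theta> is at least 1/(4dN), the bound N^d \<le> W q suffices. If not,
          p/q lies on the avoided hyperplane, so \<theta> > q \<sigma> / d, and q \<theta>^d \<ge>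
          q^(d+1) (\<sigma>/d)^d is bounded below because q \<ge> N^d / W.\<close>
        have "c \<le> real q * \<theta> ^ ?d"
        proof (cases "\<theta> < 1 / (4 * real ?d * real N)")
          case True
          have "real q * (infnorm n * \<sigma>) < real ?d * infnorm n * \<theta>"
            unfolding \<theta>_def
            by (rule rational_points_near_on_hyperplane[where x = x and N = N and n = n and p = p and ?n0.0 = "pp l (a l)" and ?x0.0 = "x0 l (a l)"])
              (use nn[of l "a l"] near near2 q qN p off True N1 in \<open>simp_all add: n_def N_def \<theta>_def\<close>)
          then have "infnorm n * (real q * \<sigma>) < infnorm n * (real ?d * \<theta>)" by (simp only: mult_ac)
          then have "real q * \<sigma> < real ?d * \<theta>" using n1 by (simp only: mult_less_cancel_left_pos)
          then have "real q * \<sigma> / real ?d \<le> \<theta>" by (simp add: pos_divide_le_eq mult.commute)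
          moreover have \<sigma>: "\<sigma> > 0" unfolding \<sigma>_def by (rule \<rho>)
          ultimately have le: "(real q * \<sigma> / real ?d) ^ ?d \<le> \<theta> ^ ?d" by (intro power_mono) auto
          have Nq: "real N ^ ?d / W \<le> q" using NW W by (simp add: pos_divide_le_eq mult.commute)
          have N\<sigma>: "real N ^ (?d + 1) * \<sigma> = \<kappa>0"
          proof -
            have "real N ^ (?d + 1) * \<sigma> = (real N ^ (?d + 1) * \<rho> l) * (1 / real \<beta>)" by (simp add: \<sigma>_def \<rho>_def)
            also have "\<dots> = \<kappa>0" unfolding N\<rho> \<kappa>0_def \<beta>_def by (simp add: power_add)
            finally show ?thesis .
          qed
          have "\<kappa>0 ^ ?d / (real ?d ^ ?d * W ^ (?d + 1)) = (real N ^ ?d / W) ^ (?d + 1) * (\<sigma> / real ?d) ^ ?d"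
            unfolding N\<sigma>[symmetric] power_divide power_mult_distrib power_mult[symmetric]
            by (simp only: mult.commute times_divide_times_eq)
          also have "\<dots> \<le> real q ^ (?d + 1) * (\<sigma> / real ?d) ^ ?d"
            using Nq W \<sigma> by (intro mult_right_mono power_mono) auto
          also have "\<dots> = real q * (real q * \<sigma> / real ?d) ^ ?d" by (simp add: power_mult_distrib power_divide)
          also have "\<dots> \<le> real q * \<theta> ^ ?d" using le by (intro mult_left_mono) auto
          finally show ?thesis by (simp add: c_def)
        next
          case False
          have N0: "real N > 0" using N1 by simp
          have q0: "real q > 0" using q by simp
          have "1 / ((4 * real ?d) ^ ?d * W) = real q / ((4 * real ?d) ^ ?d * (W * q))" using q0 by simp
          also have "\<dots> \<le> real q / ((4 * real ?d) ^ ?d * real N ^ ?d)"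
            using NW N0 W q0 by (intro divide_left_mono mult_left_mono mult_pos_pos zero_less_power) auto
          also have "\<dots> = real q * (1 / (4 * real ?d * real N)) ^ ?d" by (simp add: power_mult_distrib power_divide)
          also have "\<dots> \<le> real q * \<theta> ^ ?d" using False N0 by (intro mult_left_mono power_mono) auto
          finally show ?thesis by (simp add: c_def)
        qed
        then show ?thesis by (simp only: \<theta>_def x_def)
      qed
      then show ?thesis unfolding bad_simult_def using c by blast
    qed
    then show "A \<in> bad_matrices" using A[of 0] a0 by (simp add: bad_matrices_def \<rho>_def)
  qed
qed

theorem hausdorff_dim_bad_matrices:
  "hausdorff_dim (bad_matrices :: (real^'d^'e) set) = real (CARD('d) * CARD('e))"
proof -
  let ?S = "{s. 0 < s \<and> hausdorff_measure s (bad_matrices :: (real^'d^'e) set) = 0}"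
  let ?D = "real (CARD('d) * CARD('e))"
  have up: "s \<in> ?S" if "s > ?D" for s
  proof -
    have "hausdorff_measure s (bad_matrices :: (real^'d^'e) set) = 0"
      using that by (intro hausdorff_measure_subset_unit_cube) (auto simp: bad_matrices_def mult.commute)
    moreover have "0 < s" by (rule le_less_trans[OF of_nat_0_le_iff that])
    ultimately show ?thesis by simp
  qed
  have lo: "?D \<le> s" if "s \<in> ?S" for s
    using that hausdorff_measure_bad_matrices[of s, where 'd = 'd and 'e = 'e] by (cases "s < ?D") auto
  have "Inf ?S \<le> ?D"
  proof (rule field_le_epsilon)
    fix \<epsilon> :: real assume "\<epsilon> > 0"
    then show "Inf ?S \<le> ?D + \<epsilon>"
      using lo by (intro cInf_lower up bdd_belowI[of _ ?D]) auto
  qed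
  moreover have "?D \<le> Inf ?S" using lo up[of "?D + 1"] by (intro cInf_greatest) auto
  ultimately show ?thesis unfolding hausdorff_dim_def by simp
qed

section \<open>Torus coordinates of a cut and project set\<close>

definition horiz :: "real^('d::finite + 'e::finite) \<Rightarrow> real^'d" where
  "horiz v = (\<chi> a. v $ Inl a)"

definition vert :: "real^('d::finite + 'e::finite) \<Rightarrow> real^'e" where
  "vert v = (\<chi> b. v $ Inr b)"

definition pair_vec :: "real^'d \<Rightarrow> real^'e \<Rightarrow> real^('d::finite + 'e::finite)" where
  "pair_vec x y = (\<chi> i. case i of Inl a \<Rightarrow> x $ a | Inr b \<Rightarrow> y $ b)"

lemma horiz_pair [simp]: "horiz (pair_vec x y) = x" and vert_pair [simp]: "vert (pair_vec x y) = y"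
  by (simp_all add: horiz_def vert_def pair_vec_def)

lemma pair_horiz_vert [simp]: "pair_vec (horiz v) (vert v) = v"
proof (subst vec_eq_iff, rule allI)
  fix i show "pair_vec (horiz v) (vert v) $ i = v $ i"
    by (cases i) (simp_all add: horiz_def vert_def pair_vec_def)
qed

lemma pair_vec_eqI: "horiz v = horiz v' \<Longrightarrow> vert v = vert v' \<Longrightarrow> v = v'"
  by (metis pair_horiz_vert)

lemma linear_horiz: "linear horiz" and linear_vert: "linear vert"
  by (auto intro!: linearI simp: horiz_def vert_def vec_eq_iff)

lemmas horiz_simps [simp] = linear_add[OF linear_horiz] linear_diff[OF linear_horiz] linear_scale[OF linear_horiz] linear_0[OF linear_horiz] linear_neg[OF linear_horiz]
lemmas vert_simps [simp] = linear_add[OF linear_vert] linear_diff[OF linear_vert] linear_scale[OF linear_vert] linear_0[OF linear_vert] linear_neg[OF linear_vert]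

lemma graph_emb_eq: "graph_emb A x = pair_vec x (A *v x)"
  by (simp add: graph_emb_def pair_vec_def)

lemma horiz_graph_emb [simp]: "horiz (graph_emb A x) = x"
  and vert_graph_emb [simp]: "vert (graph_emb A x) = A *v x"
  by (simp_all add: graph_emb_eq)

lemma linear_graph_emb: "linear (graph_emb A)"
  by (rule linearI; rule pair_vec_eqI) (simp_all add: matrix_vector_right_distrib linear_scale[OF matrix_vector_mul_linear])

lemma subspace_graphE: "subspace (graphE A)"
  unfolding graphE_def by (rule linear_subspace_image[OF linear_graph_emb subspace_UNIV])

lemma mem_Fsp: "v \<in> Fsp \<longleftrightarrow> horiz v = 0"
  by (simp add: Fsp_def horiz_def vec_eq_iff)

lemma subspace_Fsp: "subspace Fsp"
  by (auto simp: subspace_def mem_Fsp)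

lemma mem_graphE: "v \<in> graphE A \<longleftrightarrow> v = graph_emb A (horiz v)"
  by (auto simp: graphE_def)

lemma graphE_Int_Fsp: "graphE A \<inter> Fsp = {0}"
  using linear_0[OF linear_graph_emb, of A] by (auto simp: mem_graphE mem_Fsp)

lemma intlat_horiz: "n \<in> intlat \<Longrightarrow> horiz n \<in> intlat"
  and intlat_vert: "n \<in> intlat \<Longrightarrow> vert n \<in> intlat"
  by (auto simp: intlat_def horiz_def vert_def)

lemma intlat_pair_vec: "x \<in> intlat \<Longrightarrow> y \<in> intlat \<Longrightarrow> pair_vec x y \<in> intlat"
  by (auto simp: intlat_def pair_vec_def split: sum.split)

lemma infnorm_horiz_le: "infnorm (horiz v) \<le> infnorm v"
  using component_le_infnorm_cart[of v] by (auto simp: infnorm_cart_le_iff horiz_def)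

section \<open>Projections along complementary subspaces\<close>

lemma proj_along_eqI:
  assumes "subspace U" "subspace W" "U \<inter> W = {0}" "u \<in> U" "v - u \<in> W"
  shows "proj_along U W v = u"
  unfolding proj_along_def
proof (rule the_equality)
  fix u' assume u': "u' \<in> U \<and> v - u' \<in> W"
  have "u' - u \<in> U" using assms u' by (auto intro: subspace_diff)
  moreover have "(v - u) - (v - u') \<in> W" using assms u' by (blast intro: subspace_diff)
  then have "u' - u \<in> W" by simp
  ultimately have "u' - u \<in> U \<inter> W" by blast
  then show "u' = u" using assms(3) by simp
qed (intro conjI assms)

lemma
  assumes UW: "subspace U" "subspace W" "U \<inter> W = {0}" and dec: "\<forall>v. \<exists>u\<in>U. \<exists>x\<in>W. v = u + x"
  shows proj_along_mem: "proj_along U W v \<in> U"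
    and proj_along_diff_mem: "v - proj_along U W v \<in> W"
    and linear_proj_along: "linear (proj_along U W)"
proof -
  have *: "proj_along U W v \<in> U \<and> v - proj_along U W v \<in> W" for v
  proof -
    obtain u x where "u \<in> U" "x \<in> W" "v = u + x" using dec by blast
    moreover from this have "proj_along U W v = u" by (intro proj_along_eqI[OF UW]) auto
    ultimately show ?thesis by simp
  qed
  show "proj_along U W v \<in> U" "v - proj_along U W v \<in> W" using * by auto
  show "linear (proj_along U W)"
  proof (rule linearI)
    fix x y :: "real^'a" and c :: real
    have "x + y - (proj_along U W x + proj_along U W y) = (x - proj_along U W x) + (y - proj_along U W y)" by simp
    moreover have "\<dots> \<in> W" using * UW(2) by (blast intro: subspace_add)
    ultimately have "x + y - (proj_along U W x + proj_along U W y) \<in> W" by metis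
    then show "proj_along U W (x + y) = proj_along U W x + proj_along U W y"
      using * UW(1,2) by (intro proj_along_eqI[OF UW]) (auto intro: subspace_add)
    have "c *\<^sub>R x - c *\<^sub>R proj_along U W x = c *\<^sub>R (x - proj_along U W x)" by (simp add: scaleR_diff_right)
    then show "proj_along U W (c *\<^sub>R x) = c *\<^sub>R proj_along U W x"
      using * UW by (intro proj_along_eqI[OF UW]) (auto intro: subspace_scale)
  qed
qed

lemma det_Ints:
  fixes M :: "real^'n^'n"
  assumes "\<And>i j. M $ i $ j \<in> \<int>"
  shows "det M \<in> \<int>"
  unfolding det_def
proof (rule Ints_sum)
  fix \<pi> :: "'n \<Rightarrow> 'n"
  have "(\<Prod>i\<in>UNIV. M $ i $ \<pi> i) \<in> \<int>" using assms by (intro Ints_prod)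
  then show "of_int (sign \<pi>) * (\<Prod>i\<in>UNIV. M $ i $ \<pi> i) \<in> \<int>" by (intro Ints_mult Ints_of_int)
qed

text \<open>Q times the value of the scaled form at (n, p) is the value of the original form at (n,
  Q p).\<close>

lemma bad_form_scaleR_inverse:
  fixes x :: "real^'d"
  assumes "bad_form x" "Q \<in> \<int>" "Q > 0"
  shows "bad_form ((1 / Q) *\<^sub>R x)"
proof -
  obtain c where c: "c > 0" "\<And>n p. n \<in> intlat \<Longrightarrow> n \<noteq> 0 \<Longrightarrow> p \<in> \<int> \<Longrightarrow> c / infnorm n ^ CARD('d) \<le> \<bar>x \<bullet> n - p\<bar>"
    using assms(1) by (auto simp: bad_form_def)
  have "(c / Q) / infnorm n ^ CARD('d) \<le> \<bar>((1 / Q) *\<^sub>R x) \<bullet> n - p\<bar>" if n: "n \<in> intlat" "n \<noteq> 0" "p \<in> \<int>" for n p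
  proof -
    have "Q * (((1 / Q) *\<^sub>R x) \<bullet> n - p) = x \<bullet> n - Q * p" using assms(3) by (simp add: right_diff_distrib)
    then have "Q * \<bar>((1 / Q) *\<^sub>R x) \<bullet> n - p\<bar> = \<bar>x \<bullet> n - Q * p\<bar>" using assms(3) by (metis abs_mult abs_of_pos)
    moreover have "c / infnorm n ^ CARD('d) \<le> \<bar>x \<bullet> n - Q * p\<bar>" using n assms(2) by (intro c(2)) auto
    ultimately have "c / infnorm n ^ CARD('d) / Q \<le> \<bar>((1 / Q) *\<^sub>R x) \<bullet> n - p\<bar>"
      using assms(3) by (metis mult.commute pos_divide_le_eq)
    then show ?thesis by (simp add: mult.commute)
  qed
  then show ?thesis unfolding bad_form_def using c(1) assms(3) by (intro exI[of _ "c / Q"]) auto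
qed

lemma finite_intlat_bounded: "finite {v :: real^'n. v \<in> intlat \<and> infnorm v \<le> B}"
proof -
  let ?R = "(UNIV :: 'n set) \<rightarrow>\<^sub>E {- \<lceil>B\<rceil>..\<lceil>B\<rceil>}"
  have "{v :: real^'n. v \<in> intlat \<and> infnorm v \<le> B} \<subseteq> (\<lambda>f. \<chi> i. of_int (f i)) ` ?R"
  proof
    fix v :: "real^'n" assume "v \<in> {v. v \<in> intlat \<and> infnorm v \<le> B}"
    then have v: "\<And>i. v $ i \<in> \<int>" "\<And>i. \<bar>v $ i\<bar> \<le> B" by (auto simp: intlat_def infnorm_cart_le_iff)
    have eq: "v = (\<chi> i. of_int \<lfloor>v $ i\<rfloor>)" using v(1) by (auto simp: vec_eq_iff elim!: Ints_cases)
    have "\<lfloor>v $ i\<rfloor> \<in> {- \<lceil>B\<rceil>..\<lceil>B\<rceil>}" for i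
    proof -
      have 1: "of_int \<lfloor>v $ i\<rfloor> = v $ i" using v(1)[of i] by simp
      have "- B \<le> of_int \<lfloor>v $ i\<rfloor>" "of_int \<lfloor>v $ i\<rfloor> \<le> B" using v(2)[of i] unfolding 1 by linarith+
      then show ?thesis by (simp add: le_ceiling_iff) linarith
    qed
    then show "v \<in> (\<lambda>f. \<chi> i. of_int (f i)) ` ?R"
      by (intro image_eqI[where x = "\<lambda>i. \<lfloor>v $ i\<rfloor>"] eq) auto
  qed
  then show ?thesis by (rule finite_subset) (intro finite_imageI finite_PiE, auto)
qed

section \<open>Shifted integer lattices\<close>

lemma lat_shift_iff: "t \<in> lat_shift s \<longleftrightarrow> t - s \<in> intlat"
proof
  assume "t - s \<in> intlat"
  then show "t \<in> lat_shift s" unfolding lat_shift_def by (intro image_eqI[of _ _ "t - s"]) simp_all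
qed (auto simp: lat_shift_def)

lemma lat_shift_add:
  assumes "t \<in> lat_shift s" "n \<in> intlat"
  shows "t + n \<in> lat_shift s"
proof -
  have "(t - s) + n \<in> intlat" using assms by (intro intlat_add) (simp_all add: lat_shift_iff)
  moreover have "(t - s) + n = t + n - s" by simp
  ultimately show ?thesis unfolding lat_shift_iff by metis
qed

lemma lat_shift_diff:
  assumes "t \<in> lat_shift s" "t' \<in> lat_shift s"
  shows "t - t' \<in> intlat"
proof -
  have "(t - s) - (t' - s) \<in> intlat" by (rule intlat_diff[OF assms[unfolded lat_shift_iff]])
  then show ?thesis by simp
qed

lemma finite_lat_shift_bounded: "finite {t \<in> lat_shift s. infnorm t \<le> R}"
proof -
  have "{t \<in> lat_shift s. infnorm t \<le> R} \<subseteq> (\<lambda>z. z + s) ` {v. v \<in> intlat \<and> infnorm v \<le> R + infnorm s}"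
  proof
    fix t assume t: "t \<in> {t \<in> lat_shift s. infnorm t \<le> R}"
    then have "infnorm (t - s) \<le> R + infnorm s" using infnorm_diff_le[of t s] by simp
    then show "t \<in> (\<lambda>z. z + s) ` {v. v \<in> intlat \<and> infnorm v \<le> R + infnorm s}"
      using t by (intro image_eqI[of _ _ "t - s"]) (simp_all add: lat_shift_iff)
  qed
  then show ?thesis using finite_intlat_bounded by (blast intro: finite_subset)
qed

lemma infnorm_sum_scaleR_le:
  fixes x :: "'i \<Rightarrow> real^'n"
  assumes "\<And>i. i \<in> I \<Longrightarrow> \<bar>c i\<bar> \<le> B"
  shows "infnorm (\<Sum>i\<in>I. c i *\<^sub>R x i) \<le> (\<Sum>i\<in>I. B * infnorm (x i))"
  unfolding infnorm_cart_le_iff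
proof
  fix l
  have "\<bar>(\<Sum>i\<in>I. c i *\<^sub>R x i) $ l\<bar> \<le> (\<Sum>i\<in>I. \<bar>c i * x i $ l\<bar>)"
    by (simp add: sum_abs)
  also have "\<dots> \<le> (\<Sum>i\<in>I. B * infnorm (x i))"
    unfolding abs_mult using assms
    by (intro sum_mono mult_mono component_le_infnorm_cart) (auto intro: order_trans[OF abs_ge_zero])
  finally show "\<bar>(\<Sum>i\<in>I. c i *\<^sub>R x i) $ l\<bar> \<le> (\<Sum>i\<in>I. B * infnorm (x i))" .
qed

section \<open>Cut and project data with an integral parallelotope window\<close>

locale cut_project =
  fixes A :: "real^'d^'e" and F0 :: "(real^('d::finite + 'e::finite)) set" 
    and w :: "'e \<Rightarrow> real^('d + 'e)" and W :: "(real^('d + 'e)) set" and s :: "real^('d + 'e)"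
  assumes bad: "\<And>b. b \<in> intlat \<Longrightarrow> b \<noteq> 0 \<Longrightarrow> bad_form (b v* A)"
    and irrational: "totally_irrational (graphE A)"
    and F0: "admissible_F0 (graphE A) F0"
    and w: "\<And>j. w j \<in> Fsp" "\<And>j. w j \<in> intlat" "inj w" "independent (range w)"
    and W: "W = {(\<Sum>j\<in>UNIV. t j *\<^sub>R w j) | t. \<forall>j. 0 \<le> t j \<and> t j \<le> 1}"
    and s: "regular_pt A W s"
begin

definition p :: "real^('d + 'e) \<Rightarrow> real^('d + 'e)" where "p = proj_along (graphE A) F0"

lemma F0': "subspace F0" "graphE A \<inter> F0 = {0}" "\<forall>v. \<exists>e\<in>graphE A. \<exists>f\<in>F0. v = e + f" "F0 \<inter> intlat = {0}"
  using F0 by (auto simp: admissible_F0_def)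

lemma linear_p: "linear p"
  unfolding p_def by (rule linear_proj_along[OF subspace_graphE F0'(1-3)])

lemma p_in_graphE: "p v \<in> graphE A"
  unfolding p_def by (rule proj_along_mem[OF subspace_graphE F0'(1-3)])

lemmas p_simps [simp] = linear_add[OF linear_p] linear_diff[OF linear_p] linear_scale[OF linear_p] linear_0[OF linear_p] linear_neg[OF linear_p] linear_sum[OF linear_p]

lemma p_graph_emb [simp]: "p (graph_emb A x) = graph_emb A x"
  unfolding p_def by (rule proj_along_eqI[OF subspace_graphE F0'(1,2)]) (auto simp: graphE_def subspace_0 F0'(1))

lemma p_inj_on_intlat: "n \<in> intlat \<Longrightarrow> p n = 0 \<Longrightarrow> n = 0"
  using proj_along_diff_mem[OF subspace_graphE F0'(1-3), of n] F0'(4) by (auto simp: p_def)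

definition M :: "real^'e^'e" where "M = (\<chi> b j. vert (w j) $ b)"

text \<open>The coordinates, with respect to the edges w, of the projection to F along E. Its kernel
  is E, and the strip is the preimage of the closed unit cube.\<close>

definition u :: "real^('d + 'e) \<Rightarrow> real^'e" where
  "u v = matrix_inv M *v (vert v - A *v horiz v)"

lemma horiz_w [simp]: "horiz (w j) = 0" using w(1) by (simp add: mem_Fsp)

lemma M_mult: "M *v t = vert (\<Sum>j\<in>UNIV. t $ j *\<^sub>R w j)"
  by (simp add: vec_eq_iff M_def matrix_vector_mult_def linear_sum[OF linear_vert] mult.commute)

lemma sum_w_eq_0:
  assumes "(\<Sum>j\<in>UNIV. t j *\<^sub>R w j) = 0" shows "t j = 0"
proof -
  have "(\<Sum>v\<in>range w. t (inv w v) *\<^sub>R v) = 0"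
    using assms w(3) by (subst sum.reindex) auto
  then have "t (inv w (w j)) = 0"
    by (rule independentD[OF w(4), where t = "range w" and v = "w j" and u = "t \<circ> inv w", unfolded o_def, rotated 2]) auto
  then show ?thesis using w(3) by simp
qed

lemma invertible_M: "invertible M"
proof -
  have "t = 0" if "M *v t = 0" for t
  proof -
    have "(\<Sum>j\<in>UNIV. t $ j *\<^sub>R w j) = 0"
      using that by (intro pair_vec_eqI) (auto simp: M_mult linear_sum[OF linear_horiz])
    then show ?thesis using sum_w_eq_0 by (simp add: vec_eq_iff)
  qed
  then show ?thesis by (simp add: invertible_left_inverse matrix_left_invertible_ker)
qed

lemma M_inverse: "M ** matrix_inv M = mat 1"
  using invertible_M unfolding invertible_def matrix_inv_def by (rule someI2_ex) blast

lemma M_u: "M *v u v = vert v - A *v horiz v"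
  by (simp add: u_def matrix_vector_mul_assoc M_inverse)

lemma linear_u: "linear u"
proof (rule linearI)
  fix x y :: "real^('d + 'e)" and r :: real
  have "vert (x + y) - A *v horiz (x + y) = (vert x - A *v horiz x) + (vert y - A *v horiz y)"
    by (simp add: matrix_vector_right_distrib)
  then show "u (x + y) = u x + u y" by (simp only: u_def matrix_vector_right_distrib)
  have "vert (r *\<^sub>R x) - A *v horiz (r *\<^sub>R x) = r *\<^sub>R (vert x - A *v horiz x)"
    by (simp add: linear_scale[OF matrix_vector_mul_linear] scaleR_diff_right)
  then show "u (r *\<^sub>R x) = r *\<^sub>R u x" by (simp only: u_def linear_scale[OF matrix_vector_mul_linear])
qed

lemmas u_simps [simp] = linear_add[OF linear_u] linear_diff[OF linear_u] linear_scale[OF linear_u] linear_0[OF linear_u] linear_neg[OF linear_u] linear_sum[OF linear_u]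

lemma decomp: "v = graph_emb A (horiz v) + (\<Sum>j\<in>UNIV. u v $ j *\<^sub>R w j)"
  by (rule pair_vec_eqI) (simp_all add: linear_sum[OF linear_horiz] M_mult[symmetric] M_u)

lemma u_graph_emb [simp]: "u (graph_emb A x) = 0"
  by (simp add: u_def)

lemma u_w [simp]: "u (w j) = axis j 1"
proof -
  have "(\<Sum>i\<in>UNIV. (u (w j) $ i - axis j 1 $ i) *\<^sub>R w i) = (\<Sum>i\<in>UNIV. u (w j) $ i *\<^sub>R w i) - (\<Sum>i\<in>UNIV. axis j 1 $ i *\<^sub>R w i)"
    by (simp add: scaleR_diff_left sum_subtractf)
  also have "(\<Sum>i\<in>UNIV. u (w j) $ i *\<^sub>R w i) = w j"
    using decomp[of "w j"] linear_0[OF linear_graph_emb, of A] by simp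
  also have "(\<Sum>i\<in>UNIV. axis j 1 $ i *\<^sub>R w i) = w j"
    by (simp add: axis_def if_distrib[of "\<lambda>x. x *\<^sub>R _"] cong: if_cong)
  finally have "(\<Sum>i\<in>UNIV. (u (w j) $ i - axis j 1 $ i) *\<^sub>R w i) = 0" by (simp only: diff_self)
  from sum_w_eq_0[OF this] show ?thesis by (simp add: vec_eq_iff)
qed

lemma u_sum_w: "u (\<Sum>j\<in>UNIV. t j *\<^sub>R w j) = (\<chi> j. t j)"
  by (simp add: vec_eq_iff axis_def if_distrib[of "\<lambda>x. _ * x"] cong: if_cong)

text \<open>Cramer's rule with Q = |det M|: Q times the inverse of M has integer entries, and
  \<open>b j\<close> is its j-th row. This is where bad approximability of integer combinations of
  the rows of A reaches the window coordinates.\<close>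

lemma u_integral_form:
  obtains Q b where "Q \<in> \<int>" "Q > 0" "\<And>j. b j \<in> intlat" "\<And>j. b j \<noteq> (0::real^'e)"
    "\<And>v j. Q * u v $ j = b j \<bullet> vert v - (b j v* A) \<bullet> horiz v"
proof -
  have MZ: "M $ i $ j \<in> \<int>" for i j
    using w(2) by (auto simp: M_def vert_def intlat_def)
  define Q where "Q = \<bar>det M\<bar>"
  define b where "b j = (\<chi> i. Q * matrix_inv M $ j $ i)" for j
  have det0: "det M \<noteq> 0" using invertible_M by (simp add: invertible_det_nz)
  have Q: "Q \<in> \<int>" "Q > 0" using det_Ints[OF MZ] det0 by (auto simp: Q_def)
  have inv: "det M * matrix_inv M $ j $ i \<in> \<int>" for i j
  proof -
    have "M *v (matrix_inv M *v axis i 1) = axis i 1"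
      by (simp add: matrix_vector_mul_assoc M_inverse)
    then have "det (\<chi> r c. if c = j then axis i 1 $ r else M $ r $ c) = (matrix_inv M *v axis i 1) $ j * det M"
      using cramer_lemma[of j M "matrix_inv M *v axis i 1"] by (simp only:)
    moreover have "(matrix_inv M *v axis i 1) $ j = matrix_inv M $ j $ i"
      by (simp add: matrix_vector_mult_basis column_def)
    moreover have "det (\<chi> r c. if c = j then axis i 1 $ r else M $ r $ c) \<in> \<int>"
      by (rule det_Ints) (auto simp: axis_def MZ)
    ultimately show ?thesis by (simp add: mult.commute)
  qed
  have "b j \<in> intlat" for j
  proof -
    have "Q * matrix_inv M $ j $ i \<in> \<int>" for i
      using inv[of j i] by (cases "det M \<ge> 0") (auto simp: Q_def)
    then show ?thesis by (simp add: intlat_def b_def)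
  qed
  moreover have form: "Q * u v $ j = b j \<bullet> vert v - (b j v* A) \<bullet> horiz v" for v j
  proof -
    have "b j \<bullet> vert v - (b j v* A) \<bullet> horiz v = b j \<bullet> (vert v - A *v horiz v)"
      by (simp add: dot_lmul_matrix inner_diff_right)
    also have "\<dots> = Q * u v $ j"
      by (simp add: u_def b_def inner_vec_def matrix_vector_mult_def sum_distrib_left mult.assoc)
    finally show ?thesis by simp
  qed
  moreover have "b j \<noteq> 0" for j
    using form[of "w j" j] Q by auto
  ultimately show ?thesis using that Q by blast
qed

text \<open>The lower bound for the form of \<open>b j\<close>, taken uniformly over the finitely
  many j; the vertical part of n only enters through the integer p. Vectors with
  \<open>horiz n = 0\<close> escape that bound, but for them Q times the coordinate is a nonzero
  integer.\<close>

lemma u_separated: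
  obtains c where "c > 0" "\<And>n j N. n \<in> intlat \<Longrightarrow> infnorm (horiz n) \<le> real N \<Longrightarrow> 1 \<le> N \<Longrightarrow> u n $ j \<noteq> 0 \<Longrightarrow> c / real N ^ CARD('d) \<le> \<bar>u n $ j\<bar>"
proof -
  obtain Q b where Q: "Q \<in> \<int>" "Q > 0" and b: "\<And>j. b j \<in> intlat" "\<And>j. b j \<noteq> (0::real^'e)"
    and form: "\<And>v j. Q * u v $ j = b j \<bullet> vert v - (b j v* A) \<bullet> horiz v"
    by (rule u_integral_form) (rule that)
  have "\<exists>c>0. \<forall>n\<in>intlat. n \<noteq> 0 \<longrightarrow> (\<forall>p\<in>\<int>. c / infnorm n ^ CARD('d) \<le> \<bar>(b j v* A) \<bullet> n - p\<bar>)" for j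
    using bad[OF b] by (simp add: bad_form_def)
  then obtain c where c: "\<And>j. c j > 0" "\<And>j n p. n \<in> intlat \<Longrightarrow> n \<noteq> 0 \<Longrightarrow> p \<in> \<int> \<Longrightarrow> c j / infnorm n ^ CARD('d) \<le> \<bar>(b j v* A) \<bullet> n - p\<bar>"
    by metis
  define c0 where "c0 = Min (insert 1 (range c))"
  have c0: "c0 > 0" unfolding c0_def using c(1) by simp
  have c0: "c0 > 0" "c0 \<le> 1" "\<And>j. c0 \<le> c j" by (fact, (unfold c0_def, intro Min_le; simp)+)
  show ?thesis
  proof (rule that[of "c0 / Q"])
    show "c0 / Q > 0" using c0 Q by simp
    fix n j N assume n: "n \<in> intlat" "infnorm (horiz n) \<le> real N" "1 \<le> (N::nat)" "u n $ j \<noteq> 0"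
    have N: "real N ^ CARD('d) \<ge> 1" using n(3) by (simp add: one_le_power)
    have int: "b j \<bullet> vert n \<in> \<int>" using b n by (intro intlat_inner intlat_vert)
    have "c0 / real N ^ CARD('d) \<le> \<bar>Q * u n $ j\<bar>"
    proof (cases "horiz n = 0")
      case True
      then have "Q * u n $ j \<in> \<int>" using int form by simp
      then have "1 \<le> \<bar>Q * u n $ j\<bar>" using n(4) Q by (intro Ints_nonzero_abs_ge1) auto
      moreover have "c0 / real N ^ CARD('d) \<le> 1" using N c0 by (simp add: divide_le_eq)
      ultimately show ?thesis by linarith
    next
      case False
      then have h: "1 \<le> infnorm (horiz n)" by (intro infnorm_intlat_ge_1 intlat_horiz n)
      have "c0 / real N ^ CARD('d) \<le> c j / infnorm (horiz n) ^ CARD('d)"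
        using c0(3)[of j] c(1)[of j] n(2) h by (intro frac_le power_mono) (auto intro: zero_less_power)
      also have "\<dots> \<le> \<bar>(b j v* A) \<bullet> horiz n - b j \<bullet> vert n\<bar>"
        using False int n by (intro c(2) intlat_horiz)
      also have "\<dots> = \<bar>Q * u n $ j\<bar>" unfolding form by (rule abs_minus_commute)
      finally show ?thesis .
    qed
    also have "\<dots> = Q * \<bar>u n $ j\<bar>" using Q by (simp add: abs_mult)
    finally show "c0 / Q / real N ^ CARD('d) \<le> \<bar>u n $ j\<bar>" 
    proof -
      assume "c0 / real N ^ CARD('d) \<le> Q * \<bar>u n $ j\<bar>"
      then have "c0 / real N ^ CARD('d) / Q \<le> \<bar>u n $ j\<bar>" using Q by (simp only: pos_divide_le_eq mult.commute)
      then show ?thesis by (simp only: divide_divide_eq_left mult.commute)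
    qed
  qed
qed

text \<open>Adding a multiple of \<open>w j\<close> changes the j-th coordinate of u by an integer
  and leaves the horizontal part alone. Such shifts provide the integer p for the form with
  coefficients \<open>b j v* A\<close> divided by Q.\<close>

lemma u_coord_dense:
  obtains C where "C \<ge> 1" "\<And>(N::nat) y j. \<exists>n\<in>intlat. infnorm (horiz n) \<le> N \<and> 0 \<le> y - u n $ j \<and> y - u n $ j < C / real (N + 1) ^ CARD('d)"
proof -
  obtain Q b where Q: "Q \<in> \<int>" "Q > 0" and b: "\<And>j. b j \<in> intlat" "\<And>j. b j \<noteq> (0::real^'e)"
    and form: "\<And>v j. Q * u v $ j = b j \<bullet> vert v - (b j v* A) \<bullet> horiz v"
    by (rule u_integral_form) (rule that)
  let ?x = "\<lambda>j. (1 / Q) *\<^sub>R (b j v* A)"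
  have "bad_form (?x j)" for j by (rule bad_form_scaleR_inverse[OF bad[OF b] Q])
  then have "\<forall>j. \<exists>C\<ge>1. \<forall>(N::nat) y. \<exists>n\<in>intlat. \<exists>p\<in>\<int>. infnorm n \<le> N \<and> 0 \<le> y - (?x j \<bullet> n - p) \<and> y - (?x j \<bullet> n - p) < C / real (N + 1) ^ CARD('d)"
    using bad_form_dense by blast
  then obtain C where C: "\<And>j. C j \<ge> 1" "\<And>j (N::nat) y. \<exists>n\<in>intlat. \<exists>p\<in>\<int>. infnorm n \<le> N \<and> 0 \<le> y - (?x j \<bullet> n - p) \<and> y - (?x j \<bullet> n - p) < C j / real (N + 1) ^ CARD('d)"
    by metis
  define C0 where "C0 = Max (insert 1 (range C))"
  have C0: "C0 \<ge> 1" "\<And>j. C j \<le> C0" unfolding C0_def by (intro Max_ge; simp)+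
  show ?thesis
  proof (rule that[OF C0(1)])
    fix N :: nat and y j
    obtain n q where n: "n \<in> intlat" "q \<in> \<int>" "infnorm n \<le> N" "0 \<le> y - (?x j \<bullet> n - q)" "y - (?x j \<bullet> n - q) < C j / real (N + 1) ^ CARD('d)"
      using C(2) by blast
    define n' where "n' = pair_vec (- n) 0 - q *\<^sub>R w j"
    have "Q * u (pair_vec (- n) 0) $ j = (b j v* A) \<bullet> n" unfolding form by simp
    then have "u (pair_vec (- n) 0) $ j = ?x j \<bullet> n" using Q by (simp add: field_simps)
    then have "u n' $ j = ?x j \<bullet> n - q" by (simp add: n'_def)
    moreover have "n' \<in> intlat" unfolding n'_def
      by (intro intlat_diff intlat_pair_vec intlat_uminus intlat_scaleR n w(2) intlat_0)
    moreover have "infnorm (horiz n') \<le> N" using n(3) by (simp add: n'_def infnorm_neg)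
    moreover have "C j / real (N + 1) ^ CARD('d) \<le> C0 / real (N + 1) ^ CARD('d)"
      by (intro divide_right_mono C0(2)) simp
    ultimately show "\<exists>n\<in>intlat. infnorm (horiz n) \<le> N \<and> 0 \<le> y - u n $ j \<and> y - u n $ j < C0 / real (N + 1) ^ CARD('d)"
      using n by (intro bexI[of _ n']) auto
  qed
qed

text \<open>u is linear, kills E and is onto, so density of E + Z^k in R^k passes to the values of u
  on Z^k.\<close>

lemma u_dense:
  assumes "\<epsilon> > 0"
  obtains z where "z \<in> intlat" "\<And>j. \<bar>u z $ j - v $ j\<bar> < \<epsilon>"
proof -
  obtain B where B: "B > 0" "\<And>x. norm (u x) \<le> B * norm x"
    using linear_bounded_pos[OF linear_u] by blast
  define V where "V = (\<Sum>j\<in>UNIV. v $ j *\<^sub>R w j)"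
  have uV: "u V = v" unfolding V_def u_sum_w by (simp add: vec_eq_iff)
  have "V \<in> closure {e + z |e z. e \<in> graphE A \<and> z \<in> intlat}"
    using irrational by (simp add: totally_irrational_def)
  then obtain y where y: "y \<in> {e + z |e z. e \<in> graphE A \<and> z \<in> intlat}" "dist y V < \<epsilon> / B"
    using assms B by (meson closure_approachable divide_pos_pos)
  then obtain e z where ez: "y = e + z" "e \<in> graphE A" "z \<in> intlat" by blast
  have "u e = 0" using ez(2) by (auto simp: graphE_def)
  then have uz: "u z - v = u (y - V)" by (simp add: ez uV)
  show ?thesis
  proof (rule that[OF ez(3)])
    fix j
    have "\<bar>u z $ j - v $ j\<bar> \<le> norm (u z - v)" using component_le_norm_cart[of "u z - v" j] by simp
    also have "\<dots> \<le> B * norm (y - V)" unfolding uz by (rule B)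
    also have "\<dots> < \<epsilon>" using y(2) B by (simp add: dist_norm field_simps)
    finally show "\<bar>u z $ j - v $ j\<bar> < \<epsilon>" .
  qed
qed

section \<open>The strip, reduction to the unit cube and the lifted point set\<close>

lemma strip_iff: "v \<in> strip A W \<longleftrightarrow> (\<forall>j. 0 \<le> u v $ j \<and> u v $ j \<le> 1)"
proof -
  have "proj_along Fsp (graphE A) v = (\<Sum>j\<in>UNIV. u v $ j *\<^sub>R w j)"
  proof (rule proj_along_eqI[OF subspace_Fsp subspace_graphE])
    show "Fsp \<inter> graphE A = {0}" using graphE_Int_Fsp[of A] by blast
    show "(\<Sum>j\<in>UNIV. u v $ j *\<^sub>R w j) \<in> Fsp" using w(1) by (intro subspace_sum[OF subspace_Fsp] subspace_scale[OF subspace_Fsp])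
    have "v - (\<Sum>j\<in>UNIV. u v $ j *\<^sub>R w j) = graph_emb A (horiz v)" using decomp[of v] by (simp add: algebra_simps)
    then show "v - (\<Sum>j\<in>UNIV. u v $ j *\<^sub>R w j) \<in> graphE A" by (simp add: graphE_def)
  qed
  then have "v \<in> strip A W \<longleftrightarrow> (\<exists>t. (\<Sum>j\<in>UNIV. u v $ j *\<^sub>R w j) = (\<Sum>j\<in>UNIV. t j *\<^sub>R w j) \<and> (\<forall>j. 0 \<le> t j \<and> t j \<le> 1))"
    by (simp add: strip_def W)
  also have "\<dots> \<longleftrightarrow> (\<forall>j. 0 \<le> u v $ j \<and> u v $ j \<le> 1)"
  proof
    assume "\<exists>t. (\<Sum>j\<in>UNIV. u v $ j *\<^sub>R w j) = (\<Sum>j\<in>UNIV. t j *\<^sub>R w j) \<and> (\<forall>j. 0 \<le> t j \<and> t j \<le> 1)"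
    then obtain t where t: "(\<Sum>j\<in>UNIV. u v $ j *\<^sub>R w j) = (\<Sum>j\<in>UNIV. t j *\<^sub>R w j)" "\<forall>j. 0 \<le> t j \<and> t j \<le> 1" by blast
    have "u v $ j = t j" for j
      using arg_cong[OF t(1), of "\<lambda>x. u x $ j"] unfolding u_sum_w by simp
    then show "\<forall>j. 0 \<le> u v $ j \<and> u v $ j \<le> 1" using t(2) by simp
  next
    assume "\<forall>j. 0 \<le> u v $ j \<and> u v $ j \<le> 1"
    then show "\<exists>t. (\<Sum>j\<in>UNIV. u v $ j *\<^sub>R w j) = (\<Sum>j\<in>UNIV. t j *\<^sub>R w j) \<and> (\<forall>j. 0 \<le> t j \<and> t j \<le> 1)"
      by (intro exI[of _ "\<lambda>j. u v $ j"] conjI refl)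
  qed
  finally show ?thesis .
qed

text \<open>Reduction to a fundamental cell of the lattice spanned by w. Since w is integral it
  stays in the shifted integer lattice, and it moves points only along F.\<close>

definition red :: "real^('d + 'e) \<Rightarrow> real^('d + 'e)" where
  "red t = t - (\<Sum>j\<in>UNIV. of_int \<lfloor>u t $ j\<rfloor> *\<^sub>R w j)"

lemma u_red [simp]: "u (red t) $ j = frac (u t $ j)"
  unfolding red_def linear_diff[OF linear_u] u_sum_w by (simp add: frac_def)

lemma horiz_red [simp]: "horiz (red t) = horiz t"
  by (simp add: red_def linear_sum[OF linear_horiz])

lemma red_lat_shift: "t \<in> lat_shift s' \<Longrightarrow> red t \<in> lat_shift s'"
proof -
  assume t: "t \<in> lat_shift s'"
  have "- (\<Sum>j\<in>UNIV. of_int \<lfloor>u t $ j\<rfloor> *\<^sub>R w j) \<in> intlat"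
    by (intro intlat_uminus intlat_sum intlat_scaleR w(2)) simp
  from lat_shift_add[OF t this] show ?thesis by (simp add: red_def)
qed

text \<open>Were the coordinate an integer, the reduced point would lie in the strip with j-th
  coordinate 0, and arbitrarily short steps against \<open>w j\<close> would leave the strip. A
  lattice point would thus lie on the boundary, contrary to regularity.\<close>

lemma u_not_int: 
  assumes t: "t \<in> lat_shift s" shows "u t $ j \<notin> \<int>"
proof
  assume j: "u t $ j \<in> \<int>"
  let ?r = "red t"
  have r: "u ?r $ j = 0" using j unfolding u_red by simp
  have "?r \<in> strip A W" unfolding strip_iff using frac_lt_1 less_imp_le by fastforce
  then have 1: "?r \<in> closure (strip A W)" using closure_subset by blast
  have "?r \<notin> interior (strip A W)"
  proof
    assume "?r \<in> interior (strip A W)"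
    then obtain e where e: "e > 0" "ball ?r e \<subseteq> strip A W" by (auto simp: mem_interior)
    define \<delta> where "\<delta> = e / (2 * (norm (w j) + 1))"
    have \<delta>: "\<delta> > 0" using e(1) by (auto simp: \<delta>_def intro!: divide_pos_pos add_nonneg_pos)
    have "\<delta> * norm (w j) < e"
    proof -
      have "\<delta> * norm (w j) \<le> \<delta> * (norm (w j) + 1)" using \<delta> by simp
      also have "\<dots> = e / 2"
      proof -
        have "norm (w j) + 1 \<noteq> 0" using norm_ge_zero[of "w j"] by linarith
        then show ?thesis by (simp add: \<delta>_def field_simps)
      qed
      finally show ?thesis using e(1) by linarith
    qed
    then have "?r - \<delta> *\<^sub>R w j \<in> ball ?r e" using \<delta> by (simp add: dist_norm)
    then have "0 \<le> u (?r - \<delta> *\<^sub>R w j) $ j" using e(2) strip_iff by blast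
    then show False using r \<delta> by (simp del: u_red)
  qed
  with 1 have "?r \<in> frontier (strip A W)" by (simp add: frontier_def)
  then show False using s red_lat_shift[OF t] by (auto simp: regular_pt_def)
qed

text \<open>The lifts of the points of Y. Regularity allows the closed conditions of the strip to be
  written as strict ones.\<close>

definition T :: "(real^('d + 'e)) set" where
  "T = {t \<in> lat_shift s. \<forall>j. 0 < u t $ j \<and> u t $ j < 1}"

lemma T_eq: "T = strip A W \<inter> lat_shift s"
proof -
  have "0 < u t $ j \<and> u t $ j < 1 \<longleftrightarrow> 0 \<le> u t $ j \<and> u t $ j \<le> 1" if "t \<in> lat_shift s" for t j
  proof -
    have "u t $ j \<noteq> 0" "u t $ j \<noteq> 1" using u_not_int[OF that, of j] by auto
    then show ?thesis by linarith
  qed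
  note * = this
  show ?thesis
  proof (intro set_eqI iffI)
    fix t assume "t \<in> T"
    then show "t \<in> strip A W \<inter> lat_shift s" unfolding T_def Int_iff strip_iff using * by blast
  next
    fix t assume "t \<in> strip A W \<inter> lat_shift s"
    then show "t \<in> T" unfolding T_def Int_iff strip_iff using * by blast
  qed
qed

lemma T_bounds:
  assumes "t \<in> T"
  shows "0 < u t $ j" "u t $ j < 1" "\<bar>u t $ j\<bar> \<le> 1"
proof -
  show 1: "0 < u t $ j" "u t $ j < 1" using assms by (auto simp: T_def)
  show "\<bar>u t $ j\<bar> \<le> 1" using 1 by linarith
qed

lemma red_T: "t \<in> lat_shift s \<Longrightarrow> red t \<in> T"
  using u_not_int by (simp add: T_def red_lat_shift frac_lt_1 frac_gt_0_iff)

lemma eq_if_u_diff_int: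
  assumes "t \<in> T" "t' \<in> T" "t - t' = (\<Sum>j\<in>UNIV. of_int (m j) *\<^sub>R w j)"
  shows "t = t'"
proof -
  have "m j = 0" for j
  proof -
    have "u t $ j - u t' $ j = of_int (m j)" using arg_cong[OF assms(3), of "\<lambda>x. u x $ j"] unfolding u_sum_w by simp
    moreover have "\<bar>u t $ j - u t' $ j\<bar> < 1"
      using T_bounds(1,2)[OF assms(1), of j] T_bounds(1,2)[OF assms(2), of j] by linarith
    ultimately show ?thesis by linarith
  qed
  then show ?thesis using assms(3) by simp
qed

text \<open>Equal reductions make t - t' an integer combination of w, and two points of the open
  unit cube can differ by such a combination only if it is 0. For z in the integer lattice this
  gives injections of T into itself.\<close>

lemma red_add_inj:
  assumes "t \<in> T" "t' \<in> T" "red (t + z) = red (t' + z)"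
  shows "t = t'"
proof (rule eq_if_u_diff_int[OF assms(1,2)])
  show "t - t' = (\<Sum>j\<in>UNIV. of_int (\<lfloor>u (t + z) $ j\<rfloor> - \<lfloor>u (t' + z) $ j\<rfloor>) *\<^sub>R w j)"
  proof -
    have eq: "t - t' = a - b" if "t + z - a = t' + z - b" for a b :: "real^('d + 'e)"
    proof -
      have "t - t' = ((t + z - a) - (t' + z - b)) + (a - b)" by simp
      then show ?thesis unfolding that by simp
    qed
    show ?thesis
      unfolding of_int_diff scaleR_diff_left sum_subtractf using assms(3) unfolding red_def by (rule eq)
  qed
qed

lemma p_inj_on: "inj_on p (lat_shift s)"
proof (rule inj_onI)
  fix t t' assume t: "t \<in> lat_shift s" "t' \<in> lat_shift s" "p t = p t'"
  have "t - t' = 0" using t(3) by (intro p_inj_on_intlat[OF lat_shift_diff[OF t(1,2)]]) simp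
  then show "t = t'" by simp
qed

lemma T_lat: "T \<subseteq> lat_shift s" by (auto simp: T_def)

lemma cps_eq: "cps A F0 W s = p ` T"
  unfolding cps_def T_eq p_def ..

lemma lift_p:
  assumes t: "t \<in> T"
  shows "lift A F0 W s (p t) = t"
  unfolding lift_def p_def[symmetric] T_eq[symmetric]
proof (rule the_equality)
  show "t \<in> T \<and> p t = p t" using t by simp
  fix t' assume t': "t' \<in> T \<and> p t' = p t"
  show "t' = t" by (rule inj_onD[OF p_inj_on]) (use t t' T_lat in auto)
qed

text \<open>v and \<open>graph_emb A (horiz v)\<close>, its projection along F, differ by the
  combination of the edges with coefficients \<open>u v\<close>. So the two projections of the two
  patch types agree up to a bounded error on differences of lifted points.\<close>

lemma p_approx:
  obtains K where "K \<ge> 0" "\<And>v. (\<forall>j. \<bar>u v $ j\<bar> \<le> 1) \<Longrightarrow> infnorm (p v - graph_emb A (horiz v)) \<le> K"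
proof (rule that[of "\<Sum>j\<in>UNIV. infnorm (p (w j))"])
  show "0 \<le> (\<Sum>j\<in>UNIV. infnorm (p (w j)))" by (intro sum_nonneg infnorm_pos_le)
  fix v assume v: "\<forall>j. \<bar>u v $ j\<bar> \<le> 1"
  have "p v = p (graph_emb A (horiz v) + (\<Sum>j\<in>UNIV. u v $ j *\<^sub>R w j))"
    by (rule arg_cong[OF decomp])
  also have "\<dots> = graph_emb A (horiz v) + (\<Sum>j\<in>UNIV. u v $ j *\<^sub>R p (w j))" by simp
  finally have "p v = graph_emb A (horiz v) + (\<Sum>j\<in>UNIV. u v $ j *\<^sub>R p (w j))" .
  then have "p v - graph_emb A (horiz v) = (\<Sum>j\<in>UNIV. u v $ j *\<^sub>R p (w j))" by simp
  also have "infnorm \<dots> \<le> (\<Sum>j\<in>UNIV. infnorm (p (w j)))"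
    using infnorm_sum_scaleR_le[of UNIV "\<lambda>j. u v $ j" 1 "\<lambda>j. p (w j)"] v by simp
  finally show "infnorm (p v - graph_emb A (horiz v)) \<le> (\<Sum>j\<in>UNIV. infnorm (p (w j)))" .
qed

lemma finite_T_bounded: "finite {t \<in> T. infnorm (p t) \<le> R}"
proof -
  obtain K where K: "K \<ge> 0" "\<And>v. (\<forall>j. \<bar>u v $ j\<bar> \<le> 1) \<Longrightarrow> infnorm (p v - graph_emb A (horiz v)) \<le> K"
    by (rule p_approx) (rule that)
  have "infnorm t \<le> R + K + (\<Sum>j\<in>UNIV. infnorm (w j))" if t: "t \<in> T" "infnorm (p t) \<le> R" for t
  proof -
    let ?e = "p t - graph_emb A (horiz t)" and ?f = "\<Sum>j\<in>UNIV. u t $ j *\<^sub>R w j"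
    have "infnorm (p t - ?e) \<le> R + K"
      using infnorm_diff_le[of "p t" ?e] K(2)[of t] T_bounds(3)[OF t(1)] t(2) by simp
    moreover have "infnorm ?f \<le> (\<Sum>j\<in>UNIV. infnorm (w j))"
      using infnorm_sum_scaleR_le[of UNIV "\<lambda>j. u t $ j" 1 w] T_bounds(3)[OF t(1)] by simp
    moreover have "infnorm t \<le> infnorm (p t - ?e) + infnorm ?f"
    proof -
      have "(p t - ?e) + ?f = graph_emb A (horiz t) + ?f" by simp
      also have "\<dots> = t" by (rule decomp[symmetric])
      finally show ?thesis using infnorm_triangle[of "p t - ?e" ?f] by metis
    qed
    ultimately show ?thesis by linarith
  qed
  then have "{t \<in> T. infnorm (p t) \<le> R} \<subseteq> {t \<in> lat_shift s. infnorm t \<le> R + K + (\<Sum>j\<in>UNIV. infnorm (w j))}"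
    using T_lat by blast
  then show ?thesis by (rule finite_subset[OF _ finite_lat_shift_bounded])
qed

end

text \<open>Kronecker's theorem for one column of A. Its entries together with 1 are independent
  over the integers, since a relation with coefficients b would make the form of bA an integer at a
  unit vector. Multiples of that unit vector alone then yield density.\<close>

lemma totally_irrational_graphE:
  fixes A :: "real^'d^'e"
  assumes bad: "\<And>b. b \<in> intlat \<Longrightarrow> b \<noteq> 0 \<Longrightarrow> bad_form (b v* A)"
  shows "totally_irrational (graphE A)"
proof -
  obtain a :: 'd where "a \<in> UNIV" by blast
  define n where "n = CARD('e)"
  obtain h where h: "bij_betw h {..<n} (UNIV :: 'e set)"
    using ex_bij_betw_nat_finite[of "UNIV :: 'e set"] by (auto simp: n_def atLeast0LessThan)
  define \<theta> where "\<theta> i = (if i < n then A $ h i $ a else 1)" for i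
  have key: "c i = 0" if c: "(\<Sum>i\<le>n. of_int (c i) * \<theta> i) = 0" and i: "i \<le> n" for c :: "nat \<Rightarrow> int" and i
  proof -
    define b where "b = (\<chi> r. real_of_int (c (the_inv_into {..<n} h r)))"
    have bint: "b \<in> intlat" by (auto simp: b_def intlat_def)
    have bh: "b $ h i = of_int (c i)" if "i < n" for i
      using the_inv_into_f_f[of h "{..<n}" i] h that by (simp add: b_def bij_betw_def)
    have "{..n} = insert n {..<n}" by auto
    then have "(\<Sum>i<n. of_int (c i) * \<theta> i) = - of_int (c n)" using c by (simp add: \<theta>_def)
    moreover have "(\<Sum>i<n. of_int (c i) * \<theta> i) = (\<Sum>i<n. b $ h i * A $ h i $ a)"
      by (intro sum.cong refl) (simp add: bh \<theta>_def)
    moreover have "\<dots> = (\<Sum>r\<in>UNIV. b $ r * A $ r $ a)"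
      by (rule sum.reindex_bij_betw[OF h])
    ultimately have comp: "(b v* A) $ a = - of_int (c n)" by (simp add: vector_matrix_mult_def)
    have b0: "b = 0"
    proof (rule ccontr)
      assume "b \<noteq> 0"
      then obtain c0 where c0: "c0 > 0" "\<And>m p. m \<in> intlat \<Longrightarrow> m \<noteq> 0 \<Longrightarrow> p \<in> \<int> \<Longrightarrow> c0 / infnorm m ^ CARD('d) \<le> \<bar>(b v* A) \<bullet> m - p\<bar>"
        using bad[OF bint] by (auto simp: bad_form_def)
      have "axis a 1 \<in> intlat" by (auto simp: axis_def intlat_def)
      moreover have "axis a (1::real) \<noteq> 0" by (simp add: axis_eq_0_iff)
      ultimately have m: "c0 / infnorm (axis a (1::real)) ^ CARD('d) \<le> 0"
        using c0(2)[of "axis a 1" "- of_int (c n)"] comp by (simp add: inner_axis)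
      have "infnorm (axis a (1::real)) > 0" using \<open>axis a (1::real) \<noteq> 0\<close> by (simp add: infnorm_pos_lt)
      then have "c0 / infnorm (axis a (1::real)) ^ CARD('d) > 0" using c0(1) by simp
      then show False using m by linarith
    qed
    show ?thesis
    proof (cases "i < n")
      case True then show ?thesis using bh[OF True] b0 by simp
    next
      case False then show ?thesis using comp b0 i by (simp add: vector_matrix_mult_def)
    qed
  qed
  have inj: "inj_on \<theta> {..n}"
  proof (rule inj_onI, rule ccontr)
    fix i j assume ij: "i \<in> {..n}" "j \<in> {..n}" "\<theta> i = \<theta> j" "i \<noteq> j"
    let ?c = "\<lambda>l. if l = i then 1 else if l = j then -1 else (0::int)"
    have "(\<Sum>l\<le>n. of_int (?c l) * \<theta> l) = (\<Sum>l\<le>n. (if l = i then \<theta> l else 0) - (if l = j then \<theta> l else 0))"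
      using ij(4) by (intro sum.cong) auto
    also have "\<dots> = 0" using ij by (simp add: sum_subtractf)
    finally show False using key[of ?c i] ij by simp
  qed
  interpret Z: Modules.module "\<lambda>r x. real_of_int r * x"
    by (simp add: Modules.module.intro distrib_left distrib_right)
  have indep: "Z.independent (\<theta> ` {..n})"
  proof
    assume "Z.dependent (\<theta> ` {..n})"
    then obtain t v where t: "finite t" "t \<subseteq> \<theta> ` {..n}" "(\<Sum>x\<in>t. of_int (v x) * x) = 0" "\<exists>x\<in>t. v x \<noteq> (0::int)"
      unfolding Z.dependent_explicit by blast
    define c where "c i = (if \<theta> i \<in> t then v (\<theta> i) else 0)" for i
    have "(\<Sum>i\<le>n. of_int (c i) * \<theta> i) = (\<Sum>x\<in>\<theta> ` {..n}. of_int (if x \<in> t then v x else 0) * x)"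
      by (subst sum.reindex[OF inj]) (simp add: c_def)
    also have "\<dots> = (\<Sum>x\<in>t. of_int (v x) * x)"
      using t(2) by (intro sum.mono_neutral_cong_right) auto
    finally have c0: "c i = 0" if "i \<le> n" for i using key that t(3) by simp
    obtain x where x: "x \<in> t" "v x \<noteq> 0" using t(4) by blast
    then obtain i where "i \<le> n" "x = \<theta> i" using t(2) by auto
    then show False using c0[of i] x by (simp add: c_def)
  qed
  have "V \<in> closure {e + z |e z. e \<in> graphE A \<and> z \<in> intlat}" for V
  proof (subst closure_approachable, intro allI impI)
    fix \<epsilon> :: real assume \<epsilon>: "\<epsilon> > 0"
    define S where "S = sqrt (real DIM(real^('d + 'e)))"
    have S: "S > 0" by (simp only: S_def real_sqrt_gt_0_iff of_nat_0_less_iff DIM_positive)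
    define \<epsilon>' where "\<epsilon>' = \<epsilon> / (2 * S)"
    have \<epsilon>': "\<epsilon>' > 0" using \<epsilon> S by (simp add: \<epsilon>'_def)
    define y where "y = vert V - A *v horiz V"
    obtain k m where km: "\<And>i. i < n \<Longrightarrow> \<bar>of_int k * \<theta> i - of_int (m i) - y $ h i\<bar> < \<epsilon>'"
      using Kronecker_thm_2[OF indep inj _ \<epsilon>', of "\<lambda>i. y $ h i"] by (auto simp: \<theta>_def)
    define mm where "mm = (\<chi> r. real_of_int (m (the_inv_into {..<n} h r)))"
    define x where "x = (of_int k :: real) *\<^sub>R axis a (1::real)"
    define e where "e = graph_emb A (horiz V + x)"
    \<comment> \<open>The horizontal parts of e + z and V agree exactly, so the only error is the
      vertical one controlled by Kronecker's theorem.\<close>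
    define z where "z = pair_vec (- x) (- mm)"
    have z: "z \<in> intlat" unfolding z_def
      by (intro intlat_pair_vec intlat_uminus) (auto simp: x_def mm_def intlat_def axis_def)
    have e: "e \<in> graphE A" by (simp add: e_def graphE_def)
    have Ax: "(A *v x) $ r = of_int k * A $ r $ a" for r
      by (simp add: x_def matrix_vector_mult_def axis_def if_distrib[of "\<lambda>t. _ * t"] mult.commute cong: if_cong)
    have "infnorm (e + z - V) \<le> \<epsilon>'"
      unfolding infnorm_cart_le_iff
    proof
      fix l :: "'d + 'e"
      show "\<bar>(e + z - V) $ l\<bar> \<le> \<epsilon>'"
      proof (cases l)
        case (Inl i)
        have "horiz (e + z - V) = 0" by (simp add: e_def z_def)
        then have "(e + z - V) $ l = 0" unfolding Inl horiz_def by (metis vec_lambda_beta zero_index)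
        then show ?thesis using \<epsilon>' by simp
      next
        case (Inr r)
        obtain i where i: "i < n" "h i = r" using h unfolding bij_betw_def by (metis UNIV_I imageE lessThan_iff)
        have mr: "mm $ r = of_int (m i)" using the_inv_into_f_f[of h "{..<n}" i] h i by (simp add: mm_def bij_betw_def)
        have "vert (e + z - V) $ r = (A *v x) $ r - mm $ r - y $ r"
          by (simp add: e_def z_def y_def matrix_vector_right_distrib)
        also have "\<dots> = of_int k * \<theta> i - of_int (m i) - y $ h i" using i by (simp add: Ax mr \<theta>_def)
        finally have "\<bar>vert (e + z - V) $ r\<bar> < \<epsilon>'" using km[OF i(1)] by simp
        then show ?thesis unfolding Inr vert_def by simp
      qed
    qed
    then have "S * infnorm (e + z - V) \<le> S * \<epsilon>'" using S by (intro mult_left_mono) auto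
    moreover have "norm (e + z - V) \<le> S * infnorm (e + z - V)" unfolding S_def by (rule norm_le_infnorm)
    moreover have "S * \<epsilon>' = \<epsilon> / 2" using S by (simp add: \<epsilon>'_def)
    ultimately have "dist (e + z) V < \<epsilon>" using \<epsilon> by (simp add: dist_norm)
    then show "\<exists>y\<in>{e + z |e z. e \<in> graphE A \<and> z \<in> intlat}. dist y V < \<epsilon>" using e z by blast
  qed
  then show ?thesis unfolding totally_irrational_def by blast
qed

section \<open>Equidistribution in boxes\<close>

text \<open>Attach to each counted lattice point a half-open unit cube. The cubes are disjoint, and
  their union contains the N-ball of radius R - k and lies in that of radius R + k, because N is at
  most k on sup-norm unit vectors. V is the volume of the unit ball of N.\<close>

lemma lattice_points_dilate_bounds:
  fixes N :: "real^'d \<Rightarrow> real" and x0 :: "real^'d"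
  assumes tri: "\<And>x y. N (x + y) \<le> N x + N y" and hom: "\<And>r x. N (r *\<^sub>R x) = \<bar>r\<bar> * N x"
    and low: "\<And>x. infnorm x \<le> N x" and up: "\<And>x. infnorm x \<le> 1 \<Longrightarrow> N x \<le> k" and cont: "continuous_on UNIV N"
  shows "\<exists>V>0. \<forall>R\<ge>k. V * (R - k) ^ CARD('d) \<le> real (card {x \<in> lat_shift x0. N x \<le> R}) \<and>
           real (card {x \<in> lat_shift x0. N x \<le> R}) \<le> V * (R + k) ^ CARD('d)"
proof -
  define B where "B R = {x. N x \<le> R}" for R
  define V where "V = measure lebesgue (B 1)"
  have k0: "k \<ge> 0" using up[of 0] low[of 0] by (simp add: infnorm_0)
  have closed_B: "closed (B R)" for R
    unfolding B_def by (intro closed_Collect_le cont continuous_on_const)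
  have bounded_B: "bounded (B R)" for R
  proof (rule boundedI)
    fix x assume "x \<in> B R"
    then have "infnorm x \<le> R" using low[of x] by (simp add: B_def)
    then show "norm x \<le> sqrt (real DIM(real^'d)) * R"
      using norm_le_infnorm[of x] by (meson mult_left_mono order_trans real_sqrt_ge_zero of_nat_0_le_iff)
  qed
  have meas_B: "B R \<in> lmeasurable" for R
    using closed_B bounded_B by (intro lmeasurable_compact) (simp add: compact_eq_bounded_closed)
  have scale: "measure lebesgue (B R) = V * R ^ CARD('d)" if "R \<ge> 0" for R
  proof (cases "R = 0")
    case True
    have "B 0 = {0}"
    proof
      show "B 0 \<subseteq> {0}"
      proof
        fix x assume "x \<in> B 0"
        then have "infnorm x \<le> 0" using low[of x] by (simp add: B_def)
        then have "infnorm x = 0" using infnorm_pos_le[of x] by linarith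
        then show "x \<in> {0}" by (simp add: infnorm_eq_0)
      qed
      show "{0} \<subseteq> B 0" using hom[of 0 0] by (simp add: B_def)
    qed
    then show ?thesis using True by simp
  next
    case False
    have "B R = (\<lambda>x. R *\<^sub>R x + 0) ` B 1"
    proof
      show "B R \<subseteq> (\<lambda>x. R *\<^sub>R x + 0) ` B 1"
      proof
        fix x assume "x \<in> B R"
        then have "N ((1 / R) *\<^sub>R x) \<le> 1" using that False by (simp only: hom) (simp add: B_def field_simps)
        then show "x \<in> (\<lambda>x. R *\<^sub>R x + 0) ` B 1"
          using False by (intro image_eqI[of _ _ "(1 / R) *\<^sub>R x"]) (simp_all add: B_def)
      qed
      show "(\<lambda>x. R *\<^sub>R x + 0) ` B 1 \<subseteq> B R"
      proof
        fix y assume "y \<in> (\<lambda>x. R *\<^sub>R x + 0) ` B 1"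
        then obtain x where x: "N x \<le> 1" "y = R *\<^sub>R x" by (auto simp: B_def)
        have "R * N x \<le> R * 1" using x(1) that by (rule mult_left_mono)
        then show "y \<in> B R" using x(2) that by (simp add: B_def hom)
      qed
    qed
    then show ?thesis using measure_lebesgue_affine[of R 0 "B 1"] that by (simp add: V_def mult.commute)
  qed
  have V: "V > 0"
  proof -
    define r where "r = 1 / (k + 1)"
    have r: "r > 0" using k0 by (simp add: r_def)
    have "ball 0 r \<subseteq> B 1"
    proof
      fix x :: "real^'d" assume "x \<in> ball 0 r"
      then have "infnorm x \<le> r" using infnorm_le_norm[of x] by simp
      then have "infnorm ((1 / r) *\<^sub>R x) \<le> 1" using r by (simp add: infnorm_mul field_simps)
      then have "N ((1 / r) *\<^sub>R x) \<le> k" by (rule up)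
      then have "N x \<le> k * r" unfolding hom using r by (simp add: field_simps)
      also have "\<dots> \<le> 1" using k0 by (simp add: r_def)
      finally show "x \<in> B 1" by (simp add: B_def)
    qed
    then have "measure lebesgue (ball (0::real^'d) r) \<le> V"
      unfolding V_def by (intro measure_mono_fmeasurable meas_B) auto
    moreover have "measure lebesgue (ball (0::real^'d) r) > 0"
      using content_ball_pos[OF r, of "0::real^'d"] by (simp add: measure_completion)
    ultimately show ?thesis by linarith
  qed
  define X where "X R = {x \<in> lat_shift x0. N x \<le> R}" for R
  define Q where "Q x = {y. \<forall>i. x $ i \<le> y $ i \<and> y $ i < x $ i + 1}" for x :: "real^'d"
  have finX: "finite (X R)" for R
    by (rule finite_subset[OF _ finite_lat_shift_bounded[of x0 R]])
      (use low in \<open>auto simp: X_def intro: order_trans\<close>)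
  have Q_meas: "Q x \<in> lmeasurable" "measure lebesgue (Q x) = 1" for x
  proof -
    have b: "box x (x + 1) \<subseteq> Q x" "Q x \<subseteq> cbox x (x + 1)"
      by (simp_all add: Q_def subset_iff mem_box_cart less_imp_le)
    have "negligible (cbox x (x + 1) - Q x \<union> (Q x - cbox x (x + 1)))"
      by (rule negligible_subset[OF negligible_frontier_interval[of x "x + 1"]]) (use b in blast)
    then have "Q x \<in> lmeasurable \<and> measure lebesgue (Q x) = measure lebesgue (cbox x (x + 1))"
      using lmeasurable_negligible_symdiff[OF lmeasurable_cbox] measure_negligible_symdiff[OF lmeasurable_cbox] by blast
    moreover have "measure lebesgue (cbox x (x + 1)) = 1"
    proof -
      have "cbox x (x + 1) \<noteq> {}" by (simp add: interval_ne_empty_cart)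
      then show ?thesis by (simp add: content_cbox_cart measure_completion)
    qed
    ultimately show "Q x \<in> lmeasurable" "measure lebesgue (Q x) = 1" by simp_all
  qed
  have disj: "Q x \<inter> Q y = {}" if "x \<in> lat_shift x0" "y \<in> lat_shift x0" "x \<noteq> y" for x y
  proof (rule ccontr)
    assume "Q x \<inter> Q y \<noteq> {}"
    then obtain z where z: "z \<in> Q x" "z \<in> Q y" by blast
    have "x - y \<in> intlat" using that by (intro lat_shift_diff)
    moreover have "x - y \<noteq> 0" using that by simp
    ultimately obtain i where i: "(x - y) $ i \<noteq> 0" "(x - y) $ i \<in> \<int>" by (auto simp: intlat_def vec_eq_iff)
    then have "1 \<le> \<bar>(x - y) $ i\<bar>" by (intro Ints_nonzero_abs_ge1)
    moreover have "x $ i \<le> z $ i" "z $ i < x $ i + 1" "y $ i \<le> z $ i" "z $ i < y $ i + 1" using z by (auto simp: Q_def)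
    ultimately show False by (simp add: abs_if split: if_splits)
  qed
  have Q_cover: "\<exists>x\<in>lat_shift x0. y \<in> Q x" for y
  proof (rule bexI[of _ "(\<chi> i. of_int \<lfloor>(y - x0) $ i\<rfloor>) + x0"])
    show "(\<chi> i. of_int \<lfloor>(y - x0) $ i\<rfloor>) + x0 \<in> lat_shift x0" by (simp add: lat_shift_iff intlat_def)
    show "y \<in> Q ((\<chi> i. of_int \<lfloor>(y - x0) $ i\<rfloor>) + x0)"
      by (simp add: Q_def) (intro allI conjI; linarith)
  qed
  have Q_close: "N (y - x) \<le> k" "N (x - y) \<le> k" if "y \<in> Q x" for x y
  proof -
    have "\<bar>(y - x) $ i\<bar> \<le> 1" "\<bar>(x - y) $ i\<bar> \<le> 1" for i using that unfolding Q_def by (simp_all add: abs_le_iff less_imp_le, (smt (verit))+)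
    then show "N (y - x) \<le> k" "N (x - y) \<le> k" by (auto intro!: up simp: infnorm_cart_le_iff)
  qed
  have card_eq: "measure lebesgue (\<Union>x\<in>X R. Q x) = real (card (X R))" for R
  proof -
    have "measure lebesgue (\<Union>x\<in>X R. Q x) = (\<Sum>x\<in>X R. measure lebesgue (Q x))"
      using finX Q_meas(1) disj by (intro measure_UNION'[OF finX]) (auto simp: X_def pairwise_def disjnt_def)
    then show ?thesis by (simp add: Q_meas)
  qed
  have meas_U: "(\<Union>x\<in>X R. Q x) \<in> lmeasurable" for R
    using finX Q_meas by (intro fmeasurable.finite_UN) auto
  have "V * (R - k) ^ CARD('d) \<le> real (card (X R)) \<and> real (card (X R)) \<le> V * (R + k) ^ CARD('d)" if "R \<ge> k" for R
  proof
    have "B (R - k) \<subseteq> (\<Union>x\<in>X R. Q x)"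
    proof
      fix y assume y: "y \<in> B (R - k)"
      obtain x where x: "x \<in> lat_shift x0" "y \<in> Q x" using Q_cover by blast
      have "N x \<le> N y + N (x - y)" using tri[of y "x - y"] by simp
      then have "x \<in> X R" using x Q_close(2)[OF x(2)] y by (simp add: X_def B_def)
      then show "y \<in> (\<Union>x\<in>X R. Q x)" using x(2) by blast
    qed
    then have "measure lebesgue (B (R - k)) \<le> measure lebesgue (\<Union>x\<in>X R. Q x)"
      by (intro measure_mono_fmeasurable meas_U) (use meas_B in auto)
    then show "V * (R - k) ^ CARD('d) \<le> real (card (X R))" using scale[of "R - k"] that card_eq by simp
    have "(\<Union>x\<in>X R. Q x) \<subseteq> B (R + k)"
    proof
      fix y assume "y \<in> (\<Union>x\<in>X R. Q x)"
      then obtain x where x: "x \<in> X R" "y \<in> Q x" by blast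
      have "N y \<le> N x + N (y - x)" using tri[of x "y - x"] by simp
      then show "y \<in> B (R + k)" using x Q_close(1)[OF x(2)] by (simp add: X_def B_def)
    qed
    then have "measure lebesgue (\<Union>x\<in>X R. Q x) \<le> measure lebesgue (B (R + k))"
      by (intro measure_mono_fmeasurable meas_B) (use meas_U in auto)
    then show "real (card (X R)) \<le> V * (R + k) ^ CARD('d)" using scale[of "R + k"] that k0 card_eq by simp
  qed
  then show ?thesis using V unfolding X_def by blast
qed

lemma filterlim_diff_const_at_top: "filterlim (\<lambda>R::real. R - c) at_top at_top"
  unfolding filterlim_at_top
proof
  fix Z :: real
  show "\<forall>\<^sub>F R in at_top. Z \<le> R - c"
    using eventually_ge_at_top[of "Z + c"] by eventually_elim simp
qed

lemma power_ratio_eventually_le: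
  fixes k c \<epsilon> :: real
  assumes "\<epsilon> > 0"
  shows "\<forall>\<^sub>F R in at_top. (R + c + k) ^ n \<le> (1 + \<epsilon>) * (R - k) ^ n"
proof -
  have "((\<lambda>R. (1 + (c + 2 * k) / (R - k)) ^ n) \<longlongrightarrow> (1 + 0) ^ n) at_top"
    by (intro tendsto_power tendsto_add tendsto_const tendsto_divide_0[OF tendsto_const]
        filterlim_at_top_imp_at_infinity filterlim_diff_const_at_top)
  then have "\<forall>\<^sub>F R in at_top. (1 + (c + 2 * k) / (R - k)) ^ n < 1 + \<epsilon>"
    using assms by (intro order_tendstoD(2)) auto
  then show ?thesis
    using eventually_gt_at_top[of k]
  proof eventually_elim
    case (elim R)
    then have "1 + (c + 2 * k) / (R - k) = (R + c + k) / (R - k)" by (simp add: field_simps)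
    then have "(R + c + k) ^ n / (R - k) ^ n < 1 + \<epsilon>" using elim(1) by (simp add: power_divide)
    then show ?case using elim(2) by (simp add: pos_divide_less_eq less_imp_le)
  qed
qed

section \<open>Growth of the number of points in balls\<close>

context cut_project
begin

definition total :: "real \<Rightarrow> nat" where
  "total R = card {t \<in> T. infnorm (p t) \<le> R}"

text \<open>Adding the integer vector with horizontal part x - x' and vertical part 0, then
  reducing, maps one fibre injectively into the other. Applied in both directions it shows that all
  fibres over the shifted horizontal lattice have the same size.\<close>

lemma card_fiber_le:
  assumes "x - x' \<in> intlat" "finite {t \<in> T. horiz t = x}" "finite {t \<in> T. horiz t = x'}"
  shows "card {t \<in> T. horiz t = x'} \<le> card {t \<in> T. horiz t = x}"
proof (rule card_inj_on_le)
  let ?z = "pair_vec (x - x') 0"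
  have z: "?z \<in> intlat" using assms(1) by (intro intlat_pair_vec) auto
  show "inj_on (\<lambda>t. red (t + ?z)) {t \<in> T. horiz t = x'}"
    by (rule inj_onI) (auto intro: red_add_inj)
  show "(\<lambda>t. red (t + ?z)) ` {t \<in> T. horiz t = x'} \<subseteq> {t \<in> T. horiz t = x}"
    using T_lat z by (auto intro!: red_T lat_shift_add)
qed (fact assms)

lemma finite_fiber: "finite {t \<in> T. horiz t = x}"
proof -
  obtain K where K: "K \<ge> 0" "\<And>v. (\<forall>j. \<bar>u v $ j\<bar> \<le> 1) \<Longrightarrow> infnorm (p v - graph_emb A (horiz v)) \<le> K"
    by (rule p_approx) (rule that)
  have "{t \<in> T. horiz t = x} \<subseteq> {t \<in> T. infnorm (p t) \<le> K + infnorm (graph_emb A x)}"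
  proof
    fix t assume t: "t \<in> {t \<in> T. horiz t = x}"
    then have "\<forall>j. \<bar>u t $ j\<bar> \<le> 1" using T_bounds(3) by blast
    then have "infnorm (p t - graph_emb A x) \<le> K" using K(2)[of t] t by auto
    then show "t \<in> {t \<in> T. infnorm (p t) \<le> K + infnorm (graph_emb A x)}"
      using t infnorm_triangle[of "p t - graph_emb A x" "graph_emb A x"] by simp
  qed
  then show ?thesis using finite_T_bounded by (rule finite_subset)
qed

text \<open>T consists of equally large fibres over the shifted horizontal lattice, and on T the two
  projections differ by a bounded amount. Counting horizontal lattice points in the norm induced by
  \<open>graph_emb A\<close> gives both bounds with the same leading constant.\<close>

lemma total_bounds:
  obtains V k where "V > 0" "\<And>R. R \<ge> k \<Longrightarrow> V * (R - k) ^ CARD('d) \<le> real (total R)"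
    "\<And>R. R \<ge> k \<Longrightarrow> real (total R) \<le> V * (R + k) ^ CARD('d)"
proof -
  obtain K where K: "K \<ge> 0" "\<And>v. (\<forall>j. \<bar>u v $ j\<bar> \<le> 1) \<Longrightarrow> infnorm (p v - graph_emb A (horiz v)) \<le> K"
    by (rule p_approx) (rule that)
  have T1: "infnorm (p t - graph_emb A (horiz t)) \<le> K" if "t \<in> T" for t
    using K(2) T_bounds(3)[OF that] by blast
  have T_ub: "infnorm (graph_emb A (horiz t)) \<le> infnorm (p t) + K" if "t \<in> T" for t
    using infnorm_triangle[of "p t" "- (p t - graph_emb A (horiz t))"] T1[OF that] infnorm_neg[of "p t - graph_emb A (horiz t)"] by simp
  have T_lb: "infnorm (p t) \<le> infnorm (graph_emb A (horiz t)) + K" if "t \<in> T" for t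
    using infnorm_triangle[of "p t - graph_emb A (horiz t)" "graph_emb A (horiz t)"] T1[OF that] by simp
  define N where "N x = infnorm (graph_emb A x)" for x
  obtain k' where k': "\<And>x. norm (graph_emb A x) \<le> norm x * k'" 
    using linear_bounded[OF linear_graph_emb[of A]] by (metis mult.commute)
  define k where "k = sqrt (real CARD('d)) * \<bar>k'\<bar>"
  have up: "N x \<le> k" if "infnorm x \<le> 1" for x
  proof -
    have "N x \<le> norm (graph_emb A x)" by (simp add: N_def infnorm_le_norm)
    also have "\<dots> \<le> norm x * k'" by (rule k')
    also have "\<dots> \<le> norm x * \<bar>k'\<bar>" by (intro mult_left_mono) auto
    also have "norm x \<le> sqrt (real CARD('d)) * infnorm x" using norm_le_infnorm[of x] by simp
    also have "\<dots> \<le> sqrt (real CARD('d)) * 1" using that by (intro mult_left_mono) auto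
    finally show ?thesis by (simp add: k_def mult_right_mono)
  qed
  have low: "infnorm x \<le> N x" for x
    unfolding N_def using infnorm_horiz_le[of "graph_emb A x"] by simp
  have tri: "N (x + y) \<le> N x + N y" for x y
    unfolding N_def linear_add[OF linear_graph_emb] by (rule infnorm_triangle)
  have hom: "N (r *\<^sub>R x) = \<bar>r\<bar> * N x" for r x
    unfolding N_def linear_scale[OF linear_graph_emb] by (rule infnorm_mul)
  have cont: "continuous_on UNIV N"
    unfolding N_def using linear_continuous_on[OF linear_conv_bounded_linear[THEN iffD1, OF linear_graph_emb]] 
    by (intro continuous_on_infnorm) blast
  define a where "a R = card {x \<in> lat_shift (horiz s). N x \<le> R}" for R
  obtain V where V: "V > 0" "\<And>R. R \<ge> k \<Longrightarrow> V * (R - k) ^ CARD('d) \<le> real (a R)" "\<And>R. R \<ge> k \<Longrightarrow> real (a R) \<le> V * (R + k) ^ CARD('d)"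
    using lattice_points_dilate_bounds[OF tri hom low up cont, of "horiz s"] unfolding a_def by blast
  have fin_a: "finite {x \<in> lat_shift (horiz s). N x \<le> R}" for R
    by (rule finite_subset[OF _ finite_lat_shift_bounded[of "horiz s" R]]) (use low in \<open>auto intro: order_trans\<close>)
  define I where "I = card {t \<in> T. horiz t = horiz s}"
  have s_mem: "s \<in> lat_shift s" by (simp add: lat_shift_iff)
  have fib: "card {t \<in> T. horiz t = x} = I" if "x \<in> lat_shift (horiz s)" for x
  proof (rule antisym)
    have 1: "x - horiz s \<in> intlat" using that by (simp add: lat_shift_iff)
    have 2: "horiz s - x \<in> intlat" using intlat_uminus[OF 1] by simp
    show "card {t \<in> T. horiz t = x} \<le> I"
      unfolding I_def by (rule card_fiber_le[OF 2 finite_fiber finite_fiber])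
    show "I \<le> card {t \<in> T. horiz t = x}"
      unfolding I_def by (rule card_fiber_le[OF 1 finite_fiber finite_fiber])
  qed
  have "red s \<in> {t \<in> T. horiz t = horiz s}" using red_T[OF s_mem] by simp
  then have "I > 0" unfolding I_def card_gt_0_iff using finite_fiber by blast
  then have I: "I \<ge> 1" by simp
  have UN_card: "card (\<Union>x\<in>{x \<in> lat_shift (horiz s). N x \<le> R}. {t \<in> T. horiz t = x}) = I * a R" for R
  proof -
    have "card (\<Union>x\<in>{x \<in> lat_shift (horiz s). N x \<le> R}. {t \<in> T. horiz t = x}) = (\<Sum>x\<in>{x \<in> lat_shift (horiz s). N x \<le> R}. card {t \<in> T. horiz t = x})"
      using fin_a finite_fiber by (intro card_UN_disjoint) auto
    also have "\<dots> = (\<Sum>x\<in>{x \<in> lat_shift (horiz s). N x \<le> R}. I)" by (intro sum.cong refl fib) auto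
    finally show ?thesis by (simp add: a_def)
  qed
  have fin_UN: "finite (\<Union>x\<in>{x \<in> lat_shift (horiz s). N x \<le> R}. {t \<in> T. horiz t = x})" for R
    using fin_a finite_fiber by auto
  have lat_h: "horiz t \<in> lat_shift (horiz s)" if "t \<in> T" for t
    using that T_lat intlat_horiz[of "t - s"] by (auto simp: lat_shift_iff)
  have up_total: "total R \<le> I * a (R + K)" for R
    unfolding UN_card[symmetric] total_def
    using T_ub lat_h by (intro card_mono fin_UN) (fastforce simp: N_def)
  have lo_total: "I * a (R - K) \<le> total R" for R
    unfolding UN_card[symmetric] total_def
    using T_lb by (intro card_mono finite_T_bounded) (fastforce simp: N_def)
  show ?thesis
  proof (rule that[of "real I * V" "k + K"])
    show "real I * V > 0" using I V(1) by simp
    fix R assume R: "R \<ge> k + K"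
    have "real I * (V * (R - K - k) ^ CARD('d)) \<le> real I * real (a (R - K))"
      using R by (intro mult_left_mono V(2)) auto
    also have "\<dots> \<le> real (total R)" using lo_total[of R] by (metis of_nat_le_iff of_nat_mult)
    finally show "real I * V * (R - (k + K)) ^ CARD('d) \<le> real (total R)" by (simp add: algebra_simps)
    have "real (total R) \<le> real I * real (a (R + K))" using up_total[of R] by (metis of_nat_le_iff of_nat_mult)
    also have "\<dots> \<le> real I * (V * (R + K + k) ^ CARD('d))" 
      using R K(1) by (intro mult_left_mono V(3)) auto
    finally show "real (total R) \<le> real I * V * (R + (k + K)) ^ CARD('d)" by (simp add: algebra_simps)
  qed
qed

lemma total_growth:
  assumes "\<epsilon> > 0"
  shows "\<forall>\<^sub>F R in at_top. real (total (R + c)) \<le> (1 + \<epsilon>) * real (total R)"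
proof -
  obtain V k where V: "V > 0" "\<And>R. R \<ge> k \<Longrightarrow> V * (R - k) ^ CARD('d) \<le> real (total R)"
    "\<And>R. R \<ge> k \<Longrightarrow> real (total R) \<le> V * (R + k) ^ CARD('d)"
    by (rule total_bounds) (rule that)
  show ?thesis
    using power_ratio_eventually_le[OF assms, of c k "CARD('d)"] eventually_ge_at_top[of k] eventually_ge_at_top[of "k - c"]
  proof eventually_elim
    case (elim R)
    have "real (total (R + c)) \<le> V * (R + c + k) ^ CARD('d)" using elim by (intro V(3)) simp
    also have "\<dots> \<le> V * ((1 + \<epsilon>) * (R - k) ^ CARD('d))" using elim V(1) by (intro mult_left_mono) auto
    also have "\<dots> = (1 + \<epsilon>) * (V * (R - k) ^ CARD('d))" by simp
    also have "\<dots> \<le> (1 + \<epsilon>) * real (total R)" using elim assms by (intro mult_left_mono V(2)) auto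
    finally show ?case .
  qed
qed

lemma total_mono: "R \<le> R' \<Longrightarrow> total R \<le> total R'"
  unfolding total_def by (intro card_mono finite_T_bounded) auto

lemma total_pos: "\<forall>\<^sub>F R in at_top. total R > 0"
proof -
  have s_mem: "s \<in> lat_shift s" by (simp add: lat_shift_iff)
  show ?thesis
    using eventually_ge_at_top[of "infnorm (p (red s))"]
  proof eventually_elim
    case (elim R)
    then have "red s \<in> {t \<in> T. infnorm (p t) \<le> R}" using red_T[OF s_mem] by simp
    then show ?case unfolding total_def card_gt_0_iff using finite_T_bounded by blast
  qed
qed

text \<open>By the growth estimate a shell of bounded width carries a vanishing share, so
  translating by a fixed lattice vector costs nothing asymptotically.\<close>

lemma total_shrink:
  assumes "\<epsilon> > 0" "c \<ge> 0"
  shows "\<forall>\<^sub>F R in at_top. real (total R) - real (total (R - c)) \<le> \<epsilon> * real (total R)"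
proof -
  have "\<forall>\<^sub>F R in at_top. real (total (R - c + c)) \<le> (1 + \<epsilon>) * real (total (R - c))"
    by (rule eventually_compose_filterlim[OF total_growth[OF assms(1), of c] filterlim_diff_const_at_top])
  then show ?thesis
  proof eventually_elim
    case (elim R)
    have "\<epsilon> * real (total (R - c)) \<le> \<epsilon> * real (total R)"
      using assms total_mono[of "R - c" R] by (intro mult_left_mono) auto
    then show ?case using elim by (simp add: algebra_simps)
  qed
qed

section \<open>Asymptotic shares of slabs and boxes\<close>

definition cnt :: "(real^'e) set \<Rightarrow> real \<Rightarrow> nat" where
  "cnt B R = card {t \<in> T. u t \<in> B \<and> infnorm (p t) \<le> R}"

lemma finite_cnt: "finite {t \<in> T. u t \<in> B \<and> infnorm (p t) \<le> R}"
  by (rule finite_subset[OF _ finite_T_bounded[of R]]) auto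

lemma cnt_shrink: "real (cnt B R) \<le> real (cnt B (R - c)) + (real (total R) - real (total (R - c)))" if "c \<ge> 0"
proof -
  let ?X = "{t \<in> T. u t \<in> B \<and> infnorm (p t) \<le> R}" and ?Y = "{t \<in> T. u t \<in> B \<and> infnorm (p t) \<le> R - c}"
  let ?P = "{t \<in> T. infnorm (p t) \<le> R}" and ?Q = "{t \<in> T. infnorm (p t) \<le> R - c}"
  have "?X \<subseteq> ?Y \<union> (?P - ?Q)" by auto
  then have "card ?X \<le> card (?Y \<union> (?P - ?Q))" by (intro card_mono) (auto simp: finite_cnt finite_T_bounded)
  also have "\<dots> \<le> card ?Y + card (?P - ?Q)" by (rule card_Un_le)
  also have "card (?P - ?Q) = total R - total (R - c)"
    unfolding total_def using that by (intro card_Diff_subset finite_T_bounded) auto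
  finally show ?thesis using total_mono[of "R - c" R] that by (simp add: cnt_def)
qed

text \<open>A thin slab has many disjoint translates in the torus, so it receives a small share of the points.\<close>
lemma cnt_slab:
  assumes "\<epsilon> > 0"
  obtains \<eta> where "\<eta> > 0" "\<And>j a. \<forall>\<^sub>F R in at_top. real (cnt {v. a \<le> v $ j \<and> v $ j \<le> a + \<eta>} R) \<le> \<epsilon> * real (total R)"
proof -
  obtain K :: nat where K: "real K > 2 / \<epsilon>" using reals_Archimedean2 by blast
  have "2 / \<epsilon> > 0" using assms by simp
  then have K0: "K > 0" using K by (metis gr0I of_nat_0 less_asym)
  \<comment> \<open>K translates of a slab of width \<eta>, at spacing 2\<eta>, fill a circle of
    length 1; the free half of each period absorbs an error of \<eta>/2 on either side of a
    slab.\<close>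
  define \<eta> where "\<eta> = 1 / (2 * real K)"
  have \<eta>: "\<eta> > 0" "2 * real K * \<eta> = 1" using K0 by (auto simp: \<eta>_def)
  show ?thesis
  proof (rule that[OF \<eta>(1)])
    fix j a
    define Sl where "Sl = {v::real^'e. a \<le> v $ j \<and> v $ j \<le> a + \<eta>}"
    have "\<exists>z. z \<in> intlat \<and> (\<forall>j'. \<bar>u z $ j' - (\<chi> j'. if j' = j then 2 * real i * \<eta> else 0) $ j'\<bar> < \<eta> / 2)" for i :: nat
      using u_dense[of "\<eta> / 2" "\<chi> j'. if j' = j then 2 * real i * \<eta> else 0"] \<eta> by (metis half_gt_zero)
    then obtain z where z: "\<And>i. z i \<in> intlat" "\<And>i j'. \<bar>u (z i) $ j' - (if j' = j then 2 * real i * \<eta> else 0)\<bar> < \<eta> / 2"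
      by (simp only: vec_lambda_beta) metis
    \<comment> \<open>Bounds the displacement of the projected point under translation by
      \<open>z i\<close> and reduction. The coordinates of \<open>u (t + z i)\<close> lie between -1
      and 3, so the floors have modulus at most 3.\<close>
    define c where "c = (\<Sum>i<K. infnorm (p (z i))) + (\<Sum>j'\<in>UNIV. 3 * infnorm (p (w j')))"
    have c0: "c \<ge> 0" unfolding c_def by (intro add_nonneg_nonneg sum_nonneg) (auto simp: infnorm_pos_le)
    have \<eta>1: "\<eta> \<le> 1 / 2" using K0 by (simp add: \<eta>_def field_simps)
    have iK: "2 * real i * \<eta> + 2 * \<eta> \<le> 1" if "i < K" for i
    proof -
      have "(2 * real i + 2) * \<eta> \<le> 2 * real K * \<eta>" using that \<eta>(1) by (intro mult_right_mono) auto
      then show ?thesis using \<eta>(2) by (simp add: algebra_simps)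
    qed
    have uz: "-1 < u (z i) $ j'" "u (z i) $ j' < 2" if "i < K" for i j'
    proof -
      define X where "X = (if j' = j then 2 * real i * \<eta> else 0)"
      have "0 \<le> X" "X \<le> 1" using \<eta>(1) iK[OF that] by (auto simp: X_def)
      moreover have "\<bar>u (z i) $ j' - X\<bar> < \<eta> / 2" unfolding X_def by (rule z(2))
      ultimately show "-1 < u (z i) $ j'" "u (z i) $ j' < 2" using \<eta>1 by linarith+
    qed
    have bound: "infnorm (p (red (t + z i))) \<le> infnorm (p t) + c" if "i < K" "t \<in> T" for i t
    proof -
      have fl: "\<bar>of_int \<lfloor>u (t + z i) $ j'\<rfloor>\<bar> \<le> (3::real)" for j'
      proof -
        have "0 < u t $ j'" "u t $ j' < 1" using that(2) by (auto simp: T_def)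
        then have "-1 < u (t + z i) $ j'" "u (t + z i) $ j' < 3" using uz[OF that(1), of j'] by auto
        then show ?thesis by linarith
      qed
      let ?f = "\<Sum>j'\<in>UNIV. of_int \<lfloor>u (t + z i) $ j'\<rfloor> *\<^sub>R p (w j')"
      have "p (red (t + z i)) = p t + (p (z i) - ?f)"
        by (simp add: red_def del: u_simps)
      then have "infnorm (p (red (t + z i))) \<le> infnorm (p t) + infnorm (p (z i) - ?f)"
        by (simp only: infnorm_triangle)
      also have "infnorm (p (z i) - ?f) \<le> infnorm (p (z i)) + infnorm ?f"
        by (rule infnorm_diff_le)
      also have "infnorm ?f \<le> (\<Sum>j'\<in>UNIV. 3 * infnorm (p (w j')))"
        by (rule infnorm_sum_scaleR_le) (rule fl)
      also have "infnorm (p (z i)) \<le> (\<Sum>i<K. infnorm (p (z i)))"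
        using that(1) by (intro member_le_sum) (auto simp: infnorm_pos_le)
      finally show ?thesis by (simp add: c_def)
    qed
    have K_cnt: "K * cnt Sl (R - c) \<le> total R" for R
    proof -
      let ?X = "{t \<in> T. u t \<in> Sl \<and> infnorm (p t) \<le> R - c}"
      have "card ({..<K} \<times> ?X) \<le> card {t \<in> T. infnorm (p t) \<le> R}"
      proof (rule card_inj_on_le)
        show "finite {t \<in> T. infnorm (p t) \<le> R}" by (rule finite_T_bounded)
        show "(\<lambda>(i, t). red (t + z i)) ` ({..<K} \<times> ?X) \<subseteq> {t \<in> T. infnorm (p t) \<le> R}"
          using bound T_lat z(1) by (fastforce intro!: red_T lat_shift_add)
        show "inj_on (\<lambda>(i, t). red (t + z i)) ({..<K} \<times> ?X)"
        proof (rule inj_onI, clarify)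
          fix i t i' t'
          assume i: "i < K" "i' < K" and t: "t \<in> T" "u t \<in> Sl" "t' \<in> T" "u t' \<in> Sl"
            and eq: "red (t + z i) = red (t' + z i')"
          let ?x = "u t $ j + u (z i) $ j" and ?y = "u t' $ j + u (z i') $ j"
          have "frac ?x = frac ?y" using arg_cong[OF eq, of "\<lambda>x. u x $ j"] by simp
          then have "?x - ?y = of_int (\<lfloor>?x\<rfloor> - \<lfloor>?y\<rfloor>)" unfolding frac_def of_int_diff by linarith
          then obtain m :: int where m: "?x - ?y = of_int m" by blast
          have zj: "\<bar>u (z i) $ j - 2 * real i * \<eta>\<bar> < \<eta> / 2" for i using z(2)[of i j] by (simp only: simp_thms if_True)
          have x: "a + 2 * real i * \<eta> - \<eta> / 2 < ?x" "?x < a + 2 * real i * \<eta> + 3 * \<eta> / 2"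
            using zj[of i] t unfolding Sl_def mem_Collect_eq by linarith+
          have y: "a + 2 * real i' * \<eta> - \<eta> / 2 < ?y" "?y < a + 2 * real i' * \<eta> + 3 * \<eta> / 2"
            using zj[of i'] t unfolding Sl_def mem_Collect_eq by linarith+
          have i0: "0 \<le> 2 * real i * \<eta>" "0 \<le> 2 * real i' * \<eta>" using \<eta> by auto
          \<comment> \<open>All thickened slabs lie in one interval of length 1, so no wraparound
            can identify points of different slabs.\<close>
          have "\<bar>?x - ?y\<bar> < 1" using x y iK[OF i(1)] iK[OF i(2)] i0 unfolding abs_less_iff by linarith
          then have "m = 0" using m by linarith
          then have xy: "?x = ?y" using m by simp
          then have "\<bar>(real i - real i') * (2 * \<eta>)\<bar> < 1 * (2 * \<eta>)" using x y by (simp add: abs_less_iff algebra_simps)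
          then have "\<bar>real i - real i'\<bar> < 1" using \<eta>(1) by (simp add: abs_mult)
          then have ii: "i = i'" by linarith
          then show "i = i' \<and> t = t'" using red_add_inj[OF t(1,3)] eq by blast
        qed
      qed
      then show ?thesis by (simp add: cnt_def total_def card_cartesian_product)
    qed
    have "\<forall>\<^sub>F R in at_top. real (total R) - real (total (R - c)) \<le> (\<epsilon> / 2) * real (total R)"
      using assms c0 by (intro total_shrink) auto
    then have "\<forall>\<^sub>F R in at_top. real (cnt Sl R) \<le> \<epsilon> * real (total R)"
    proof eventually_elim
      case (elim R)
      have "real K * real (cnt Sl (R - c)) \<le> real (total R)" using K_cnt[of R] by (metis of_nat_le_iff of_nat_mult)
      then have "real (cnt Sl (R - c)) \<le> real (total R) * (1 / real K)" using K0 by (simp add: field_simps)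
      also have "\<dots> \<le> real (total R) * (\<epsilon> / 2)" using K K0 assms by (intro mult_left_mono) (auto simp: field_simps)
      finally show ?case using elim cnt_shrink[OF c0, of Sl R] by (simp add: algebra_simps)
    qed
    then show "\<forall>\<^sub>F R in at_top. real (cnt {v. a \<le> v $ j \<and> v $ j \<le> a + \<eta>} R) \<le> \<epsilon> * real (total R)"
      by (simp add: Sl_def)
  qed
qed

definition bx :: "real^'e \<Rightarrow> real^'e \<Rightarrow> (real^'e) set" where
  "bx l h = {v. \<forall>j. l $ j < v $ j \<and> v $ j < h $ j}"

text \<open>A lattice vector z with \<open>u z\<close> within \<eta> of l' - l carries the first
  box, shrunk by \<eta> on all sides, into the second one. As the second box lies in the unit cube,
  the translates are in T without reduction. The part cut off lies in two thin slabs per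
  coordinate.\<close>

lemma cnt_bx_le:
  assumes same: "h - l = h' - l'" and l': "\<And>j. 0 \<le> l' $ j" "\<And>j. h' $ j \<le> 1" and \<epsilon>: "\<epsilon> > 0"
  shows "\<forall>\<^sub>F R in at_top. real (cnt (bx l h) R) \<le> real (cnt (bx l' h') R) + \<epsilon> * real (total R)"
proof -
  let ?e = "CARD('e)"
  \<comment> \<open>Two slabs for each coordinate, and one further share for the smaller radius R -
    c.\<close>
  define \<epsilon>' where "\<epsilon>' = \<epsilon> / (2 * real ?e + 1)"
  have \<epsilon>': "\<epsilon>' > 0" using \<epsilon> by (auto simp: \<epsilon>'_def intro!: divide_pos_pos add_nonneg_pos)
  obtain \<eta> where \<eta>: "\<eta> > 0" "\<And>j a. \<forall>\<^sub>F R in at_top. real (cnt {v. a \<le> v $ j \<and> v $ j \<le> a + \<eta>} R) \<le> \<epsilon>' * real (total R)"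
    by (rule cnt_slab[OF \<epsilon>']) (rule that)
  obtain z where z: "z \<in> intlat" "\<And>j. \<bar>u z $ j - (l' - l) $ j\<bar> < \<eta>"
    using u_dense[OF \<eta>(1), of "l' - l"] by metis
  define c where "c = infnorm (p z)"
  have c0: "c \<ge> 0" by (simp add: c_def infnorm_pos_le)
  define In where "In = {v. \<forall>j. l $ j + \<eta> < v $ j \<and> v $ j < h $ j - \<eta>}"
  define S1 where "S1 j = {v::real^'e. l $ j \<le> v $ j \<and> v $ j \<le> l $ j + \<eta>}" for j
  define S2 where "S2 j = {v::real^'e. h $ j - \<eta> \<le> v $ j \<and> v $ j \<le> h $ j - \<eta> + \<eta>}" for j
  have move: "cnt In (R - c) \<le> cnt (bx l' h') R" for R
    unfolding cnt_def
  proof (rule card_inj_on_le)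
    show "inj_on (\<lambda>t. t + z) {t \<in> T. u t \<in> In \<and> infnorm (p t) \<le> R - c}" by simp
    show "(\<lambda>t. t + z) ` {t \<in> T. u t \<in> In \<and> infnorm (p t) \<le> R - c} \<subseteq> {t \<in> T. u t \<in> bx l' h' \<and> infnorm (p t) \<le> R}"
    proof clarify
      fix t assume t: "t \<in> T" "u t \<in> In" "infnorm (p t) \<le> R - c"
      have b: "l' $ j < u (t + z) $ j \<and> u (t + z) $ j < h' $ j" for j
      proof -
        have "h $ j - l $ j = h' $ j - l' $ j" using arg_cong[OF same, of "\<lambda>v. v $ j"] by simp
        moreover have "l $ j + \<eta> < u t $ j" "u t $ j < h $ j - \<eta>" using t(2) by (auto simp: In_def)
        ultimately show ?thesis using z(2)[of j] by (simp add: abs_less_iff)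
      qed
      have "t + z \<in> T" unfolding T_def
        using t(1) T_lat z(1) b l' by (auto intro!: lat_shift_add simp del: u_simps) (meson le_less_trans less_le_trans)+
      moreover have "infnorm (p (t + z)) \<le> R" using t(3) infnorm_triangle[of "p t" "p z"] by (simp add: c_def)
      ultimately show "t + z \<in> T \<and> u (t + z) \<in> bx l' h' \<and> infnorm (p (t + z)) \<le> R" using b by (simp add: bx_def)
    qed
  qed (rule finite_cnt)
  have split: "cnt (bx l h) R \<le> cnt In R + (\<Sum>j\<in>UNIV. cnt (S1 j) R + cnt (S2 j) R)" for R
  proof -
    let ?C = "\<lambda>B. {t \<in> T. u t \<in> B \<and> infnorm (p t) \<le> R}"
    have "?C (bx l h) \<subseteq> ?C In \<union> (\<Union>j\<in>UNIV. ?C (S1 j) \<union> ?C (S2 j))"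
      by (auto simp: bx_def In_def S1_def S2_def not_less) (meson less_imp_le not_less)+
    then have "cnt (bx l h) R \<le> card (?C In \<union> (\<Union>j\<in>UNIV. ?C (S1 j) \<union> ?C (S2 j)))"
      unfolding cnt_def by (intro card_mono) (auto simp: finite_cnt)
    also have "\<dots> \<le> card (?C In) + card (\<Union>j\<in>UNIV. ?C (S1 j) \<union> ?C (S2 j))" by (rule card_Un_le)
    also have "card (\<Union>j\<in>UNIV. ?C (S1 j) \<union> ?C (S2 j)) \<le> (\<Sum>j\<in>UNIV. card (?C (S1 j) \<union> ?C (S2 j)))" by (rule card_UN_le) simp
    also have "\<dots> \<le> (\<Sum>j\<in>UNIV. card (?C (S1 j)) + card (?C (S2 j)))" by (intro sum_mono card_Un_le)
    finally show ?thesis by (simp add: cnt_def)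
  qed
  have ev: "\<forall>\<^sub>F R in at_top. \<forall>j\<in>UNIV. real (cnt (S1 j) R) \<le> \<epsilon>' * real (total R) \<and> real (cnt (S2 j) R) \<le> \<epsilon>' * real (total R)"
    unfolding S1_def S2_def by (intro eventually_ball_finite ballI eventually_conj \<eta>(2) finite)
  show ?thesis
    using ev total_shrink[OF \<epsilon>' c0]
  proof eventually_elim
    case (elim R)
    have "real (cnt (bx l h) R) \<le> real (cnt In R) + (\<Sum>j\<in>UNIV. real (cnt (S1 j) R) + real (cnt (S2 j) R))"
      using of_nat_mono[OF split[of R], where 'a = real] unfolding of_nat_add of_nat_sum .
    also have "(\<Sum>j\<in>UNIV. real (cnt (S1 j) R) + real (cnt (S2 j) R)) \<le> (\<Sum>j\<in>(UNIV::'e set). 2 * (\<epsilon>' * real (total R)))"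
    proof (rule sum_mono)
      fix j
      have "real (cnt (S1 j) R) \<le> \<epsilon>' * real (total R)" "real (cnt (S2 j) R) \<le> \<epsilon>' * real (total R)"
        using elim(1) by blast+
      then show "real (cnt (S1 j) R) + real (cnt (S2 j) R) \<le> 2 * (\<epsilon>' * real (total R))" by linarith
    qed
    also have "real (cnt In R) \<le> real (cnt In (R - c)) + \<epsilon>' * real (total R)"
      using cnt_shrink[OF c0, of In R] elim(2) by linarith
    also have "real (cnt In (R - c)) \<le> real (cnt (bx l' h') R)" using move by simp
    finally have "real (cnt (bx l h) R) \<le> real (cnt (bx l' h') R) + (2 * real ?e + 1) * \<epsilon>' * real (total R)"
      by (simp add: algebra_simps)
    moreover have "(2 * real ?e + 1) * \<epsilon>' = \<epsilon>" unfolding \<epsilon>'_def by (simp add: add_nonneg_eq_0_iff)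
    ultimately show ?case by simp
  qed
qed

lemma cnt_bx_asymp:
  assumes "h - l = h' - l'" "\<And>j. 0 \<le> l $ j" "\<And>j. h $ j \<le> 1" "\<And>j. 0 \<le> l' $ j" "\<And>j. h' $ j \<le> 1"
  shows "((\<lambda>R. real (cnt (bx l h) R) / real (total R) - real (cnt (bx l' h') R) / real (total R)) \<longlongrightarrow> 0) at_top"
proof (rule tendstoI)
  fix \<epsilon> :: real assume "\<epsilon> > 0"
  then have \<epsilon>: "\<epsilon> / 2 > 0" by simp
  show "\<forall>\<^sub>F R in at_top. dist (real (cnt (bx l h) R) / real (total R) - real (cnt (bx l' h') R) / real (total R)) 0 < \<epsilon>"
    using cnt_bx_le[OF assms(1,4,5) \<epsilon>] cnt_bx_le[OF assms(1)[symmetric] assms(2,3) \<epsilon>] total_pos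
  proof eventually_elim
    case (elim R)
    have "\<bar>real (cnt (bx l h) R) - real (cnt (bx l' h') R)\<bar> \<le> \<epsilon> / 2 * real (total R)"
      using elim(1,2) by linarith
    also have "\<dots> < \<epsilon> * real (total R)" using \<open>\<epsilon> > 0\<close> elim(3) by simp
    finally show ?case using elim(3) by (simp add: dist_real_def diff_divide_distrib[symmetric] pos_divide_less_eq)
  qed
qed

end

section \<open>Counting patch frequencies\<close>

lemma card_separated_le:
  fixes X :: "real set"
  assumes \<sigma>: "\<sigma> > 0" and sep: "\<And>x y. x \<in> X \<Longrightarrow> y \<in> X \<Longrightarrow> x \<noteq> y \<Longrightarrow> \<sigma> \<le> \<bar>x - y\<bar>"
    and X: "X \<subseteq> {a..b}" and K: "b - a \<le> real K * \<sigma>"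
  shows "finite X \<and> card X \<le> K + 1"
proof -
  let ?f = "\<lambda>x. nat \<lfloor>(x - a) / \<sigma>\<rfloor>"
  have inj: "inj_on ?f X"
  proof (rule inj_onI, rule ccontr)
    fix x y assume x: "x \<in> X" "y \<in> X" "?f x = ?f y" "x \<noteq> y"
    have "0 \<le> (x - a) / \<sigma>" "0 \<le> (y - a) / \<sigma>" using x X \<sigma> by auto
    then have "\<lfloor>(x - a) / \<sigma>\<rfloor> = \<lfloor>(y - a) / \<sigma>\<rfloor>" using x(3) by (simp add: eq_nat_nat_iff)
    then have "\<bar>(x - a) / \<sigma> - (y - a) / \<sigma>\<bar> < 1" by linarith
    then have "\<bar>(x - y) / \<sigma>\<bar> < 1" by (simp add: diff_divide_distrib)
    then have "\<bar>x - y\<bar> < \<sigma>" using \<sigma> by (simp add: abs_divide)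
    then show False using sep[OF x(1,2,4)] by simp
  qed
  have "?f ` X \<subseteq> {..K}"
  proof (rule image_subsetI)
    fix x assume "x \<in> X"
    then have "x - a \<le> real K * \<sigma>" using X K by force
    then have "(x - a) / \<sigma> \<le> real K" using \<sigma> by (simp add: divide_le_eq)
    then have "\<lfloor>(x - a) / \<sigma>\<rfloor> \<le> int K" by linarith
    then show "?f x \<in> {..K}" by simp
  qed
  then have "finite (?f ` X)" "card (?f ` X) \<le> card {..K}"
    using finite_subset card_mono by (blast, metis finite_atMost card_mono)
  then show ?thesis using inj finite_image_iff card_image by fastforce
qed

lemma card_vec_set:
  fixes X :: "'n::finite \<Rightarrow> 'a set"
  assumes "\<And>j. finite (X j)" "\<And>j. card (X j) \<le> q"
  shows "finite {v :: 'a^'n. \<forall>j. v $ j \<in> X j}" "card {v :: 'a^'n. \<forall>j. v $ j \<in> X j} \<le> q ^ CARD('n)"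
proof -
  let ?P = "Pi\<^sub>E UNIV X"
  have sub: "{v :: 'a^'n. \<forall>j. v $ j \<in> X j} \<subseteq> vec_lambda ` ?P"
  proof
    fix v :: "'a^'n" assume "v \<in> {v. \<forall>j. v $ j \<in> X j}"
    then show "v \<in> vec_lambda ` ?P" by (intro image_eqI[of _ _ "vec_nth v"]) auto
  qed
  have fin: "finite ?P" using assms(1) by (intro finite_PiE) auto
  show "finite {v :: 'a^'n. \<forall>j. v $ j \<in> X j}" using sub fin by (meson finite_imageI finite_subset)
  have "card {v :: 'a^'n. \<forall>j. v $ j \<in> X j} \<le> card (vec_lambda ` ?P)" using sub fin by (intro card_mono) auto
  also have "\<dots> \<le> card ?P" using fin by (rule card_image_le)
  also have "\<dots> = (\<Prod>j\<in>UNIV. card (X j))" by (simp add: card_PiE)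
  also have "\<dots> \<le> (\<Prod>j\<in>(UNIV::'n set). q)" using assms(2) by (intro prod_mono) auto
  finally show "card {v :: 'a^'n. \<forall>j. v $ j \<in> X j} \<le> q ^ CARD('n)" by simp
qed

lemma Lim_eq_if_diff_tendsto_0:
  fixes f g :: "'b \<Rightarrow> real"
  assumes "((\<lambda>x. f x - g x) \<longlongrightarrow> 0) F"
  shows "Lim F f = Lim F g"
proof -
  have "(f \<longlongrightarrow> l) F \<longleftrightarrow> (g \<longlongrightarrow> l) F" for l
  proof
    assume "(f \<longlongrightarrow> l) F"
    from tendsto_diff[OF this assms] show "(g \<longlongrightarrow> l) F" by simp
  next
    assume "(g \<longlongrightarrow> l) F"
    from tendsto_add[OF this assms] show "(f \<longlongrightarrow> l) F" by simp
  qed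
  then have "(\<lambda>l. (f \<longlongrightarrow> l) F) = (\<lambda>l. (g \<longlongrightarrow> l) F)" by (rule ext)
  then show ?thesis unfolding Topological_Spaces.Lim_def by (rule arg_cong[where f = The])
qed

section \<open>Patches as sets of lattice differences and the cells on which they are
  constant\<close>

context cut_project
begin

text \<open>A patch recorded by the differences of lifted points, with S the set of differences
  allowed by its size and type; equivalence of patches becomes equality of these sets.\<close>

definition pat :: "(real^('d + 'e)) set \<Rightarrow> real^('d + 'e) \<Rightarrow> (real^('d + 'e)) set" where
  "pat S t = {n \<in> S. t + n \<in> T}"

definition pat_freq :: "(real^('d + 'e)) set \<Rightarrow> real^('d + 'e) \<Rightarrow> real" where
  "pat_freq S t0 = Lim at_top (\<lambda>R. real (card {t \<in> T. infnorm (p t) \<le> R \<and> pat S t = pat S t0}) / real (total R))"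

text \<open>Every difference of two points of T has all coordinates of u below 1 in modulus, so this
  set contains all such differences of horizontal size at most N.\<close>

definition near :: "nat \<Rightarrow> (real^('d + 'e)) set" where
  "near N = {n \<in> intlat. (\<forall>j. \<bar>u n $ j\<bar> < 1) \<and> infnorm (horiz n) \<le> real N}"

text \<open>If the j-th coordinates were more than G apart, some n of admissible size would have its
  j-th coordinate strictly between them. Moving t by -n and reducing wraps around in direction j.
  The resulting difference m belongs to the pattern of t, but added to t' it raises the coordinate
  above 1.\<close>

lemma eq_coords_if_same_pat:
  assumes S: "near N \<subseteq> S"
    and gap: "\<And>y j. \<exists>n\<in>intlat. infnorm (horiz n) \<le> N \<and> 0 \<le> y - u n $ j \<and> y - u n $ j < G"
    and t: "t \<in> T" "t' \<in> T" "pat S t = pat S t'"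
  shows "u t' $ j - u t $ j \<le> G"
proof (rule ccontr)
  assume "\<not> ?thesis"
  then have far: "u t' $ j - u t $ j > G" by simp
  obtain n where n: "n \<in> intlat" "infnorm (horiz n) \<le> N" "0 \<le> u t' $ j - u n $ j" "u t' $ j - u n $ j < G"
    using gap by blast
  have lt: "t \<in> lat_shift s" "t' \<in> lat_shift s" using t T_lat by auto
  have t'n: "t' - n \<in> lat_shift s" using lat_shift_add[OF lt(2) intlat_uminus[OF n(1)]] by simp
  have tn: "t - n \<in> lat_shift s" using lat_shift_add[OF lt(1) intlat_uminus[OF n(1)]] by simp
  have pos: "u t' $ j - u n $ j > 0" using u_not_int[OF t'n, of j] n(3) by (cases "u t' $ j = u n $ j") auto
  define m where "m = red (t - n) - t"
  have mT: "t + m \<in> T" using red_T[OF tn] by (simp add: m_def)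
  have um: "u m $ i = frac (u t $ i - u n $ i) - u t $ i" for i by (simp add: m_def)
  have "m \<in> intlat" unfolding m_def using red_lat_shift[OF tn] lt(1) by (rule lat_shift_diff)
  moreover have "\<bar>u m $ i\<bar> < 1" for i
    using T_bounds(1,2)[OF t(1), of i] T_bounds(1,2)[OF mT, of i] by simp
  moreover have "infnorm (horiz m) \<le> N" using n(2) by (simp add: m_def infnorm_neg)
  ultimately have "m \<in> S" using S by (auto simp: near_def)
  then have "m \<in> pat S t" using mT by (simp add: pat_def)
  then have "m \<in> pat S t'" unfolding t(3) .
  then have "t' + m \<in> T" by (simp add: pat_def)
  then have "u (t' + m) $ j < 1" by (rule T_bounds)
  moreover have "frac (u t $ j - u n $ j) \<ge> u t $ j - u n $ j + 1"
  proof -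
    have "u t $ j - u n $ j < 0" using far n(4) by linarith
    then have "\<lfloor>u t $ j - u n $ j\<rfloor> \<le> -1" by (simp add: floor_le_iff)
    then show ?thesis by (simp add: frac_def)
  qed
  ultimately show False using pos by (simp add: um)
qed

text \<open>The positions in coordinate j at which t + n can enter or leave T for some n of
  horizontal size at most N. They include 0 and 1, so every point of T has a neighbouring cut on
  both sides.\<close>

definition cuts :: "nat \<Rightarrow> 'e \<Rightarrow> real set" where
  "cuts N j = {x. \<exists>n\<in>intlat. infnorm (horiz n) \<le> real N \<and> x = u n $ j \<and> 0 \<le> x \<and> x \<le> 1}"

definition lo :: "nat \<Rightarrow> real^('d + 'e) \<Rightarrow> real^'e" where
  "lo N t = (\<chi> j. Max {x \<in> cuts N j. x < u t $ j})"

definition hi :: "nat \<Rightarrow> real^('d + 'e) \<Rightarrow> real^'e" where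
  "hi N t = (\<chi> j. Min {x \<in> cuts N j. u t $ j < x})"

lemma cuts_0_1: "0 \<in> cuts N j" "1 \<in> cuts N j"
proof -
  show "0 \<in> cuts N j" unfolding cuts_def by (auto intro!: bexI[of _ 0] simp: infnorm_0)
  show "1 \<in> cuts N j" unfolding cuts_def using w(2) by (auto intro!: bexI[of _ "w j"] simp: infnorm_0 axis_def)
qed

text \<open>The difference of two cuts is itself a value of the j-th coordinate, at a vector of
  horizontal size at most 2N.\<close>

lemma cuts_separated:
  assumes c: "\<And>n j N. n \<in> intlat \<Longrightarrow> infnorm (horiz n) \<le> real N \<Longrightarrow> 1 \<le> N \<Longrightarrow> u n $ j \<noteq> 0 \<Longrightarrow> c / real N ^ CARD('d) \<le> \<bar>u n $ j\<bar>"
    and N: "N \<ge> 1" and xy: "x \<in> cuts N j" "y \<in> cuts N j" "x \<noteq> y"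
  shows "c / real (2 * N) ^ CARD('d) \<le> \<bar>x - y\<bar>"
proof -
  obtain n m where n: "n \<in> intlat" "infnorm (horiz n) \<le> real N" "x = u n $ j" and m: "m \<in> intlat" "infnorm (horiz m) \<le> real N" "y = u m $ j"
    using xy by (auto simp: cuts_def)
  have "infnorm (horiz (n - m)) \<le> infnorm (horiz n) + infnorm (horiz m)"
    unfolding horiz_simps(2) by (rule infnorm_diff_le)
  then have "infnorm (horiz (n - m)) \<le> real (2 * N)" using n(2) m(2) by simp
  then have "c / real (2 * N) ^ CARD('d) \<le> \<bar>u (n - m) $ j\<bar>"
    using N n m xy(3) by (intro c intlat_diff) auto
  then show ?thesis using n m by simp
qed

lemma finite_cuts:
  assumes "N \<ge> 1" shows "finite (cuts N j)"
proof -
  obtain c where c: "c > 0" "\<And>n j N. n \<in> intlat \<Longrightarrow> infnorm (horiz n) \<le> real N \<Longrightarrow> 1 \<le> N \<Longrightarrow> u n $ j \<noteq> 0 \<Longrightarrow> c / real N ^ CARD('d) \<le> \<bar>u n $ j\<bar>"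
    by (rule u_separated) (rule that)
  define \<sigma> where "\<sigma> = c / real (2 * N) ^ CARD('d)"
  have \<sigma>: "\<sigma> > 0" using c(1) assms by (simp add: \<sigma>_def)
  obtain K :: nat where "1 / \<sigma> \<le> real K" using real_arch_simple by blast
  then have K: "1 - 0 \<le> real K * \<sigma>" using \<sigma> by (simp add: pos_divide_le_eq)
  have sub: "cuts N j \<subseteq> {0..1}" by (auto simp: cuts_def)
  have "finite (cuts N j) \<and> card (cuts N j) \<le> K + 1"
    by (rule card_separated_le[OF \<sigma> _ sub K]) (unfold \<sigma>_def, rule cuts_separated[OF c(2) assms])
  then show ?thesis ..
qed

lemma u_notin_cuts: 
  assumes "t \<in> T" shows "u t $ j \<notin> cuts N j"
proof
  assume "u t $ j \<in> cuts N j"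
  then obtain n where n: "n \<in> intlat" "u t $ j = u n $ j" by (auto simp: cuts_def)
  have "t - n \<in> lat_shift s" using lat_shift_add[OF _ intlat_uminus[OF n(1)], of t s] assms T_lat by auto
  from u_not_int[OF this, of j] show False using n(2) by simp
qed

lemma
  assumes N: "N \<ge> 1" and t: "t \<in> T"
  shows lo_cut: "lo N t $ j \<in> cuts N j" and lo_less: "lo N t $ j < u t $ j"
    and hi_cut: "hi N t $ j \<in> cuts N j" and less_hi: "u t $ j < hi N t $ j"
    and lo_max: "\<And>x. x \<in> cuts N j \<Longrightarrow> x < u t $ j \<Longrightarrow> x \<le> lo N t $ j"
    and hi_min: "\<And>x. x \<in> cuts N j \<Longrightarrow> u t $ j < x \<Longrightarrow> hi N t $ j \<le> x"
proof -
  have "0 \<in> {x \<in> cuts N j. x < u t $ j}" "1 \<in> {x \<in> cuts N j. u t $ j < x}"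
    using cuts_0_1 T_bounds[OF t] by auto
  then have ne: "{x \<in> cuts N j. x < u t $ j} \<noteq> {}" "{x \<in> cuts N j. u t $ j < x} \<noteq> {}" by blast+
  have fin: "finite {x \<in> cuts N j. x < u t $ j}" "finite {x \<in> cuts N j. u t $ j < x}"
    using finite_cuts[OF N] by auto
  show "lo N t $ j \<in> cuts N j" "lo N t $ j < u t $ j"
    using Max_in[OF fin(1) ne(1)] by (auto simp: lo_def)
  show "hi N t $ j \<in> cuts N j" "u t $ j < hi N t $ j"
    using Min_in[OF fin(2) ne(2)] by (auto simp: hi_def)
  show "x \<in> cuts N j \<Longrightarrow> x < u t $ j \<Longrightarrow> x \<le> lo N t $ j" for x
    using Max_ge[OF fin(1)] by (auto simp: lo_def)
  show "x \<in> cuts N j \<Longrightarrow> u t $ j < x \<Longrightarrow> hi N t $ j \<le> x" for x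
    using Min_le[OF fin(2)] by (auto simp: hi_def)
qed

lemma cell_iff:
  assumes N: "N \<ge> 1" and t: "t \<in> T" "t1 \<in> T"
  shows "u t \<in> bx (lo N t1) (hi N t1) \<longleftrightarrow> lo N t = lo N t1 \<and> hi N t = hi N t1"
proof
  assume "lo N t = lo N t1 \<and> hi N t = hi N t1"
  then show "u t \<in> bx (lo N t1) (hi N t1)"
    using lo_less[OF N t(1)] less_hi[OF N t(1)] by (simp add: bx_def)
next
  assume b: "u t \<in> bx (lo N t1) (hi N t1)"
  have "lo N t $ j = lo N t1 $ j \<and> hi N t $ j = hi N t1 $ j" for j
  proof -
    have l: "lo N t1 $ j < u t $ j" "u t $ j < hi N t1 $ j" using b by (auto simp: bx_def)
    have 1: "lo N t1 $ j \<le> lo N t $ j" using lo_max[OF N t(1) lo_cut[OF N t(2)] l(1)] .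
    have 2: "hi N t $ j \<le> hi N t1 $ j" using hi_min[OF N t(1) hi_cut[OF N t(2)] l(2)] .
    have ne: "lo N t $ j \<noteq> u t1 $ j" "hi N t $ j \<noteq> u t1 $ j"
      using u_notin_cuts[OF t(2)] lo_cut[OF N t(1)] hi_cut[OF N t(1)] by metis+
    have 3: "lo N t $ j < u t1 $ j"
    proof (rule ccontr)
      assume "\<not> ?thesis"
      then have "u t1 $ j < lo N t $ j" using ne by simp
      then have "hi N t1 $ j \<le> lo N t $ j" by (rule hi_min[OF N t(2) lo_cut[OF N t(1)]])
      then show False using l lo_less[OF N t(1), of j] by linarith
    qed
    have 4: "u t1 $ j < hi N t $ j"
    proof (rule ccontr)
      assume "\<not> ?thesis"
      then have "hi N t $ j < u t1 $ j" using ne by simp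
      then have "hi N t $ j \<le> lo N t1 $ j" by (rule lo_max[OF N t(2) hi_cut[OF N t(1)]])
      then show False using l less_hi[OF N t(1), of j] by linarith
    qed
    have "lo N t $ j \<le> lo N t1 $ j" using 3 by (rule lo_max[OF N t(2) lo_cut[OF N t(1)]])
    moreover have "hi N t1 $ j \<le> hi N t $ j" using 4 by (rule hi_min[OF N t(2) hi_cut[OF N t(1)]])
    ultimately show ?thesis using 1 2 by simp
  qed
  then show "lo N t = lo N t1 \<and> hi N t = hi N t1" by (simp add: vec_eq_iff)
qed

text \<open>For fixed n, membership of t + n in T can change in direction j only where the
  coordinate of t crosses that of -n or of \<open>w j - n\<close>. Both are cuts when they fall into
  the unit interval, so inside a cell there is no crossing.\<close>

lemma pat_subset_if_same_cell:
  assumes N: "N \<ge> 1" and S: "S \<subseteq> intlat" "\<And>n. n \<in> S \<Longrightarrow> (\<forall>j. \<bar>u n $ j\<bar> < 1) \<Longrightarrow> infnorm (horiz n) \<le> real N"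
    and t: "t \<in> T" "t' \<in> T" "lo N t = lo N t'" "hi N t = hi N t'"
  shows "pat S t \<subseteq> pat S t'"
proof
  fix n assume "n \<in> pat S t"
  then have n: "n \<in> S" "t + n \<in> T" by (auto simp: pat_def)
  have int: "n \<in> intlat" using n S by auto
  have un: "\<bar>u n $ j\<bar> < 1" for j using T_bounds(1,2)[OF t(1), of j] T_bounds(1,2)[OF n(2), of j] by simp
  have hn: "infnorm (horiz n) \<le> real N" using S(2) n(1) un by blast
  have "0 < u (t' + n) $ j \<and> u (t' + n) $ j < 1" for j
  proof
    note b = T_bounds(1,2)[OF t(1), of j] T_bounds(1,2)[OF t(2), of j] T_bounds(1,2)[OF n(2), of j]
    show "0 < u (t' + n) $ j"
    proof (rule ccontr)
      assume "\<not> ?thesis"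
      then have le: "u t' $ j \<le> - u n $ j" by simp
      have "- u n $ j \<in> cuts N j"
        unfolding cuts_def using int hn b le by (auto intro!: bexI[of _ "- n"] intlat_uminus simp: infnorm_neg)
      moreover have "- u n $ j < u t $ j" using b by simp
      ultimately have "- u n $ j \<le> lo N t $ j" by (rule lo_max[OF N t(1)])
      then show False using lo_less[OF N t(2), of j] t(3) le by simp
    qed
    show "u (t' + n) $ j < 1"
    proof (rule ccontr)
      assume "\<not> ?thesis"
      then have le: "1 - u n $ j \<le> u t' $ j" by simp
      have "1 - u n $ j \<in> cuts N j"
        unfolding cuts_def
      proof (intro CollectI bexI[of _ "w j - n"] conjI)
        show "infnorm (horiz (w j - n)) \<le> real N" using hn by (simp add: infnorm_neg)
        show "1 - u n $ j = u (w j - n) $ j" by simp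
        show "0 \<le> 1 - u n $ j" "1 - u n $ j \<le> 1" using un[of j] le b by linarith+
        show "w j - n \<in> intlat" by (rule intlat_diff[OF w(2) int])
      qed
      moreover have "u t $ j < 1 - u n $ j" using b by simp
      ultimately have "hi N t $ j \<le> 1 - u n $ j" by (rule hi_min[OF N t(1)])
      then show False using less_hi[OF N t(2), of j] t(4) le by simp
    qed
  qed
  then have "t' + n \<in> T" unfolding T_def using t(2) T_lat int by (auto intro: lat_shift_add)
  then show "n \<in> pat S t'" using n(1) by (simp add: pat_def)
qed

text \<open>Each class of patches is a union of boundedly many cells of the product partition cut out by
  the outer radius, and the asymptotic share of a cell depends on its side lengths only.\<close>
lemma card_pat_freq_bounded:
  assumes \<kappa>: "\<kappa> \<ge> (1::nat)"
  shows "\<exists>C::nat. \<forall>S N. S \<subseteq> intlat \<longrightarrow>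
     (N \<ge> 1 \<longrightarrow> near N \<subseteq> S) \<longrightarrow>
     (\<forall>n\<in>S. (\<forall>j. \<bar>u n $ j\<bar> < 1) \<longrightarrow> infnorm (horiz n) \<le> real (\<kappa> * (N + 1))) \<longrightarrow>
     finite (pat_freq S ` T) \<and> card (pat_freq S ` T) \<le> C"
proof -
  let ?d = "CARD('d)" and ?e = "CARD('e)"
  obtain c where c: "c > 0" "\<And>n j N. n \<in> intlat \<Longrightarrow> infnorm (horiz n) \<le> real N \<Longrightarrow> 1 \<le> N \<Longrightarrow> u n $ j \<noteq> 0 \<Longrightarrow> c / real N ^ CARD('d) \<le> \<bar>u n $ j\<bar>"
    by (rule u_separated) (rule that)
  obtain C where C: "C \<ge> 1" "\<And>(N::nat) y j. \<exists>n\<in>intlat. infnorm (horiz n) \<le> N \<and> 0 \<le> y - u n $ j \<and> y - u n $ j < C / real (N + 1) ^ CARD('d)"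
    by (rule u_coord_dense) (rule that)
  \<comment> \<open>K bounds how many separations \<sigma> fit into length 4G. The powers of N + 1
    in G and \<sigma> cancel, so K does not depend on N.\<close>
  obtain K :: nat where K: "4 * C * (4 * real \<kappa>) ^ ?d / c \<le> real K" using real_arch_simple by blast
  define q where "q = K + 1"
  \<comment> \<open>\<open>C3\<close> bounds the cells in a class, each given by two corners, and
    \<open>C1\<close> the possible vectors of side lengths. The final bound counts the ways to
    assign a multiplicity 0..\<open>C3\<close> to each of these vectors.\<close>
  define C3 where "C3 = q ^ ?e * q ^ ?e"
  define C1 where "C1 = q ^ ?e"
  show ?thesis
  proof (rule exI[of _ "(C3 + 1) ^ C1"], intro allI impI)
    fix S :: "(real^('d + 'e)) set" and N :: nat
    assume S: "S \<subseteq> intlat"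
      and inner': "1 \<le> N \<longrightarrow> near N \<subseteq> S"
      and outer': "\<forall>n\<in>S. (\<forall>j. \<bar>u n $ j\<bar> < 1) \<longrightarrow> infnorm (horiz n) \<le> real (\<kappa> * (N + 1))"
    have inner: "near N \<subseteq> S" if "1 \<le> N"
      using inner' that by blast
    have outer: "infnorm (horiz n) \<le> real (\<kappa> * (N + 1))" if "n \<in> S" "\<forall>j. \<bar>u n $ j\<bar> < 1" for n
      using outer' that by blast
    define Nm where "Nm = \<kappa> * (N + 1)"
    have Nm: "Nm \<ge> 1" using \<kappa> by (simp add: Nm_def)
    define G where "G = C / real (N + 1) ^ ?d"
    have G0: "G > 0" using C(1) by (simp add: G_def)
    \<comment> \<open>The factor 4 serves the side lengths: they are values at vectors of horizontal
      size 2 \<open>Nm\<close>, and two of them differ by a value at size 4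
      \<open>Nm\<close>.\<close>
    define \<sigma> where "\<sigma> = c / real (4 * Nm) ^ ?d"
    have \<sigma>: "\<sigma> > 0" using c(1) Nm by (simp add: \<sigma>_def)
    have ratio: "4 * G \<le> real K * \<sigma>"
    proof -
      have "4 * G = (4 * C * (4 * real \<kappa>) ^ ?d / c) * \<sigma>"
      proof -
        have "real (4 * Nm) = (4 * real \<kappa>) * real (N + 1)" by (simp add: Nm_def distrib_left)
        then have "\<sigma> = c / ((4 * real \<kappa>) ^ ?d * real (N + 1) ^ ?d)" by (simp only: \<sigma>_def power_mult_distrib)
        then show ?thesis using c(1) \<kappa> by (simp add: G_def)
      qed
      also have "\<dots> \<le> real K * \<sigma>" using K \<sigma> by (intro mult_right_mono) auto
      finally show ?thesis .
    qed
    have \<sigma>2: "\<sigma> \<le> c / real (2 * Nm) ^ ?d"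
      unfolding \<sigma>_def using c(1) Nm by (intro divide_left_mono power_mono mult_pos_pos zero_less_power) auto
    have sep: "\<sigma> \<le> \<bar>x - y\<bar>" if "x \<in> cuts Nm j" "y \<in> cuts Nm j" "x \<noteq> y" for x y j
      using cuts_separated[OF c(2) Nm that] \<sigma>2 by linarith
    have close: "\<bar>u t $ j - u t' $ j\<bar> \<le> G" if t: "t \<in> T" "t' \<in> T" "pat S t = pat S t'" for t t' j
    proof (cases "N \<ge> 1")
      case True
      have "u t' $ j - u t $ j \<le> G" "u t $ j - u t' $ j \<le> G"
        using eq_coords_if_same_pat[OF inner[OF True] C(2)] t unfolding G_def by metis+
      then show ?thesis by linarith
    next
      case False
      then have "N = 0" by simp
      then have "1 \<le> G" using C(1) by (simp add: G_def)
      moreover have "\<bar>u t $ j - u t' $ j\<bar> < 1" 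
        using T_bounds(1,2)[OF t(1), of j] T_bounds(1,2)[OF t(2), of j] by linarith
      ultimately show ?thesis by linarith
    qed
    have "1 * N \<le> \<kappa> * (N + 1)" using \<kappa> by (intro mult_le_mono) auto
    then have NNm: "real N \<le> real Nm" unfolding Nm_def by (simp only: of_nat_le_iff mult_1)
    have lo_near: "u t $ j - lo Nm t $ j \<le> G" if t: "t \<in> T" for t j
    proof -
      obtain n where n: "n \<in> intlat" "infnorm (horiz n) \<le> N" "0 \<le> u t $ j - u n $ j" "u t $ j - u n $ j < G"
        using C(2) unfolding G_def by blast
      show ?thesis
      proof (cases "u n $ j < 0")
        case True
        have "0 \<le> lo Nm t $ j" using T_bounds[OF t] by (intro lo_max[OF Nm t] cuts_0_1)
        then show ?thesis using n True by linarith
      next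
        case False
        have "u n $ j \<in> cuts Nm j"
          unfolding cuts_def using n NNm False T_bounds(2)[OF t, of j] by (auto intro!: bexI[of _ n])
        moreover from this have "u n $ j \<noteq> u t $ j" using u_notin_cuts[OF t] by metis
        ultimately have "u n $ j \<le> lo Nm t $ j" using n(3) by (intro lo_max[OF Nm t]) auto
        then show ?thesis using n by linarith
      qed
    qed
    have hi_near: "hi Nm t $ j - u t $ j \<le> G" if t: "t \<in> T" for t j
    proof -
      \<comment> \<open>Approximating the number G above the coordinate of t from below lands
        strictly above this coordinate and at most G away.\<close>
      obtain n where n: "n \<in> intlat" "infnorm (horiz n) \<le> N" "0 \<le> u t $ j + G - u n $ j" "u t $ j + G - u n $ j < G"
        using C(2) unfolding G_def by blast
      show ?thesis
      proof (cases "u n $ j > 1")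
        case True
        have "hi Nm t $ j \<le> 1" using T_bounds[OF t] by (intro hi_min[OF Nm t] cuts_0_1)
        then show ?thesis using n True by linarith
      next
        case False
        have "u n $ j \<in> cuts Nm j"
          unfolding cuts_def using n NNm False T_bounds(1)[OF t, of j] by (auto intro!: bexI[of _ n])
        then have "hi Nm t $ j \<le> u n $ j" using n(4) by (intro hi_min[OF Nm t]) auto
        then show ?thesis using n by linarith
      qed
    qed
    have cut01: "0 \<le> x \<and> x \<le> 1" if "x \<in> cuts Nm j" for x j using that by (auto simp: cuts_def)
    define cell where "cell t = (lo Nm t, hi Nm t)" for t
    define Cells where "Cells t0 = cell ` {t \<in> T. pat S t = pat S t0}" for t0
    define shape where "shape b = snd b - (fst b :: real^'e)" for b
    define Lj where "Lj j = {x. \<exists>n\<in>intlat. infnorm (horiz n) \<le> real (2 * Nm) \<and> x = u n $ j \<and> 0 \<le> x \<and> x \<le> 2 * G}" for j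
    define Len where "Len = {v :: real^'e. \<forall>j. v $ j \<in> Lj j}"
    have Lj: "finite (Lj j) \<and> card (Lj j) \<le> q" for j
      unfolding q_def
    proof (rule card_separated_le[OF \<sigma>])
      show "Lj j \<subseteq> {0..2 * G}" by (auto simp: Lj_def)
      show "2 * G - 0 \<le> real K * \<sigma>" using ratio G0 by linarith
      fix x y assume xy: "x \<in> Lj j" "y \<in> Lj j" "x \<noteq> y"
      then obtain n m where n: "n \<in> intlat" "infnorm (horiz n) \<le> real (2 * Nm)" "x = u n $ j" and m: "m \<in> intlat" "infnorm (horiz m) \<le> real (2 * Nm)" "y = u m $ j"
        by (auto simp: Lj_def)
      have "infnorm (horiz (n - m)) \<le> infnorm (horiz n) + infnorm (horiz m)"
        unfolding horiz_simps(2) by (rule infnorm_diff_le)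
      then have "infnorm (horiz (n - m)) \<le> real (4 * Nm)" using n(2) m(2) by simp
      then have "\<sigma> \<le> \<bar>u (n - m) $ j\<bar>"
        unfolding \<sigma>_def using Nm n m xy(3) by (intro c(2) intlat_diff) auto
      then show "\<sigma> \<le> \<bar>x - y\<bar>" using n m by simp
    qed
    have Len: "finite Len" "card Len \<le> C1"
      unfolding Len_def C1_def using card_vec_set[of Lj q] Lj by blast+
    have shape_Len: "shape (cell t) \<in> Len" if t: "t \<in> T" for t
    proof -
      have "hi Nm t $ j - lo Nm t $ j \<in> Lj j" for j
      proof -
        obtain n m where n: "n \<in> intlat" "infnorm (horiz n) \<le> real Nm" "lo Nm t $ j = u n $ j" and m: "m \<in> intlat" "infnorm (horiz m) \<le> real Nm" "hi Nm t $ j = u m $ j"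
          using lo_cut[OF Nm t, of j] hi_cut[OF Nm t, of j] by (auto simp: cuts_def)
        have "infnorm (horiz (m - n)) \<le> infnorm (horiz m) + infnorm (horiz n)"
          unfolding horiz_simps(2) by (rule infnorm_diff_le)
        then have "infnorm (horiz (m - n)) \<le> real (2 * Nm)" using n(2) m(2) by simp
        moreover have "0 \<le> hi Nm t $ j - lo Nm t $ j" "hi Nm t $ j - lo Nm t $ j \<le> 2 * G"
          using lo_less[OF Nm t, of j] less_hi[OF Nm t, of j] lo_near[OF t, of j] hi_near[OF t, of j] by linarith+
        ultimately show ?thesis unfolding Lj_def n m
          using intlat_diff[OF m(1) n(1)] by (intro CollectI bexI[of _ "m - n"]) auto
      qed
      then show ?thesis by (simp add: Len_def shape_def cell_def)
    qed
    have Cells: "finite (Cells t0) \<and> card (Cells t0) \<le> C3" if t0: "t0 \<in> T" for t0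
    proof -
      \<comment> \<open>One G accounts for the spread of the class of \<open>t0\<close>, the other
        for the distance from a point to the corners of its cell.\<close>
      define X where "X j = cuts Nm j \<inter> {u t0 $ j - 2 * G..u t0 $ j + 2 * G}" for j
      have X: "finite (X j) \<and> card (X j) \<le> q" for j
        unfolding q_def
        by (rule card_separated_le[OF \<sigma>, of _ "u t0 $ j - 2 * G" "u t0 $ j + 2 * G"]) (use sep ratio in \<open>auto simp: X_def\<close>)
      let ?V = "{v :: real^'e. \<forall>j. v $ j \<in> X j}"
      have V: "finite ?V" "card ?V \<le> q ^ ?e" using card_vec_set[of X q] X by blast+
      have sub: "Cells t0 \<subseteq> ?V \<times> ?V"
      proof
        fix b assume "b \<in> Cells t0"
        then obtain t where t: "t \<in> T" "pat S t = pat S t0" "b = cell t" by (auto simp: Cells_def)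
        have "lo Nm t $ j \<in> X j \<and> hi Nm t $ j \<in> X j" for j
          using lo_less[OF Nm t(1), of j] less_hi[OF Nm t(1), of j] lo_near[OF t(1), of j] hi_near[OF t(1), of j]
            close[OF t(1) t0 t(2), of j] lo_cut[OF Nm t(1), of j] hi_cut[OF Nm t(1), of j]
          by (simp add: X_def abs_le_iff)
        then show "b \<in> ?V \<times> ?V" by (simp add: t(3) cell_def)
      qed
      have fin: "finite (?V \<times> ?V)" using V(1) by (rule finite_cartesian_product[OF _ V(1)])
      have "finite (Cells t0)" "card (Cells t0) \<le> card (?V \<times> ?V)"
        by (rule finite_subset[OF sub fin], rule card_mono[OF fin sub])
      moreover have "card (?V \<times> ?V) \<le> C3" using V by (simp add: card_cartesian_product C3_def mult_le_mono)
      ultimately show ?thesis by linarith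
    qed
    define share where "share b R = real (cnt (bx (fst b) (snd b)) R) / real (total R)" for b R
    \<comment> \<open>One cell for each vector of side lengths; its share replaces those of all
      cells of this shape up to null functions.\<close>
    define rep where "rep v = (SOME b. b \<in> cell ` T \<and> shape b = v)" for v
    have rep: "rep (shape b) \<in> cell ` T \<and> shape (rep (shape b)) = shape b" if "b \<in> cell ` T" for b
      unfolding rep_def by (rule someI[of _ b]) (use that in auto)
    have share_rep: "((\<lambda>R. share b R - share (rep (shape b)) R) \<longlongrightarrow> 0) at_top" if b: "b \<in> cell ` T" for b
    proof -
      obtain t where t: "t \<in> T" "b = cell t" using b by auto
      obtain t' where t': "t' \<in> T" "rep (shape b) = cell t'" using rep[OF b] by auto
      have "shape (cell t') = shape (cell t)" using rep[OF b] t'(2) t(2) by metis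
      then have "hi Nm t - lo Nm t = hi Nm t' - lo Nm t'" by (simp add: shape_def cell_def)
      then have "((\<lambda>R. share (cell t) R - share (cell t') R) \<longlongrightarrow> 0) at_top"
        unfolding share_def cell_def fst_conv snd_conv
      proof (rule cnt_bx_asymp)
        show "0 \<le> lo Nm t $ j" "0 \<le> lo Nm t' $ j" "hi Nm t $ j \<le> 1" "hi Nm t' $ j \<le> 1" for j
          using cut01[OF lo_cut[OF Nm t(1)]] cut01[OF lo_cut[OF Nm t'(1)]]
            cut01[OF hi_cut[OF Nm t(1)]] cut01[OF hi_cut[OF Nm t'(1)]] by blast+
      qed
      then show ?thesis unfolding t'(2)[symmetric] t(2)[symmetric] .
    qed
    \<comment> \<open>How often each shape occurs in the class. Restriction to \<open>Len\<close>
      makes these functions elements of a finite function space.\<close>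
    define mult where "mult t0 = (\<lambda>v\<in>Len. card {b \<in> Cells t0. shape b = v})" for t0
    define main where "main m R = (\<Sum>v\<in>Len. real (m v) * share (rep v) R)" for m :: "real^'e \<Rightarrow> nat" and R
    have share_sum: "real (card {t \<in> T. infnorm (p t) \<le> R \<and> pat S t = pat S t0}) / real (total R) = (\<Sum>b\<in>Cells t0. share b R)"
      if t0: "t0 \<in> T" for t0 R
    proof -
      let ?c = "\<lambda>b. {t \<in> T. u t \<in> bx (fst b) (snd b) \<and> infnorm (p t) \<le> R}"
      have cell_mem: "u t \<in> bx (fst b) (snd b) \<longleftrightarrow> cell t = b" if bt: "b \<in> Cells t0" "t \<in> T" for b t
      proof -
        obtain t1 where t1: "t1 \<in> T" "b = cell t1" using bt(1) unfolding Cells_def by blast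
        show ?thesis unfolding t1(2) using cell_iff[OF Nm bt(2) t1(1)] by (auto simp: cell_def)
      qed
      have pat_cell: "pat S t = pat S t1" if "t \<in> T" "t1 \<in> T" "cell t = cell t1" for t t1
        using pat_subset_if_same_cell[OF Nm S outer[folded Nm_def], of t t1] pat_subset_if_same_cell[OF Nm S outer[folded Nm_def], of t1 t] that
        by (auto simp: cell_def)
      \<comment> \<open>Patterns are constant on cells, so a class is exactly the disjoint union of
        its cells and the counts add up.\<close>
      have eq: "{t \<in> T. infnorm (p t) \<le> R \<and> pat S t = pat S t0} = (\<Union>b\<in>Cells t0. ?c b)"
      proof (intro set_eqI iffI)
        fix t assume t: "t \<in> {t \<in> T. infnorm (p t) \<le> R \<and> pat S t = pat S t0}"
        then have "cell t \<in> Cells t0" by (auto simp: Cells_def)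
        then show "t \<in> (\<Union>b\<in>Cells t0. ?c b)" using t cell_mem[of "cell t" t] by blast
      next
        fix t assume "t \<in> (\<Union>b\<in>Cells t0. ?c b)"
        then obtain b where b: "b \<in> Cells t0" "t \<in> T" "u t \<in> bx (fst b) (snd b)" "infnorm (p t) \<le> R" by blast
        then have "cell t = b" using cell_mem by blast
        moreover obtain t1 where t1: "t1 \<in> T" "pat S t1 = pat S t0" "b = cell t1" using b(1) by (auto simp: Cells_def)
        ultimately have "pat S t = pat S t0" using pat_cell[of t t1] b(2) by simp
        then show "t \<in> {t \<in> T. infnorm (p t) \<le> R \<and> pat S t = pat S t0}" using b by simp
      qed
      have "card (\<Union>b\<in>Cells t0. ?c b) = (\<Sum>b\<in>Cells t0. card (?c b))"
      proof (rule card_UN_disjoint)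
        show "finite (Cells t0)" using Cells[OF t0] by simp
        show "\<forall>i\<in>Cells t0. finite (?c i)" using finite_cnt by blast
        show "\<forall>i\<in>Cells t0. \<forall>j\<in>Cells t0. i \<noteq> j \<longrightarrow> ?c i \<inter> ?c j = {}" using cell_mem by blast
      qed
      then show ?thesis unfolding eq by (simp add: share_def cnt_def sum_divide_distrib)
    qed
    have regroup: "(\<Sum>b\<in>Cells t0. share (rep (shape b)) R) = main (mult t0) R" if t0: "t0 \<in> T" for t0 R
    proof -
      have "(\<Sum>b\<in>Cells t0. share (rep (shape b)) R) = (\<Sum>v\<in>Len. \<Sum>b\<in>{b \<in> Cells t0. shape b = v}. share (rep (shape b)) R)"
        using Cells[OF t0] Len(1) shape_Len by (intro sum.group[symmetric]) (auto simp: Cells_def)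
      also have "\<dots> = main (mult t0) R"
        unfolding main_def mult_def by (intro sum.cong refl) simp
      finally show ?thesis .
    qed
    have same: "pat_freq S t0 = pat_freq S t1" if t: "t0 \<in> T" "t1 \<in> T" "mult t0 = mult t1" for t0 t1
    proof -
      have lim: "((\<lambda>R. (\<Sum>b\<in>Cells t. share b R) - main (mult t) R) \<longlongrightarrow> 0) at_top" if "t \<in> T" for t
      proof -
        have "((\<lambda>R. \<Sum>b\<in>Cells t. share b R - share (rep (shape b)) R) \<longlongrightarrow> (\<Sum>b\<in>Cells t. 0)) at_top"
          by (intro tendsto_sum share_rep) (auto simp: Cells_def)
        then show ?thesis by (simp add: sum_subtractf regroup[OF that])
      qed
      have "((\<lambda>R. (\<Sum>b\<in>Cells t0. share b R) - (\<Sum>b\<in>Cells t1. share b R)) \<longlongrightarrow> 0) at_top"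
        using tendsto_diff[OF lim[OF t(1)] lim[OF t(2)]] t(3) by simp
      then show ?thesis unfolding pat_freq_def share_sum[OF t(1)] share_sum[OF t(2)] by (rule Lim_eq_if_diff_tendsto_0)
    qed
    have mult_range: "mult ` T \<subseteq> Len \<rightarrow>\<^sub>E {..C3}"
    proof
      fix m assume "m \<in> mult ` T"
      then obtain t where t: "t \<in> T" "m = mult t" by auto
      have "card {b \<in> Cells t. shape b = v} \<le> C3" for v
        using Cells[OF t(1)] card_mono[of "Cells t" "{b \<in> Cells t. shape b = v}"] by fastforce
      then show "m \<in> Len \<rightarrow>\<^sub>E {..C3}" by (auto simp: t(2) mult_def)
    qed
    have fin: "finite (Len \<rightarrow>\<^sub>E {..C3})" using Len(1) by (intro finite_PiE) auto
    have finm: "finite (mult ` T)" using mult_range fin by (rule finite_subset)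
    define inv_m where "inv_m m = (SOME t. t \<in> T \<and> mult t = m)" for m
    have "pat_freq S t = pat_freq S (inv_m (mult t))" if "t \<in> T" for t
    proof -
      have "inv_m (mult t) \<in> T \<and> mult (inv_m (mult t)) = mult t"
        unfolding inv_m_def by (rule someI[of _ t]) (use that in auto)
      then show ?thesis using same that by metis
    qed
    then have sub: "pat_freq S ` T \<subseteq> (\<lambda>m. pat_freq S (inv_m m)) ` (mult ` T)" by auto
    then have "finite (pat_freq S ` T)" using finm by (meson finite_imageI finite_subset)
    moreover have "card (pat_freq S ` T) \<le> card (mult ` T)"
      using sub finm by (meson card_image_le card_mono finite_imageI order_trans)
    moreover have "card (mult ` T) \<le> card (Len \<rightarrow>\<^sub>E {..C3})" using mult_range fin by (rule card_mono[rotated])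
    moreover have "card (Len \<rightarrow>\<^sub>E {..C3}) = (C3 + 1) ^ card Len" using Len(1) by (simp add: card_PiE)
    moreover have "(C3 + 1) ^ card Len \<le> (C3 + 1) ^ C1" using Len(2) by (intro power_increasing) auto
    ultimately show "finite (pat_freq S ` T) \<and> card (pat_freq S ` T) \<le> (C3 + 1) ^ C1" by linarith
  qed
qed

section \<open>Identification of both types of patches with patterns, and the uniform bound\<close>

definition hits :: "nat \<Rightarrow> (real^('d + 'e)) set \<Rightarrow> real \<Rightarrow> (real^('d + 'e)) set" where
  "hits i \<Omega> r = {n \<in> intlat. (if i = 1 then p n else graph_emb A (horiz n)) \<in> (*\<^sub>R) r ` \<Omega>}"

lemma proj_along_graphE_Fsp: "proj_along (graphE A) Fsp v = graph_emb A (horiz v)"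
  by (rule proj_along_eqI[OF subspace_graphE subspace_Fsp graphE_Int_Fsp]) (auto simp: graphE_def mem_Fsp)

lemma patch_eq:
  assumes t: "t \<in> T"
  shows "patch i A F0 W s \<Omega> (p t) r = (\<lambda>n. p (t + n)) ` pat (hits i \<Omega> r) t"
proof -
  define hit where "hit n \<longleftrightarrow> (if i = 1 then p n else graph_emb A (horiz n)) \<in> (*\<^sub>R) r ` \<Omega>" for n
  have "patch i A F0 W s \<Omega> (p t) r = p ` {t' \<in> T. hit (t' - t)}"
  proof (cases "i = 1")
    case True
    have "p t' - p t \<in> (*\<^sub>R) r ` \<Omega> \<longleftrightarrow> hit (t' - t)" for t' using True by (simp add: hit_def)
    then show ?thesis unfolding patch_def cps_eq if_P[OF True] by blast
  next
    case False
    have "proj_along (graphE A) Fsp (lift A F0 W s (p t') - lift A F0 W s (p t)) \<in> (*\<^sub>R) r ` \<Omega> \<longleftrightarrow> hit (t' - t)"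
      if "t' \<in> T" for t'
      using False unfolding hit_def lift_p[OF that] lift_p[OF t] proj_along_graphE_Fsp by simp
    then show ?thesis unfolding patch_def cps_eq if_not_P[OF False] by blast
  qed
  also have "{t' \<in> T. hit (t' - t)} = (\<lambda>n. t + n) ` pat (hits i \<Omega> r) t"
  proof (intro set_eqI iffI)
    fix t' assume t': "t' \<in> {t' \<in> T. hit (t' - t)}"
    then have "t' - t \<in> intlat" using t T_lat by (intro lat_shift_diff[of t' s t]) auto
    then have "t' - t \<in> pat (hits i \<Omega> r) t" using t' by (simp add: pat_def hits_def hit_def)
    then show "t' \<in> (\<lambda>n. t + n) ` pat (hits i \<Omega> r) t"
      by (intro image_eqI[of _ _ "t' - t"]) simp_all
  next
    fix t' assume "t' \<in> (\<lambda>n. t + n) ` pat (hits i \<Omega> r) t"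
    then obtain n where "t' = t + n" "t + n \<in> T" "hit n" unfolding pat_def hits_def hit_def by blast
    then show "t' \<in> {t' \<in> T. hit (t' - t)}" by simp
  qed
  finally show ?thesis by (simp add: image_image)
qed

text \<open>The projection along \<open>F0\<close> is injective on Z^k because \<open>F0\<close>
  meets Z^k only in 0; hence translated patches coincide exactly when their sets of differences
  do.\<close>

lemma patch_equiv_iff:
  assumes t: "t1 \<in> T" "t2 \<in> T"
  shows "patch_equiv i A F0 W s \<Omega> r (p t1) (p t2) \<longleftrightarrow> pat (hits i \<Omega> r) t1 = pat (hits i \<Omega> r) t2"
proof -
  let ?D = "\<lambda>t. pat (hits i \<Omega> r) t"
  have D: "?D t \<subseteq> intlat" for t by (auto simp: pat_def hits_def)
  have inj: "inj_on (\<lambda>n. p (t1 + n)) intlat"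
  proof (rule inj_onI)
    fix n m assume n: "n \<in> intlat" "m \<in> intlat" "p (t1 + n) = p (t1 + m)"
    have "n - m = 0" using n(3) by (intro p_inj_on_intlat[OF intlat_diff[OF n(1,2)]]) simp
    then show "n = m" by simp
  qed
  have "(\<lambda>v. v + (p t1 - p t2)) ` (\<lambda>n. p (t2 + n)) ` ?D t2 = (\<lambda>n. p (t1 + n)) ` ?D t2"
    by (simp add: image_image add.commute)
  then show ?thesis
    unfolding patch_equiv_def patch_eq[OF t(1)] patch_eq[OF t(2)]
    using inj_on_image_eq_iff[OF inj D D] by simp
qed

lemma xi_eq: "xi i A F0 W s \<Omega> r = pat_freq (hits i \<Omega> r) ` T"
proof -
  have pinj: "inj_on p X" if "X \<subseteq> T" for X using inj_on_subset[OF p_inj_on] that T_lat by blast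
  have "freq i A F0 W s \<Omega> r (p t0) = pat_freq (hits i \<Omega> r) t0" if t0: "t0 \<in> T" for t0
  proof -
    have "{y' \<in> cps A F0 W s. infnorm y' \<le> R} = p ` {t \<in> T. infnorm (p t) \<le> R}" for R
      by (auto simp: cps_eq)
    then have 1: "card {y' \<in> cps A F0 W s. infnorm y' \<le> R} = total R" for R
      unfolding total_def by (simp only:) (intro card_image pinj, auto)
    have "{y' \<in> cps A F0 W s. infnorm y' \<le> R \<and> patch_equiv i A F0 W s \<Omega> r y' (p t0)}
       = p ` {t \<in> T. infnorm (p t) \<le> R \<and> pat (hits i \<Omega> r) t = pat (hits i \<Omega> r) t0}" for R
      using patch_equiv_iff[OF _ t0] by (auto simp: cps_eq)
    then have 2: "card {y' \<in> cps A F0 W s. infnorm y' \<le> R \<and> patch_equiv i A F0 W s \<Omega> r y' (p t0)}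
       = card {t \<in> T. infnorm (p t) \<le> R \<and> pat (hits i \<Omega> r) t = pat (hits i \<Omega> r) t0}" for R
      by (simp only:) (intro card_image pinj, auto)
    show ?thesis unfolding freq_def pat_freq_def 1 2 ..
  qed
  then show ?thesis unfolding xi_def cps_eq image_image by (intro image_cong refl)
qed

text \<open>\<Omega> lies between a small and a large ball of E, and the two projections differ by a
  bounded amount on the relevant differences. So the selected differences are squeezed between
  horizontal radii N and \<kappa>(N+1), with \<kappa> independent of r and of the type.\<close>

lemma xi_bounded:
  assumes \<Omega>: "admissible_Omega (graphE A) \<Omega>"
  obtains C :: nat where "\<And>i r. r \<ge> 0 \<Longrightarrow> finite (xi i A F0 W s \<Omega> r) \<and> card (xi i A F0 W s \<Omega> r) \<le> C"
proof -
  obtain K where K: "K \<ge> 0" "\<And>v. (\<forall>j. \<bar>u v $ j\<bar> \<le> 1) \<Longrightarrow> infnorm (p v - graph_emb A (horiz v)) \<le> K"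
    by (rule p_approx) (rule that)
  obtain \<epsilon> where \<epsilon>: "\<epsilon> > 0" "graphE A \<inter> ball 0 \<epsilon> \<subseteq> \<Omega>" using \<Omega> by (auto simp: admissible_Omega_def)
  obtain B where B: "B > 0" "\<And>x. x \<in> \<Omega> \<Longrightarrow> norm x \<le> B" using \<Omega> by (auto simp: admissible_Omega_def bounded_pos)
  define k where "k = sqrt (real DIM(real^('d + 'e)))"
  have "0 < DIM(real^('d + 'e))" by (rule DIM_positive)
  then have "1 \<le> real DIM(real^('d + 'e))" by linarith
  then have k1: "k \<ge> 1" unfolding k_def by (rule real_sqrt_ge_one)
  have k2: "norm x \<le> k * infnorm x" for x :: "real^('d + 'e)" unfolding k_def by (rule norm_le_infnorm)
  note k = k1 k2
  obtain b where b: "b > 0" "\<And>x. norm (graph_emb A x) \<le> b * norm x"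
    using linear_bounded_pos[OF linear_graph_emb] by blast
  define a where "a = b * sqrt (real CARD('d))"
  have a0: "a > 0" using b(1) by (simp add: a_def)
  have a: "norm (graph_emb A x) \<le> a * infnorm x" for x
  proof -
    have "norm (graph_emb A x) \<le> b * norm x" by (rule b)
    also have "\<dots> \<le> b * (sqrt (real CARD('d)) * infnorm x)" using norm_le_infnorm[of x] b(1) by (intro mult_left_mono) auto
    finally show ?thesis by (simp add: a_def mult_ac)
  qed
  define pr where "pr i n = (if i = (1::nat) then p n else graph_emb A (horiz n))" for i n
  have pr: "infnorm (pr i n - graph_emb A (horiz n)) \<le> K" if "\<forall>j. \<bar>u n $ j\<bar> < 1" for i n
  proof -
    have "\<forall>j. \<bar>u n $ j\<bar> \<le> 1" using that less_imp_le by blast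
    from K(2)[OF this] K(1) show ?thesis by (simp add: pr_def infnorm_0)
  qed
  have prE: "pr i n \<in> graphE A" for i n using p_in_graphE by (auto simp: pr_def graphE_def)
  \<comment> \<open>Collects the two bounds used below: r is at most ((a + k K) +
    2a)(N+1)/\<epsilon>, and selected differences have horizontal size at most r B + K.\<close>
  obtain \<kappa> :: nat where \<kappa>: "real \<kappa> \<ge> ((a + k * K) + 2 * a) / \<epsilon> * B + K + 1" using real_arch_simple by blast
  have nn: "0 \<le> ((a + k * K) + 2 * a) / \<epsilon> * B" using a0 k K(1) \<epsilon>(1) B(1) by (intro mult_nonneg_nonneg divide_nonneg_pos add_nonneg_nonneg) auto
  have \<kappa>1: "\<kappa> \<ge> 1" using \<kappa> nn K(1) by linarith
  obtain C :: nat where C: "\<forall>S N. S \<subseteq> intlat \<longrightarrow>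
     (N \<ge> 1 \<longrightarrow> near N \<subseteq> S) \<longrightarrow>
     (\<forall>n\<in>S. (\<forall>j. \<bar>u n $ j\<bar> < 1) \<longrightarrow> infnorm (horiz n) \<le> real (\<kappa> * (N + 1))) \<longrightarrow>
     finite (pat_freq S ` T) \<and> card (pat_freq S ` T) \<le> C"
    using card_pat_freq_bounded[OF \<kappa>1] by (rule exE)
  show ?thesis
  proof (rule that)
    fix i :: nat and r :: real assume r: "r \<ge> 0"
    \<comment> \<open>Subtracting 1 leaves room for a strict inequality, as the ball inside \<Omega>
      is open. For small r the value is 0 and no inner inclusion is claimed.\<close>
    define N where "N = nat \<lfloor>(r * \<epsilon> - k * K) / a - 1\<rfloor>"
    have h: "hits i \<Omega> r = {n \<in> intlat. pr i n \<in> (*\<^sub>R) r ` \<Omega>}" by (simp add: hits_def pr_def)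
    show "finite (xi i A F0 W s \<Omega> r) \<and> card (xi i A F0 W s \<Omega> r) \<le> C"
      unfolding xi_eq
    proof (rule C[THEN spec, THEN spec, THEN mp, THEN mp, THEN mp, of _ N])
      show "hits i \<Omega> r \<subseteq> intlat" by (auto simp: hits_def)
      show "1 \<le> N \<longrightarrow> near N \<subseteq> hits i \<Omega> r"
      proof (intro impI subsetI)
        assume N: "1 \<le> N"
        fix n assume "n \<in> near N"
        then have n: "n \<in> intlat" "\<forall>j. \<bar>u n $ j\<bar> < 1" "infnorm (horiz n) \<le> real N" by (auto simp: near_def)
        have "real N \<le> (r * \<epsilon> - k * K) / a - 1" using N unfolding N_def by linarith
        then have "real N + 1 \<le> (r * \<epsilon> - k * K) / a" by simp
        then have aN: "a * (real N + 1) + k * K \<le> r * \<epsilon>" using a0 by (simp add: pos_le_divide_eq mult.commute)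
        have "norm (pr i n) \<le> norm (graph_emb A (horiz n)) + norm (pr i n - graph_emb A (horiz n))"
          using norm_triangle_ineq[of "graph_emb A (horiz n)" "pr i n - graph_emb A (horiz n)"] by simp
        also have "norm (graph_emb A (horiz n)) \<le> a * real N"
          using n a0 by (intro order_trans[OF a] mult_left_mono) auto
        also have "norm (pr i n - graph_emb A (horiz n)) \<le> k * K"
          using k(1) pr[of n i, OF n(2)] by (intro order_trans[OF k(2)] mult_left_mono) auto
        finally have lt: "norm (pr i n) < r * \<epsilon>" using aN a0 by (simp add: algebra_simps)
        have "r * \<epsilon> > 0" by (rule le_less_trans[OF norm_ge_zero lt])
        then have r0: "r > 0" using \<epsilon>(1) by (simp add: zero_less_mult_iff)
        have "(1 / r) *\<^sub>R pr i n \<in> graphE A" using prE subspace_scale[OF subspace_graphE] by blast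
        moreover have "norm ((1 / r) *\<^sub>R pr i n) < \<epsilon>" using lt r0 by (simp add: field_simps)
        ultimately have "(1 / r) *\<^sub>R pr i n \<in> \<Omega>" using \<epsilon>(2) by auto
        then have "pr i n \<in> (*\<^sub>R) r ` \<Omega>" using r0 by (intro image_eqI[of _ _ "(1 / r) *\<^sub>R pr i n"]) auto
        then show "n \<in> hits i \<Omega> r" using n(1) by (simp add: h)
      qed
      show "\<forall>n\<in>hits i \<Omega> r. (\<forall>j. \<bar>u n $ j\<bar> < 1) \<longrightarrow> infnorm (horiz n) \<le> real (\<kappa> * (N + 1))"
      proof (intro ballI impI)
        fix n assume n: "n \<in> hits i \<Omega> r" "\<forall>j. \<bar>u n $ j\<bar> < 1"
        then obtain x where x: "x \<in> \<Omega>" "pr i n = r *\<^sub>R x" by (auto simp: h)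
        have "infnorm (horiz n) \<le> infnorm (graph_emb A (horiz n))" using infnorm_horiz_le[of "graph_emb A (horiz n)"] by simp
        also have "\<dots> \<le> infnorm (pr i n) + infnorm (pr i n - graph_emb A (horiz n))"
          using infnorm_triangle[of "pr i n" "- (pr i n - graph_emb A (horiz n))"] infnorm_neg[of "pr i n - graph_emb A (horiz n)"] by simp
        also have "infnorm (pr i n - graph_emb A (horiz n)) \<le> K" using pr n(2) by blast
        also have "infnorm (pr i n) \<le> norm (pr i n)" by (rule infnorm_le_norm)
        also have "\<dots> = r * norm x" using r by (simp add: x(2))
        also have "\<dots> \<le> r * B" using B(2)[OF x(1)] r by (intro mult_left_mono)
        finally have up: "infnorm (horiz n) \<le> r * B + K" by simp
        have "(r * \<epsilon> - k * K) / a - 1 \<le> real N + 1" unfolding N_def by linarith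
        then have "(r * \<epsilon> - k * K) / a \<le> real N + 2" by simp
        then have "r * \<epsilon> \<le> a * (real N + 2) + k * K" using a0 by (simp add: pos_divide_le_eq mult.commute)
        also have "\<dots> \<le> ((a + k * K) + 2 * a) * (real N + 1)"
        proof -
          have "0 \<le> k * K * real N" "0 \<le> a * real N" using a0 k K by auto
          then show ?thesis using a0 by (simp add: algebra_simps)
        qed
        finally have "r \<le> ((a + k * K) + 2 * a) * (real N + 1) / \<epsilon>" using \<epsilon>(1) by (simp add: pos_le_divide_eq)
        then have "r * B \<le> ((a + k * K) + 2 * a) * (real N + 1) / \<epsilon> * B" using B(1) by (intro mult_right_mono) auto
        also have "\<dots> = ((a + k * K) + 2 * a) / \<epsilon> * B * (real N + 1)" by simp
        finally have "r * B \<le> ((a + k * K) + 2 * a) / \<epsilon> * B * (real N + 1)" .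
        moreover have "K * 1 \<le> K * (real N + 1)" using K(1) by (intro mult_left_mono) auto
        ultimately have "r * B + K \<le> ((a + k * K) + 2 * a) / \<epsilon> * B * (real N + 1) + K * (real N + 1)" by linarith
        also have "\<dots> = (((a + k * K) + 2 * a) / \<epsilon> * B + K) * (real N + 1)" by (simp only: distrib_right)
        also have "\<dots> \<le> real \<kappa> * (real N + 1)" using \<kappa> by (intro mult_right_mono) auto
        also have "\<dots> = real (\<kappa> * (N + 1))" by (simp add: distrib_left)
        finally show "infnorm (horiz n) \<le> real (\<kappa> * (N + 1))" using up by linarith
      qed
    qed
  qed
qed

end

theorem theorem1p1:
  "\<exists>\<L> :: (real^'d::finite^'e::finite) set.
     hausdorff_dim \<L> = real (CARD('d) * CARD('e)) \<and>
     (\<forall>A\<in>\<L>. totally_irrational (graphE A) \<and>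
        (\<forall>F0 \<Omega> s W. admissible_F0 (graphE A) F0 \<and> admissible_Omega (graphE A) \<Omega> \<and>
            is_window W \<and> int_parallelotope W \<and> regular_pt A W s \<longrightarrow>
          (\<exists>C::real. \<forall>r\<ge>0.
              finite (xi 1 A F0 W s \<Omega> r) \<and> real (card (xi 1 A F0 W s \<Omega> r)) \<le> C \<and>
              finite (xi 2 A F0 W s \<Omega> r) \<and> real (card (xi 2 A F0 W s \<Omega> r)) \<le> C)))"
proof (intro exI[of _ bad_matrices] conjI ballI allI impI)
  show "hausdorff_dim (bad_matrices :: (real^'d^'e) set) = real (CARD('d) * CARD('e))"
    by (rule hausdorff_dim_bad_matrices)
  fix A :: "real^'d^'e" assume "A \<in> bad_matrices"
  then have bad: "bad_form (b v* A)" if "b \<in> intlat" "b \<noteq> 0" for b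
    using that by (intro bad_form_if_bad_simult) (auto simp: bad_matrices_def)
  show irr: "totally_irrational (graphE A)" by (rule totally_irrational_graphE[OF bad])
  fix F0 \<Omega> s W
  assume asm: "admissible_F0 (graphE A) F0 \<and> admissible_Omega (graphE A) \<Omega> \<and>
            is_window W \<and> int_parallelotope W \<and> regular_pt A W s"
  then obtain w where w: "\<And>j::'e. w j \<in> Fsp \<inter> intlat" "inj w" "independent (range w)"
      "W = {(\<Sum>j\<in>UNIV. t j *\<^sub>R w j) | t. \<forall>j. 0 \<le> t j \<and> t j \<le> 1}"
    by (auto simp: int_parallelotope_def)
  interpret cut_project A F0 w W s
    by unfold_locales (use asm w bad irr in auto)
  obtain C where C: "\<And>i r. r \<ge> 0 \<Longrightarrow> finite (xi i A F0 W s \<Omega> r) \<and> card (xi i A F0 W s \<Omega> r) \<le> C"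
    using asm by (rule_tac xi_bounded[of \<Omega>]) blast+
  then show "\<exists>C::real. \<forall>r\<ge>0.
              finite (xi 1 A F0 W s \<Omega> r) \<and> real (card (xi 1 A F0 W s \<Omega> r)) \<le> C \<and>
              finite (xi 2 A F0 W s \<Omega> r) \<and> real (card (xi 2 A F0 W s \<Omega> r)) \<le> C"
    by (intro exI[of _ "real C"]) auto
qed

end
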